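(* There is $\beta_0<\infty$ such that for all $\beta\ge\beta_0$ the following holds. Let $V_n=\{-n,\dots,n\}\subset\mathbb{Z}$ and let $\mu\in\mathcal{M}$ be such that $$s(\mu|\nu_\beta^+):=\lim_{n\to\infty}\frac{1}{2n+1}S_{V_n}(\mu|\nu_\beta^+)=0$$ and $$\lim_{n\to\infty}\mu\Big(\exp\Big[2\beta\sum_{i=-n}^n(1-\eta(i))\Big]\Big)\,2^n\exp[-\beta n]=0$$ (where $\eta$ denotes the configuration integrated over). Then $\mu\in\mathcal{G}(\Gamma)$.
   Context: Ising model on $\mathbb{Z}^2$ at zero field: for finite $\Lambda\subset\mathbb{Z}^2$, $\mu^+_{\Lambda,\beta}$ is the probability measure on $\{\pm1\}^\Lambda$ with weights proportional to $\exp[\beta\sum_{\langle xy\rangle:\{x,y\}\cap\Lambda\ne\emptyset}(\sigma_x\sigma_y-1)]$ (nearest neighbour pairs, $\sigma_y=+1$ for $y\notin\Lambda$); $\mu_\beta^+=\lim_\Lambda\mu^+_{\Lambda,\beta}$ is the plus phase with random field $X$. $\Omega=\{\pm1\}^{\mathbb{Z}}$, $\Omega_V=\{\pm1\}^V$; $\nu_\beta^+$ is the law on $\Omega$ of $(X((i,0)))_{i\in\mathbb{Z}}$. $\sigma_V\omega_{V^c}$ is the configuration equal to $\sigma$ on $V$ and to $\omega$ off $V$. Specification $\Gamma=\{\gamma_V\}$: with $\Lambda_n=([-n,n]\cap\mathbb{Z})^2$, for finite $V\subset\mathbb{Z}$, $\sigma\in\Omega_V$, $\omega\in\Omega$, $$\gamma_V(\sigma|\omega)=\lim_{n\to\infty}\mu^+_{\Lambda_n,\beta}\big(X(i,0)=\sigma_i,\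 i\in V\,\big|\,X(i,0)=\omega_i,\ i\in[-n,n]\setminus V\big).$$ This is the monotone right-continuous specification with which $\nu_\beta^+$ is consistent. $\mu\in\mathcal{G}(\Gamma)$ means that for every finite $V\subset\mathbb{Z}$ and every bounded measurable $f$, $\int d\mu(\omega)\sum_{\sigma\in\Omega_V}\gamma_V(\sigma|\omega)f(\sigma_V\omega_{V^c})=\int f\,d\mu$. For $1\le\alpha<9/8$ and $i\in\mathbb{Z}$ ($\mathbb{N}=\{1,2,\dots\}$): $l_i^{\alpha,+}(\sigma)=\min\{n\in\mathbb{N}:\forall k\ge n,\ \frac1k\sum_{j=0}^{k-1}\sigma_{i+j}\ge\frac89\alpha\}$ and $l_i^{\alpha,-}(\sigma)=\min\{n\in\mathbb{N}:\forall k\ge n,\ \frac1k\sum_{j=0}^{k-1}\sigma_{i-j}\ge\frac89\alpha\}$ ($=\infty$ if there is no such $n$). $\mathcal{M}_\alpha$ is the set of translation invariant probability measures $\mu$ on $\Omega$ for which there is $c>0$ with $\mu[l_0^{\alpha,\pm}>n]\le e^{-cn}$ for all $n\in\mathbb{N}$ (both signs); $\mathcal{M}=\bigcup_{\alpha>1}\mathcal{M}_\alpha$. Relative entropy: $S_V(\mu|\nu)=\sum_{\sigma\in\Omega_V}\mu_V(\sigma)\log\frac{\mu_V(\sigma)}{\nu_V(\sigma)}$ if $\mu_V$ is absolutely continuous with respect to $\nu_V$, $+\infty$ otherwise ($0\log0=0$; $\mu_V$ is the marginal on $\Omega_V$). *)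

theory Defs
  imports "HOL-Probability.Probability" "HOL-Library.Extended_Nat"
begin

definition spins :: "real set" where
  "spins = {-1, 1}"

text \<open>The measurable space \<open>{-1,1}\<^sup>S\<close> with its product \<open>\<sigma>\<close>-algebra. For finite \<open>S\<close> its points are
  extensional functions, i.e. \<open>undefined\<close> off \<open>S\<close>.\<close>

definition configs :: "'s set \<Rightarrow> ('s \<Rightarrow> real) measure" where
  "configs S = PiM S (\<lambda>_. count_space spins)"

definition glue :: "'s set \<Rightarrow> ('s \<Rightarrow> real) \<Rightarrow> ('s \<Rightarrow> real) \<Rightarrow> ('s \<Rightarrow> real)" where
  "glue V \<sigma> \<omega> = (\<lambda>i. if i \<in> V then \<sigma> i else \<omega> i)"


subsection \<open>The Ising model on the square lattice at zero field\<close>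

definition neighbours :: "int \<times> int \<Rightarrow> int \<times> int \<Rightarrow> bool" where
  "neighbours x y \<longleftrightarrow> \<bar>fst x - fst y\<bar> + \<bar>snd x - snd y\<bar> = 1"

definition bonds :: "(int \<times> int) set \<Rightarrow> (int \<times> int) set set" where
  "bonds \<Lambda> = {{x, y} | x y. neighbours x y \<and> {x, y} \<inter> \<Lambda> \<noteq> {}}"

text \<open>A bond is an unordered pair \<open>{x, y}\<close>, so the product over its elements is \<open>\<sigma>\<^sub>x \<sigma>\<^sub>y\<close>;
  the configuration is continued by \<open>+1\<close> outside \<open>\<Lambda>\<close>.\<close>

definition ising_weight :: "(int \<times> int) set \<Rightarrow> real \<Rightarrow> (int \<times> int \<Rightarrow> real) \<Rightarrow> real" where
  "ising_weight \<Lambda> \<beta> \<sigma> =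
     exp (\<beta> * (\<Sum>e\<in>bonds \<Lambda>. (\<Prod>z\<in>e. glue \<Lambda> \<sigma> (\<lambda>_. 1) z) - 1))"

definition ising_plus_finite ::
    "(int \<times> int) set \<Rightarrow> real \<Rightarrow> (int \<times> int \<Rightarrow> real) measure" where
  "ising_plus_finite \<Lambda> \<beta> =
     point_measure (space (configs \<Lambda>))
       (\<lambda>\<sigma>. ennreal (ising_weight \<Lambda> \<beta> \<sigma> / (\<Sum>\<tau>\<in>space (configs \<Lambda>). ising_weight \<Lambda> \<beta> \<tau>)))"

text \<open>The infinite-volume limit is weak convergence, i.e. convergence of the probabilities of all
  cylinder events, along the net of all finite \<open>\<Lambda>\<close> ordered by inclusion. The value of the event
  for the \<open>\<Lambda>\<close> that do not contain \<open>A\<close> plays no role in this limit.\<close>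

definition is_plus_phase :: "real \<Rightarrow> (int \<times> int \<Rightarrow> real) measure \<Rightarrow> bool" where
  "is_plus_phase \<beta> P \<longleftrightarrow>
     prob_space P \<and> sets P = sets (configs UNIV) \<and>
     (\<forall>A a. finite A \<longrightarrow> a \<in> space (configs A) \<longrightarrow>
        ((\<lambda>\<Lambda>. \<P>(X in ising_plus_finite \<Lambda> \<beta>. \<forall>x\<in>A. X x = a x))
           \<longlongrightarrow> \<P>(X in P. \<forall>x\<in>A. X x = a x)) (finite_subsets_at_top UNIV))"

definition plus_phase :: "real \<Rightarrow> (int \<times> int \<Rightarrow> real) measure" where
  "plus_phase \<beta> = (THE P. is_plus_phase \<beta> P)"

definition nu_plus :: "real \<Rightarrow> (int \<Rightarrow> real) measure" where
  "nu_plus \<beta> = distr (plus_phase \<beta>) (configs UNIV) (\<lambda>X i. X (i, 0))"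


subsection \<open>The specification on the line\<close>

definition box :: "nat \<Rightarrow> (int \<times> int) set" where
  "box n = {- int n..int n} \<times> {- int n..int n}"

definition gamma :: "real \<Rightarrow> int set \<Rightarrow> (int \<Rightarrow> real) \<Rightarrow> (int \<Rightarrow> real) \<Rightarrow> real" where
  "gamma \<beta> V \<sigma> \<omega> =
     lim (\<lambda>n. \<P>(X in ising_plus_finite (box n) \<beta>.
        (\<forall>i\<in>V. X (i, 0) = \<sigma> i) \<bar> (\<forall>i\<in>{- int n..int n} - V. X (i, 0) = \<omega> i)))"

definition gibbs :: "real \<Rightarrow> (int \<Rightarrow> real) measure set" where
  "gibbs \<beta> = {\<mu>. prob_space \<mu> \<and> sets \<mu> = sets (configs UNIV) \<and>
     (\<forall>V f. finite V \<longrightarrow> f \<in> borel_measurable (configs UNIV) \<longrightarrow>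
        (\<exists>C. \<forall>\<omega>\<in>space (configs UNIV). \<bar>f \<omega>\<bar> \<le> C) \<longrightarrow>
        (\<integral>\<omega>. (\<Sum>\<sigma>\<in>space (configs V). gamma \<beta> V \<sigma> \<omega> * f (glue V \<sigma> \<omega>)) \<partial>\<mu>)
          = (\<integral>\<omega>. f \<omega> \<partial>\<mu>))}"


subsection \<open>Measures with exponentially controlled magnetization\<close>

text \<open>In \<^typ>\<open>enat\<close> the infimum of a nonempty set is its minimum, and \<open>Inf {} = \<infinity>\<close>.\<close>

definition l_plus :: "real \<Rightarrow> int \<Rightarrow> (int \<Rightarrow> real) \<Rightarrow> enat" where
  "l_plus \<alpha> i \<sigma> = Inf (enat ` {n. n \<ge> 1 \<and>
     (\<forall>k\<ge>n. (1 / real k) * (\<Sum>j = 0..k - 1. \<sigma> (i + int j)) \<ge> 8 / 9 * \<alpha>)})"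

definition l_minus :: "real \<Rightarrow> int \<Rightarrow> (int \<Rightarrow> real) \<Rightarrow> enat" where
  "l_minus \<alpha> i \<sigma> = Inf (enat ` {n. n \<ge> 1 \<and>
     (\<forall>k\<ge>n. (1 / real k) * (\<Sum>j = 0..k - 1. \<sigma> (i - int j)) \<ge> 8 / 9 * \<alpha>)})"

definition translation_invariant :: "(int \<Rightarrow> real) measure \<Rightarrow> bool" where
  "translation_invariant \<mu> \<longleftrightarrow>
     (\<forall>k. distr \<mu> (configs UNIV) (\<lambda>\<sigma> i. \<sigma> (i + k)) = \<mu>)"

definition M_class :: "real \<Rightarrow> (int \<Rightarrow> real) measure set" where
  "M_class \<alpha> = {\<mu>. prob_space \<mu> \<and> sets \<mu> = sets (configs UNIV) \<and> translation_invariant \<mu> \<and>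
     (\<exists>c>0. \<forall>n\<ge>1. \<P>(\<sigma> in \<mu>. l_plus \<alpha> 0 \<sigma> > enat n) \<le> exp (- c * real n) \<and>
                    \<P>(\<sigma> in \<mu>. l_minus \<alpha> 0 \<sigma> > enat n) \<le> exp (- c * real n))}"

definition M_all :: "(int \<Rightarrow> real) measure set" where
  "M_all = (\<Union>\<alpha>\<in>{1<..<9 / 8}. M_class \<alpha>)"


subsection \<open>Relative entropy\<close>

definition marginal :: "int set \<Rightarrow> (int \<Rightarrow> real) measure \<Rightarrow> (int \<Rightarrow> real) measure" where
  "marginal V \<mu> = distr \<mu> (configs V) (\<lambda>\<sigma>. restrict \<sigma> V)"

text \<open>The library's \<open>KL_divergence\<close> is real-valued, hence the explicit value \<open>\<infinity>\<close>. The summand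
  vanishes when \<open>\<mu>\<^sub>V(\<sigma>) = 0\<close>, in accordance with \<open>0 log 0 = 0\<close>.\<close>

definition rel_entropy ::
    "int set \<Rightarrow> (int \<Rightarrow> real) measure \<Rightarrow> (int \<Rightarrow> real) measure \<Rightarrow> ereal" where
  "rel_entropy V \<mu> \<nu> =
     (if absolutely_continuous (marginal V \<nu>) (marginal V \<mu>)
      then ereal (\<Sum>\<sigma>\<in>space (configs V). measure (marginal V \<mu>) {\<sigma>} *
             ln (measure (marginal V \<mu>) {\<sigma>} / measure (marginal V \<nu>) {\<sigma>}))
      else \<infinity>)"

end

theory Submission
  imports Defs
begin

text \<open>
The proof has two parts: vanishing relative entropy density forces \<open>\<mu>\<close> to have, in an averaged
sense, the finite-window conditional probabilities of \<open>\<nu> = nu_plus \<beta>\<close>; and along configurations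
with sparse minus spins these conditional probabilities converge to the specification.

For the first part let \<open>H(D)\<close> be the relative entropy of \<open>\<mu>\<close> with respect to \<open>\<nu>\<close> on \<open>D\<close>. The
increment \<open>H(\<Delta>) - H(\<Delta> - V)\<close> is the mean relative entropy of the conditional distributions in \<open>V\<close>
given the spins on \<open>\<Delta> - V\<close>, hence dominates the square of a total variation distance
(\<open>entropy_increment\<close>). Let an interval grow by blocks that contain a translate of \<open>V\<close> in their
middle. By translation invariance the increments add up to at most the entropy of a long interval,
which is \<open>o(n)\<close>, so some increment is small although the window extends far beyond \<open>V\<close> in both
directions (\<open>small_entropy_increment\<close>).

For the second part a configuration is encoded by the set \<open>M\<close> of its minus spins, of weight
\<open>exp (- 2 \<beta> |cut M|)\<close> where \<open>cut M\<close> is the set of broken bonds. Submodularity of \<open>|cut M|\<close> and the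
four functions inequality give a single comparison principle (\<open>avg_mono_interval\<close>), from which
follow the existence of the plus phase and of the specification, and the bound of the specification
by the conditional probabilities of \<open>\<nu>\<close> from one side. For the other side one explores the minus
clusters that start on the line outside the window: if they do not reach \<open>V\<close>, then the spins in \<open>V\<close>
are at least as much plus as with plus spins on that part of the line (\<open>exploration\<close>). If they do,
there is a contour around a site of \<open>V\<close> that reaches out of the window. The spins on the line are
prescribed and must not be flipped, but flipping the inside of a contour \<open>F\<close> and restoring the
prescribed spins gains \<open>2 \<beta> |cut F|\<close> and costs at most \<open>16 \<beta>\<close> for every prescribed minus spin
inside (\<open>contour_weight\<close>). A configuration for which the averages of the definition of \<open>M_class\<close>
eventually exceed \<open>8/9\<close> on both sides has at most \<open>|cut F| / 18\<close> such minus spins up to a constant,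
so the Peierls sum converges for large \<open>\<beta>\<close> and is small for large windows (\<open>far_influence\<close>). Such
configurations have full measure under \<open>\<mu>\<close> (\<open>AE_sparse\<close>).

Dominated convergence combines the two parts: the integral of the specification against a cylinder
event off \<open>V\<close> is the probability of the cylinder under \<open>\<mu>\<close> (\<open>spec_integral\<close>), which is the Gibbs
property on cylinders.
\<close>

section \<open>Edge boundaries of sets of minus spins\<close>

definition cut :: "(int \<times> int) set \<Rightarrow> (int \<times> int) set set" where
  "cut M = {{x, y} | x y. neighbours x y \<and> x \<in> M \<and> y \<notin> M}"

lemma neighbours_sym: "neighbours x y \<longleftrightarrow> neighbours y x"
  by (auto simp: neighbours_def)

lemma neighbours_irrefl: "\<not> neighbours x x"
  by (auto simp: neighbours_def)

lemma pair_in_cut: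
  assumes "neighbours x y"
  shows "{x, y} \<in> cut M \<longleftrightarrow> (x \<in> M) \<noteq> (y \<in> M)"
proof
  assume "{x, y} \<in> cut M"
  then obtain u v where "{x, y} = {u, v}" "u \<in> M" "v \<notin> M" unfolding cut_def by blast
  then show "(x \<in> M) \<noteq> (y \<in> M)" by (metis doubleton_eq_iff)
next
  assume "(x \<in> M) \<noteq> (y \<in> M)"
  then consider "x \<in> M" "y \<notin> M" | "y \<in> M" "x \<notin> M" by blast
  then show "{x, y} \<in> cut M"
  proof cases
    case 1
    with assms show ?thesis unfolding cut_def by blast
  next
    case 2
    moreover have "neighbours y x" "{x, y} = {y, x}" using assms neighbours_sym[of x y] by auto
    ultimately show ?thesis unfolding cut_def by blast
  qed
qed

lemma cutE:
  assumes "e \<in> cut M"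
  obtains x y where "e = {x, y}" "neighbours x y" "x \<in> M" "y \<notin> M"
  using assms by (auto simp: cut_def)

definition edges :: "(int \<times> int) set set" where
  "edges = {{x, y} | x y. neighbours x y}"

lemma cut_subset_edges: "cut M \<subseteq> edges"
  unfolding cut_def edges_def by blast

text \<open>Relations between cuts only have to be checked edge by edge.\<close>

lemma edges_subsetI:
  assumes "X \<subseteq> edges" "\<And>x y. neighbours x y \<Longrightarrow> {x, y} \<in> X \<Longrightarrow> {x, y} \<in> Y"
  shows "X \<subseteq> Y"
  using assms unfolding edges_def by blast

lemma edges_eqI:
  assumes "X \<subseteq> edges" "Y \<subseteq> edges" "\<And>x y. neighbours x y \<Longrightarrow> {x, y} \<in> X \<longleftrightarrow> {x, y} \<in> Y"
  shows "X = Y"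
  using assms unfolding edges_def by blast

lemma cut_empty [simp]: "cut {} = {}"
  by (auto simp: cut_def)

lemma neighbours_set:
  "{y. neighbours x y} = {(fst x + 1, snd x), (fst x - 1, snd x), (fst x, snd x + 1), (fst x, snd x - 1)}"
  by (auto simp: neighbours_def prod_eq_iff abs_if split: if_splits)

lemma finite_neighbours: "finite {y. neighbours x y}"
  and card_neighbours_le: "card {y. neighbours x y} \<le> 4"
proof -
  show "finite {y. neighbours x y}" unfolding neighbours_set by simp
  show "card {y. neighbours x y} \<le> 4" unfolding neighbours_set
    by (intro card_insert_le_m1) (auto simp: card_insert_if)
qed

lemma finite_bonds: assumes "finite \<Lambda>" shows "finite (bonds \<Lambda>)"
proof -
  have "bonds \<Lambda> \<subseteq> (\<lambda>(x, y). {x, y}) ` (SIGMA x:\<Lambda>. {y. neighbours x y})"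
  proof
    fix e assume "e \<in> bonds \<Lambda>"
    then obtain x y where e: "e = {x, y}" "neighbours x y" "x \<in> \<Lambda> \<or> y \<in> \<Lambda>"
      by (auto simp: bonds_def)
    then consider "x \<in> \<Lambda>" | "y \<in> \<Lambda>" by blast
    then show "e \<in> (\<lambda>(x, y). {x, y}) ` (SIGMA x:\<Lambda>. {y. neighbours x y})"
    proof cases
      case 1 then show ?thesis using e by (intro image_eqI[of _ _ "(x, y)"]) auto
    next
      case 2 then show ?thesis using e neighbours_sym
        by (intro image_eqI[of _ _ "(y, x)"]) auto
    qed
  qed
  moreover have "finite ((\<lambda>(x, y). {x, y}) ` (SIGMA x:\<Lambda>. {y. neighbours x y}))"
    using assms finite_neighbours by (intro finite_imageI finite_SigmaI) auto
  ultimately show ?thesis by (rule finite_subset)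
qed

lemma cut_subset_bonds: "M \<subseteq> \<Lambda> \<Longrightarrow> cut M \<subseteq> bonds \<Lambda>"
  unfolding cut_def bonds_def by blast

lemma finite_cut [simp]: "finite M \<Longrightarrow> finite (cut M)"
  using cut_subset_bonds[of M M] finite_bonds finite_subset by blast

text \<open>Submodularity of the edge boundary is what makes the Ising weights log-supermodular.\<close>

lemma cut_submodular:
  assumes "finite A" "finite B"
  shows "card (cut (A \<union> B)) + card (cut (A \<inter> B)) \<le> card (cut A) + card (cut B)"
proof -
  have 1: "cut (A \<union> B) \<union> cut (A \<inter> B) \<subseteq> cut A \<union> cut B"
    by (rule edges_subsetI) (simp_all add: cut_subset_edges le_infI1, auto simp: pair_in_cut)
  have 2: "cut (A \<union> B) \<inter> cut (A \<inter> B) \<subseteq> cut A \<inter> cut B"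
    by (rule edges_subsetI) (simp_all add: cut_subset_edges le_infI1, auto simp: pair_in_cut)
  have "card (cut (A \<union> B)) + card (cut (A \<inter> B))
      = card (cut (A \<union> B) \<union> cut (A \<inter> B)) + card (cut (A \<union> B) \<inter> cut (A \<inter> B))"
    using assms by (intro card_Un_Int) auto
  also have "\<dots> \<le> card (cut A \<union> cut B) + card (cut A \<inter> cut B)"
    using assms 1 2 by (intro add_mono card_mono) auto
  also have "\<dots> = card (cut A) + card (cut B)"
    using assms by (intro card_Un_Int[symmetric]) auto
  finally show ?thesis .
qed

definition nonadjacent :: "(int \<times> int) set \<Rightarrow> (int \<times> int) set \<Rightarrow> bool" where
  "nonadjacent A B \<longleftrightarrow> (\<forall>x\<in>A. \<forall>y\<in>B. \<not> neighbours x y)"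

lemma card_cut_Un:
  assumes "finite A" "finite B" "A \<inter> B = {}" "nonadjacent A B"
  shows "card (cut (A \<union> B)) = card (cut A) + card (cut B)"
proof -
  have N: "\<not> (x \<in> A \<and> y \<in> B)" "\<not> (x \<in> B \<and> y \<in> A)" if "neighbours x y" for x y
    using assms(4) that neighbours_sym[of x y] unfolding nonadjacent_def by metis+
  have "cut (A \<union> B) = cut A \<union> cut B"
  proof (rule edges_eqI)
    fix x y assume n: "neighbours x y"
    show "{x, y} \<in> cut (A \<union> B) \<longleftrightarrow> {x, y} \<in> cut A \<union> cut B"
      using N[OF n] assms(3) by (auto simp: pair_in_cut[OF n])
  qed (simp_all add: cut_subset_edges)
  moreover have "cut A \<inter> cut B \<subseteq> {}"
  proof (rule edges_subsetI)
    fix x y assume n: "neighbours x y" and "{x, y} \<in> cut A \<inter> cut B"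
    then show "{x, y} \<in> {}"
      using N[OF n] assms(3) by (auto simp: pair_in_cut[OF n])
  qed (simp add: cut_subset_edges le_infI1)
  ultimately show ?thesis using assms by (simp add: card_Un_disjoint)
qed

lemma card_cut_singleton: "card (cut {x}) \<le> 4"
proof -
  have "cut {x} \<subseteq> (\<lambda>y. {x, y}) ` {y. neighbours x y}"
    by (auto elim!: cutE)
  then have "card (cut {x}) \<le> card ((\<lambda>y. {x, y}) ` {y. neighbours x y})"
    using finite_neighbours by (intro card_mono) auto
  also have "\<dots> \<le> card {y. neighbours x y}"
    using finite_neighbours by (rule card_image_le)
  finally show ?thesis using card_neighbours_le[of x] by linarith
qed

lemma card_cut_le: "finite A \<Longrightarrow> card (cut A) \<le> 4 * card A"
proof (induction A rule: finite_induct)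
  case (insert x A)
  have "card (cut (insert x A)) \<le> card (cut (A \<union> {x})) + card (cut (A \<inter> {x}))" by simp
  also have "\<dots> \<le> card (cut A) + card (cut {x})"
    using insert by (intro cut_submodular) auto
  finally show ?case using insert card_cut_singleton[of x] by simp
qed simp

text \<open>A site has four bonds, so turning the spins in \<open>A\<close> to minus breaks at most \<open>4 |A|\<close> new bonds.\<close>

lemma card_cut_add:
  assumes "finite M" "finite A"
  shows "card (cut (M \<union> A)) \<le> card (cut M) + 4 * card A"
  using cut_submodular[OF assms] card_cut_le[OF assms(2)] by linarith

lemma card_cut_remove:
  assumes "finite M" "finite A" "M \<inter> A = {}"
  shows "card (cut M) \<le> card (cut (M \<union> A)) + 4 * card A"
proof -
  have "cut M \<subseteq> cut (M \<union> A) \<union> cut A"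
    by (rule edges_subsetI[OF cut_subset_edges]) (use assms(3) in \<open>auto simp: pair_in_cut\<close>)
  then have "card (cut M) \<le> card (cut (M \<union> A) \<union> cut A)"
    using assms by (intro card_mono) auto
  also have "\<dots> \<le> card (cut (M \<union> A)) + card (cut A)" by (rule card_Un_le)
  finally show ?thesis using card_cut_le[OF assms(2)] by linarith
qed

text \<open>\<open>F\<close> is the interior of a Peierls contour of the configuration with minus set \<open>M\<close>: minus just
  inside, plus just outside.\<close>

definition contour :: "(int \<times> int) set \<Rightarrow> (int \<times> int) set \<Rightarrow> bool" where
  "contour F M \<longleftrightarrow> (\<forall>x\<in>F. \<forall>y. y \<notin> F \<longrightarrow> neighbours x y \<longrightarrow> x \<in> M \<and> y \<notin> M)"

text \<open>All bonds across the contour are broken. Inside \<open>F\<close> the broken bonds of \<open>M\<close> are those of the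
  flipped configuration \<open>F - M\<close>, which is plus along the contour and so has no broken bond across
  it; outside they are those of \<open>M - F\<close> for the same reason.\<close>

lemma card_cut_contour:
  assumes "finite M" "finite F" "contour F M"
  shows "card (cut M) = card (cut F) + card (cut (F - M)) + card (cut (M - F))"
proof -
  have C: "x \<in> F \<Longrightarrow> y \<notin> F \<Longrightarrow> x \<in> M \<and> y \<notin> M" "y \<in> F \<Longrightarrow> x \<notin> F \<Longrightarrow> y \<in> M \<and> x \<notin> M"
    if "neighbours x y" for x y
    using assms(3) that neighbours_sym[of x y] unfolding contour_def by metis+
  have "cut M = cut F \<union> cut (F - M) \<union> cut (M - F)"
  proof (rule edges_eqI)
    fix x y assume n: "neighbours x y"
    show "{x, y} \<in> cut M \<longleftrightarrow> {x, y} \<in> cut F \<union> cut (F - M) \<union> cut (M - F)"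
      using C[OF n] by (auto simp: pair_in_cut[OF n])
  qed (simp_all add: cut_subset_edges)
  moreover have "cut F \<inter> cut (F - M) \<subseteq> {}"
  proof (rule edges_subsetI)
    fix x y assume n: "neighbours x y" and "{x, y} \<in> cut F \<inter> cut (F - M)"
    then show "{x, y} \<in> {}"
      using C[OF n] by (auto simp: pair_in_cut[OF n])
  qed (simp add: cut_subset_edges le_infI1)
  moreover have "(cut F \<union> cut (F - M)) \<inter> cut (M - F) \<subseteq> {}"
  proof (rule edges_subsetI)
    fix x y assume n: "neighbours x y" and "{x, y} \<in> (cut F \<union> cut (F - M)) \<inter> cut (M - F)"
    then show "{x, y} \<in> {}"
      using C[OF n] by (auto simp: pair_in_cut[OF n])
  qed (simp add: cut_subset_edges le_infI1)
  ultimately show ?thesis using assms by (simp add: card_Un_disjoint)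
qed

text \<open>A spin flip in \<open>F\<close> preserves the bonds inside \<open>F\<close> and exchanges the broken and the unbroken
  bonds across the boundary of \<open>F\<close>.\<close>

lemma card_cut_Diff:
  assumes "finite F" "M \<subseteq> F"
  shows "card (cut (F - M)) + 2 * card (cut M \<inter> cut F) = card (cut M) + card (cut F)"
proof -
  have fin: "finite (cut M)" "finite (cut F)" using assms finite_subset[OF assms(2,1)] by auto
  have eq: "cut (F - M) = (cut M - cut F) \<union> (cut F - cut M)"
    by (rule edges_eqI[OF cut_subset_edges])
       (simp add: cut_subset_edges le_supI le_infI1 Diff_eq, use assms(2) in \<open>auto simp: pair_in_cut\<close>)
  have "card (cut (F - M)) = card (cut M - cut F) + card (cut F - cut M)"
    unfolding eq using fin by (intro card_Un_disjoint) auto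
  moreover have "card (cut M - cut F) + card (cut M \<inter> cut F) = card (cut M)"
    using fin(1) by (metis add.commute card_Int_Diff)
  moreover have "card (cut F - cut M) + card (cut M \<inter> cut F) = card (cut F)"
    using fin(2) by (metis add.commute card_Int_Diff Int_commute)
  ultimately show ?thesis by linarith
qed


section \<open>The four functions inequality\<close>

lemma four_functions_point:
  fixes a0 a1 b0 b1 c0 c1 d0 d1 :: real
  assumes nn: "a0 \<ge> 0" "a1 \<ge> 0" "b0 \<ge> 0" "b1 \<ge> 0" "c0 \<ge> 0" "c1 \<ge> 0" "d0 \<ge> 0" "d1 \<ge> 0"
    and "a0 * b0 \<le> c0 * d0" "a0 * b1 \<le> c1 * d0" "a1 * b0 \<le> c1 * d0" "a1 * b1 \<le> c1 * d1"
  shows "(a0 + a1) * (b0 + b1) \<le> (c0 + c1) * (d0 + d1)"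
proof (cases "c1 * d0 = 0")
  case True
  then have "a0 * b1 = 0" "a1 * b0 = 0"
    using assms by (metis antisym mult_nonneg_nonneg)+
  moreover have "c0 * d1 \<ge> 0" using nn by simp
  moreover have "(a0 + a1) * (b0 + b1) = a0 * b0 + a0 * b1 + a1 * b0 + a1 * b1"
    "(c0 + c1) * (d0 + d1) = c0 * d0 + c0 * d1 + c1 * d0 + c1 * d1"
    by (simp_all add: algebra_simps)
  ultimately show ?thesis using assms(9,12) True by linarith
next
  case False
  define X where "X = c1 * d0"
  have X: "X > 0" using False nn unfolding X_def by (metis less_eq_real_def mult_nonneg_nonneg)
  \<comment> \<open>The two mixed products are at most \<open>X\<close>; expanding this product bounds their sum.\<close>
  have "0 \<le> (X - a0 * b1) * (X - a1 * b0)"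
    using assms X_def by (intro mult_nonneg_nonneg) auto
  then have 1: "X * (a0 * b1 + a1 * b0) \<le> X * X + (a0 * b0) * (a1 * b1)"
    by (simp add: algebra_simps)
  have "(a0 * b0) * (a1 * b1) \<le> (c0 * d0) * (c1 * d1)"
    using assms by (intro mult_mono[of "a0 * b0" "c0 * d0"]) auto
  also have "\<dots> = X * (c0 * d1)" by (simp add: X_def)
  finally have "X * (a0 * b1 + a1 * b0) \<le> X * (X + c0 * d1)"
    using 1 by (simp add: algebra_simps)
  then have "a0 * b1 + a1 * b0 \<le> X + c0 * d1" using X by simp
  then show ?thesis using assms by (simp add: X_def algebra_simps)
qed

lemma sum_Pow_insert:
  fixes f :: "'a set \<Rightarrow> 'b::comm_monoid_add"
  assumes "finite S" "x \<notin> S"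
  shows "sum f (Pow (insert x S)) = (\<Sum>A\<in>Pow S. f A + f (insert x A))"
proof -
  have "sum f (Pow (insert x S)) = sum f (Pow S) + sum f (insert x ` Pow S)"
    unfolding Pow_insert using assms by (intro sum.union_disjoint) auto
  also have "sum f (insert x ` Pow S) = (\<Sum>A\<in>Pow S. f (insert x A))"
    using assms by (subst sum.reindex) (auto simp: inj_on_def)
  finally show ?thesis by (simp add: sum.distrib)
qed

text \<open>The inequality of Ahlswede and Daykin, by summing out one site at a time.\<close>

lemma four_functions:
  fixes a b c d :: "'a set \<Rightarrow> real"
  assumes "finite S"
    and "\<And>A. A \<subseteq> S \<Longrightarrow> a A \<ge> 0" "\<And>A. A \<subseteq> S \<Longrightarrow> b A \<ge> 0" "\<And>A. A \<subseteq> S \<Longrightarrow> c A \<ge> 0" "\<And>A. A \<subseteq> S \<Longrightarrow> d A \<ge> 0"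
    and "\<And>A B. A \<subseteq> S \<Longrightarrow> B \<subseteq> S \<Longrightarrow> a A * b B \<le> c (A \<union> B) * d (A \<inter> B)"
  shows "sum a (Pow S) * sum b (Pow S) \<le> sum c (Pow S) * sum d (Pow S)"
  using assms
proof (induction S arbitrary: a b c d rule: finite_induct)
  case empty
  from empty.prems(5)[of "{}" "{}"] show ?case by simp
next
  case (insert x S)
  have *: "A \<subseteq> insert x S" "insert x A \<subseteq> insert x S" if "A \<subseteq> S" for A using that by auto
  have "(\<Sum>A\<in>Pow S. a A + a (insert x A)) * (\<Sum>A\<in>Pow S. b A + b (insert x A))
      \<le> (\<Sum>A\<in>Pow S. c A + c (insert x A)) * (\<Sum>A\<in>Pow S. d A + d (insert x A))"
  proof (rule insert.IH)
    fix A B assume AB: "A \<subseteq> S" "B \<subseteq> S"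
    then have x: "x \<notin> A" "x \<notin> B" using insert by auto
    note P = insert.prems(5)
    show "(a A + a (insert x A)) * (b B + b (insert x B))
      \<le> (c (A \<union> B) + c (insert x (A \<union> B))) * (d (A \<inter> B) + d (insert x (A \<inter> B)))"
    proof (rule four_functions_point)
      show "a A * b B \<le> c (A \<union> B) * d (A \<inter> B)" using P[of A B] AB by auto
      show "a A * b (insert x B) \<le> c (insert x (A \<union> B)) * d (A \<inter> B)"
        using P[of A "insert x B"] AB x by auto
      show "a (insert x A) * b B \<le> c (insert x (A \<union> B)) * d (A \<inter> B)"
        using P[of "insert x A" B] AB x by auto
      show "a (insert x A) * b (insert x B) \<le> c (insert x (A \<union> B)) * d (insert x (A \<inter> B))"
        using P[of "insert x A" "insert x B"] AB x by auto
    qed (use AB in \<open>auto intro!: insert.prems\<close>)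
  qed (auto intro!: add_nonneg_nonneg insert.prems)
  then show ?case using insert.hyps by (simp add: sum_Pow_insert)
qed


section \<open>Ising weights and their monotonicity\<close>

text \<open>With plus spins outside, a configuration is the set \<open>M\<close> of its minus spins, and its weight depends
  on its broken bonds only. In particular the weight does not refer to the volume: a volume, a
  boundary condition or a prescription of spins only restricts the range of \<open>M\<close>.\<close>

definition bw :: "real \<Rightarrow> (int \<times> int) set \<Rightarrow> real" where
  "bw \<beta> M = exp (- 2 * \<beta> * card (cut M))"

text \<open>The partition function of a set of configurations.\<close>

definition part :: "real \<Rightarrow> (int \<times> int) set set \<Rightarrow> real" where
  "part \<beta> I = (\<Sum>M\<in>I. bw \<beta> M)"

text \<open>The mean under the normalized weights; on an empty set of configurations it is 0.\<close>

definition avg :: "real \<Rightarrow> (int \<times> int) set set \<Rightarrow> ((int \<times> int) set \<Rightarrow> real) \<Rightarrow> real" where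
  "avg \<beta> I f = (\<Sum>M\<in>I. bw \<beta> M * f M) / part \<beta> I"

lemma bw_pos [simp]: "bw \<beta> M > 0" and bw_nonneg [simp]: "bw \<beta> M \<ge> 0"
  by (simp_all add: bw_def)

lemma part_nonneg [simp]: "part \<beta> I \<ge> 0"
  unfolding part_def by (intro sum_nonneg) simp

lemma part_pos: "finite I \<Longrightarrow> I \<noteq> {} \<Longrightarrow> part \<beta> I > 0"
  unfolding part_def by (intro sum_pos) auto

lemma finite_set_interval [simp]: "finite T \<Longrightarrow> finite {B..T :: 'a set}"
  by (rule finite_subset[of _ "Pow T"]) auto

lemma bw_supermodular:
  assumes "\<beta> \<ge> 0" "finite A" "finite B"
  shows "bw \<beta> A * bw \<beta> B \<le> bw \<beta> (A \<union> B) * bw \<beta> (A \<inter> B)"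
proof -
  have "real (card (cut (A \<union> B))) + real (card (cut (A \<inter> B)))
      \<le> real (card (cut A)) + real (card (cut B))"
    using cut_submodular[OF assms(2,3)] by linarith
  then have "2 * \<beta> * (real (card (cut (A \<union> B))) + real (card (cut (A \<inter> B))))
      \<le> 2 * \<beta> * (real (card (cut A)) + real (card (cut B)))"
    using assms(1) by (intro mult_left_mono) auto
  then show ?thesis unfolding bw_def exp_add[symmetric] by (simp add: algebra_simps)
qed

text \<open>The interval \<open>{B..T}\<close> prescribes minus spins on \<open>B\<close> and plus spins off \<open>T\<close>. Enlarging \<open>B\<close> and \<open>T\<close>
  replaces prescribed plus spins by free ones, and free ones by minus spins, so increasing functions
  of the minus set grow in the mean. This is the only correlation inequality in use: it contains the
  monotonicity in the volume, in the boundary condition and in the conditioning. The union and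
  intersection of members of the two intervals lie in the upper and lower interval respectively, so
  the four functions inequality applies to the weights cut off to the intervals.\<close>

lemma avg_mono_interval:
  assumes \<beta>: "\<beta> \<ge> 0" and fin: "finite T2" and B: "B1 \<subseteq> B2" and T: "T1 \<subseteq> T2"
    and ne: "B1 \<subseteq> T1" "B2 \<subseteq> T2"
    and f: "mono f" "\<And>M. f M \<ge> (0::real)"
  shows "avg \<beta> {B1..T1} f \<le> avg \<beta> {B2..T2} f"
proof -
  define r where "r I g = (\<lambda>M. bw \<beta> M * g M * (if M \<in> I then 1 else (0::real)))" for I g
  have red: "(\<Sum>M\<in>Pow T2. r I g M) = (\<Sum>M\<in>I. bw \<beta> M * g M)" if "I \<subseteq> Pow T2" for I g
    unfolding r_def using that fin
    by (simp add: if_distrib[of "\<lambda>x. _ * x"] sum.If_cases Int_absorb1 cong: if_cong)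
  have sub: "{B1..T1} \<subseteq> Pow T2" "{B2..T2} \<subseteq> Pow T2" using T by (meson PowI atLeastAtMost_iff subsetI subset_trans)+
  have "sum (r {B1..T1} f) (Pow T2) * sum (r {B2..T2} (\<lambda>_. 1)) (Pow T2)
      \<le> sum (r {B2..T2} f) (Pow T2) * sum (r {B1..T1} (\<lambda>_. 1)) (Pow T2)"
  proof (rule four_functions)
    fix A C assume AC: "A \<subseteq> T2" "C \<subseteq> T2"
    show "r {B1..T1} f A * r {B2..T2} (\<lambda>_. 1) C
      \<le> r {B2..T2} f (A \<union> C) * r {B1..T1} (\<lambda>_. 1) (A \<inter> C)"
    proof (cases "A \<in> {B1..T1} \<and> C \<in> {B2..T2}")
      case True
      then have in': "A \<union> C \<in> {B2..T2}" "A \<inter> C \<in> {B1..T1}" using AC B T by auto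
      have "bw \<beta> A * bw \<beta> C * f A \<le> (bw \<beta> (A \<union> C) * bw \<beta> (A \<inter> C)) * f (A \<union> C)"
        using \<beta> AC fin f finite_subset
        by (intro mult_mono bw_supermodular) (auto intro: monoD)
      then show ?thesis using True in' unfolding r_def by (simp add: algebra_simps)
    next
      case False
      then have "r {B1..T1} f A * r {B2..T2} (\<lambda>_. 1) C = 0" unfolding r_def by auto
      moreover have "r {B2..T2} f (A \<union> C) * r {B1..T1} (\<lambda>_. 1) (A \<inter> C) \<ge> 0"
        unfolding r_def using f by (intro mult_nonneg_nonneg) auto
      ultimately show ?thesis by linarith
    qed
  qed (use fin f in \<open>auto simp: r_def\<close>)
  then have *: "(\<Sum>M\<in>{B1..T1}. bw \<beta> M * f M) * part \<beta> {B2..T2}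
      \<le> (\<Sum>M\<in>{B2..T2}. bw \<beta> M * f M) * part \<beta> {B1..T1}"
    unfolding red[OF sub(1)] red[OF sub(2)] by (simp add: part_def)
  have "part \<beta> {B1..T1} > 0" "part \<beta> {B2..T2} > 0"
    using ne fin T finite_subset[OF T fin] by (auto intro!: part_pos)
  with * show ?thesis unfolding avg_def by (simp add: field_simps)
qed

section \<open>The Peierls estimate for one contour\<close>

text \<open>Prescribing minus spins on \<open>X\<close> instead of plus spins breaks at most four bonds per site of
  \<open>X\<close>, each of which costs \<open>exp (2 \<beta>)\<close>.\<close>

lemma part_shift:
  assumes "\<beta> \<ge> 0" "finite T" "finite X" "T \<inter> X = {}"
  shows "part \<beta> {B..T} \<le> exp (8 * \<beta> * card X) * part \<beta> {B \<union> X..T \<union> X}"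
proof (cases "B \<subseteq> T")
  case False
  then have "{B..T} = {}" by auto
  then show ?thesis by (simp add: part_def sum_nonneg)
next
  case True
  have im: "{B \<union> X..T \<union> X} = (\<lambda>K. K \<union> X) ` {B..T}"
  proof (intro set_eqI iffI)
    fix M assume M: "M \<in> {B \<union> X..T \<union> X}"
    then have "M = (M - X) \<union> X" "M - X \<in> {B..T}" using assms(4) True by auto
    then show "M \<in> (\<lambda>K. K \<union> X) ` {B..T}" by blast
  qed auto
  have inj: "inj_on (\<lambda>K. K \<union> X) {B..T}"
    using assms(4) by (intro inj_onI) auto
  have "bw \<beta> M \<le> exp (8 * \<beta> * card X) * bw \<beta> (M \<union> X)" if "M \<in> {B..T}" for M
  proof -
    have "card (cut (M \<union> X)) \<le> card (cut M) + 4 * card X"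
      using that assms finite_subset[of M T] by (intro card_cut_add) auto
    then have "2 * \<beta> * real (card (cut (M \<union> X))) \<le> 2 * \<beta> * (real (card (cut M)) + 4 * real (card X))"
      using assms(1) by (intro mult_left_mono) linarith+
    then show ?thesis unfolding bw_def exp_add[symmetric] by (simp add: algebra_simps)
  qed
  then have "part \<beta> {B..T} \<le> (\<Sum>M\<in>{B..T}. exp (8 * \<beta> * card X) * bw \<beta> (M \<union> X))"
    unfolding part_def by (intro sum_mono)
  also have "\<dots> = exp (8 * \<beta> * card X) * part \<beta> {B \<union> X..T \<union> X}"
    unfolding part_def im by (simp add: sum.reindex[OF inj] sum_distrib_left)
  finally show ?thesis .
qed

text \<open>With plus boundary conditions the spins in \<open>F - U\<close> are rather all plus than all minus.
  The weight ratio of a configuration and its spin flip depends on the configuration only through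
  the part of its boundary on the boundary of \<open>F\<close>, hence increases with the set of minus spins;
  its mean over all configurations in \<open>F\<close> is 1.\<close>

lemma part_flip:
  assumes \<beta>: "\<beta> \<ge> 0" and F: "finite F" "U \<subseteq> F"
  shows "(\<Sum>M\<in>{{}..U}. bw \<beta> (F - M)) \<le> part \<beta> {{}..U}"
proof -
  define r where "r M = exp (2 * \<beta> * (2 * real (card {e \<in> cut F. e \<inter> F \<inter> M \<noteq> {}}) - real (card (cut F))))" for M
  have bw_r: "bw \<beta> (F - M) = bw \<beta> M * r M" if "M \<subseteq> F" for M
  proof -
    have "{e \<in> cut F. e \<inter> F \<inter> M \<noteq> {}} = cut M \<inter> cut F"
    proof (intro set_eqI iffI)
      fix e assume "e \<in> {e \<in> cut F. e \<inter> F \<inter> M \<noteq> {}}"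
      then have e: "e \<in> cut F" "e \<inter> F \<inter> M \<noteq> {}" by auto
      from e(1) obtain x y where xy: "e = {x, y}" "neighbours x y" "x \<in> F" "y \<notin> F" by (rule cutE)
      with e(2) have "x \<in> M" by auto
      moreover have "y \<notin> M" using xy that by auto
      ultimately show "e \<in> cut M \<inter> cut F" using xy e(1) by (simp add: pair_in_cut[OF xy(2)])
    next
      fix e assume e: "e \<in> cut M \<inter> cut F"
      then obtain x y where xy: "e = {x, y}" "neighbours x y" "x \<in> F" "y \<notin> F" by (auto elim: cutE)
      then have "x \<in> M" using e that by (auto simp: pair_in_cut[OF xy(2)])
      then show "e \<in> {e \<in> cut F. e \<inter> F \<inter> M \<noteq> {}}" using xy e by auto
    qed
    then have eq: "real (card (cut (F - M))) = real (card (cut M)) - (2 * real (card {e \<in> cut F. e \<inter> F \<inter> M \<noteq> {}}) - real (card (cut F)))"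
      using card_cut_Diff[OF F(1) that] by simp
    show ?thesis unfolding bw_def r_def exp_add[symmetric] eq by (simp add: algebra_simps)
  qed
  have mono: "mono r"
  proof (rule monoI)
    fix A C :: "(int \<times> int) set" assume "A \<subseteq> C"
    then have "card {e \<in> cut F. e \<inter> F \<inter> A \<noteq> {}} \<le> card {e \<in> cut F. e \<inter> F \<inter> C \<noteq> {}}"
      using F by (intro card_mono) auto
    then show "r A \<le> r C" unfolding r_def using \<beta> by (intro exp_mono mult_left_mono) auto
  qed
  have "avg \<beta> {{}..U} r \<le> avg \<beta> {{}..F} r"
    using \<beta> F mono by (intro avg_mono_interval) (auto simp: r_def)
  also have "avg \<beta> {{}..F} r = 1"
  proof -
    have "(\<Sum>M\<in>{{}..F}. bw \<beta> M * r M) = (\<Sum>M\<in>{{}..F}. bw \<beta> (F - M))"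
      by (intro sum.cong) (auto simp: bw_r)
    also have "\<dots> = part \<beta> {{}..F}" unfolding part_def
      by (rule sum.reindex_bij_witness[of _ "\<lambda>M. F - M" "\<lambda>M. F - M"]) auto
    finally show ?thesis unfolding avg_def using part_pos[of "{{}..F}" \<beta>] F by simp
  qed
  finally have "(\<Sum>M\<in>{{}..U}. bw \<beta> M * r M) \<le> part \<beta> {{}..U}"
    unfolding avg_def using part_pos[of "{{}..U}" \<beta>] finite_subset[OF F(2,1)] by (simp add: field_simps)
  moreover have "(\<Sum>M\<in>{{}..U}. bw \<beta> M * r M) = (\<Sum>M\<in>{{}..U}. bw \<beta> (F - M))"
    using F by (intro sum.cong) (auto simp: bw_r)
  ultimately show ?thesis by simp
qed

text \<open>On the left the prescribed spins \<open>W \<inter> F\<close> are flipped: minus off \<open>B\<close>, plus on \<open>B\<close>. They are first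
  turned to all minus, then to all plus, and finally to minus on \<open>B\<close>; the first and the last step
  change spins on \<open>B\<close> only.\<close>

lemma part_interior:
  assumes \<beta>: "\<beta> \<ge> 0" and F: "finite F" and BW: "B \<subseteq> W"
  shows "part \<beta> {W \<inter> F - B..F - B} \<le> exp (16 * \<beta> * card (B \<inter> F)) * part \<beta> {B \<inter> F..(F - W) \<union> (B \<inter> F)}"
proof -
  define c where "c = exp (8 * \<beta> * card (B \<inter> F))"
  have "part \<beta> {W \<inter> F - B..F - B} \<le> c * part \<beta> {(W \<inter> F - B) \<union> (B \<inter> F)..(F - B) \<union> (B \<inter> F)}"
    unfolding c_def using assms by (intro part_shift) auto
  also have "{(W \<inter> F - B) \<union> (B \<inter> F)..(F - B) \<union> (B \<inter> F)} = {W \<inter> F..F}"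
    using BW by (intro arg_cong2[where f=atLeastAtMost]) auto
  also have "part \<beta> {W \<inter> F..F} = (\<Sum>M\<in>{{}..F - W}. bw \<beta> (F - M))"
    unfolding part_def
    by (rule sum.reindex_bij_witness[of _ "\<lambda>M. F - M" "\<lambda>M. F - M"]) (auto simp: double_diff)
  also have "\<dots> \<le> part \<beta> {{}..F - W}" using assms by (intro part_flip) auto
  also have "\<dots> \<le> c * part \<beta> {{} \<union> (B \<inter> F)..(F - W) \<union> (B \<inter> F)}"
    unfolding c_def using assms by (intro part_shift) auto
  finally have "part \<beta> {W \<inter> F - B..F - B} \<le> c * (c * part \<beta> {{} \<union> (B \<inter> F)..(F - W) \<union> (B \<inter> F)})"
    by (simp add: c_def)
  moreover have "c * c = exp (16 * \<beta> * card (B \<inter> F))" unfolding c_def exp_add[symmetric] by simp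
  ultimately show ?thesis by (simp add: mult.assoc[symmetric])
qed

text \<open>Flipping the interior of a contour \<open>F\<close> gains the weight of its boundary, and restoring the
  prescribed spins on \<open>W\<close> costs a factor only for the prescribed minus spins inside \<open>F\<close>.\<close>

lemma contour_weight:
  assumes \<beta>: "\<beta> \<ge> 0" and L: "finite \<Lambda>" "F \<subseteq> \<Lambda>" and BW: "B \<subseteq> W" and T: "T = (\<Lambda> - W) \<union> B" and Tf: "finite T"
  shows "(\<Sum>M\<in>{M\<in>{B..T}. contour F M}. bw \<beta> M)
     \<le> exp (- 2 * \<beta> * card (cut F)) * exp (16 * \<beta> * card (B \<inter> F)) * part \<beta> {B..T}"
proof -
  have F: "finite F" using L finite_subset by blast
  define S where "S = {M\<in>{B..T}. contour F M}"
  define N where "N = (\<lambda>M. M - F) ` S"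
  have finS: "finite S" unfolding S_def using Tf by simp
  have finM: "finite M" if "M \<in> S" for M
    using that Tf finite_subset[of M T] unfolding S_def by auto
  define I1 where "I1 = {W \<inter> F - B..F - B}"
  define I2 where "I2 = {B \<inter> F..(F - W) \<union> (B \<inter> F)}"
  define q where "q = exp (- 2 * \<beta> * card (cut F))"
  have finI: "finite I1" "finite I2" unfolding I1_def I2_def using F by auto
  have finN: "finite N" unfolding N_def using finS by simp
  \<comment> \<open>Splitting along the contour: the flipped inside \<open>F - M\<close> and the outside \<open>M - F\<close> decouple.\<close>
  have "sum (bw \<beta>) S = (\<Sum>M\<in>S. q * (bw \<beta> (F - M) * bw \<beta> (M - F)))"
  proof (intro sum.cong refl)
    fix M assume M: "M \<in> S"
    then have "card (cut M) = card (cut F) + card (cut (F - M)) + card (cut (M - F))"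
      using F finM[OF M] by (intro card_cut_contour) (auto simp: S_def)
    then show "bw \<beta> M = q * (bw \<beta> (F - M) * bw \<beta> (M - F))"
      unfolding bw_def q_def exp_add[symmetric] by (simp add: algebra_simps)
  qed
  also have "\<dots> = q * (\<Sum>M\<in>S. bw \<beta> (F - M) * bw \<beta> (M - F))" by (simp add: sum_distrib_left)
  also have "(\<Sum>M\<in>S. bw \<beta> (F - M) * bw \<beta> (M - F))
      = (\<Sum>(K, P)\<in>(\<lambda>M. (F - M, M - F)) ` S. bw \<beta> K * bw \<beta> P)"
  proof -
    have "inj_on (\<lambda>M. (F - M, M - F)) S" by (intro inj_onI) (simp, blast)
    then show ?thesis by (simp add: sum.reindex)
  qed
  also have "\<dots> \<le> (\<Sum>(K, P)\<in>I1 \<times> N. bw \<beta> K * bw \<beta> P)"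
    using finI finN L BW by (intro sum_mono2) (auto simp: I1_def N_def S_def T)
  also have "\<dots> = part \<beta> I1 * sum (bw \<beta>) N"
    unfolding part_def by (simp add: sum.cartesian_product[symmetric] sum_product)
  also have "\<dots> \<le> (exp (16 * \<beta> * card (B \<inter> F)) * part \<beta> I2) * sum (bw \<beta>) N"
    unfolding I1_def I2_def by (intro mult_right_mono part_interior \<beta> F BW sum_nonneg) simp
  finally have 1: "sum (bw \<beta>) S \<le> q * (exp (16 * \<beta> * card (B \<inter> F)) * part \<beta> I2 * sum (bw \<beta>) N)"
    by (simp add: q_def)
  \<comment> \<open>Every admissible inside can be combined with every outside: the spins next to \<open>F\<close> are plus.\<close>
  have "part \<beta> I2 * sum (bw \<beta>) N = (\<Sum>(K, P)\<in>I2 \<times> N. bw \<beta> K * bw \<beta> P)"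
    unfolding part_def by (simp add: sum.cartesian_product[symmetric] sum_product)
  also have "\<dots> = (\<Sum>(K, P)\<in>I2 \<times> N. bw \<beta> (K \<union> P))"
  proof (intro sum.cong refl, clarify)
    fix K P assume KP: "K \<in> I2" "P \<in> N"
    then obtain M where M: "M \<in> S" "P = M - F" unfolding N_def by auto
    have KF: "K \<subseteq> F" using KP by (auto simp: I2_def)
    have "nonadjacent K P" unfolding nonadjacent_def
      using M KF unfolding S_def contour_def by blast
    then have "card (cut (K \<union> P)) = card (cut K) + card (cut P)"
      using KF M finM[OF M(1)] F finite_subset[OF KF] by (intro card_cut_Un) auto
    then show "bw \<beta> K * bw \<beta> P = bw \<beta> (K \<union> P)"
      unfolding bw_def exp_add[symmetric] by (simp add: algebra_simps)
  qed
  also have "\<dots> = sum (bw \<beta>) ((\<lambda>(K, P). K \<union> P) ` (I2 \<times> N))"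
  proof -
    have "inj_on (\<lambda>(K, P). K \<union> P) (I2 \<times> N)"
      unfolding I2_def N_def
    proof (intro inj_onI, clarsimp, intro conjI)
      fix K K' M M' assume "K \<subseteq> F - W \<union> B \<inter> F" "K' \<subseteq> F - W \<union> B \<inter> F" "K \<union> (M - F) = K' \<union> (M' - F)"
      then show "K = K'" "M - F = M' - F" by blast+
    qed
    then show ?thesis by (simp add: sum.reindex case_prod_unfold)
  qed
  also have "\<dots> \<le> part \<beta> {B..T}"
    unfolding part_def
  proof (intro sum_mono2)
    show "(\<lambda>(K, P). K \<union> P) ` (I2 \<times> N) \<subseteq> {B..T}"
    proof clarify
      fix K P assume KP: "K \<in> I2" "P \<in> N"
      then obtain M where M: "M \<in> S" "P = M - F" unfolding N_def by auto
      have "B \<subseteq> M" "M \<subseteq> T" using M by (auto simp: S_def)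
      then show "K \<union> P \<in> {B..T}" using KP M(2) L unfolding I2_def T by auto
    qed
  qed (use Tf in auto)
  finally have 2: "part \<beta> I2 * sum (bw \<beta>) N \<le> part \<beta> {B..T}" .
  have "sum (bw \<beta>) S \<le> q * exp (16 * \<beta> * card (B \<inter> F)) * (part \<beta> I2 * sum (bw \<beta>) N)"
    using 1 by (simp add: algebra_simps)
  also have "\<dots> \<le> q * exp (16 * \<beta> * card (B \<inter> F)) * part \<beta> {B..T}"
    using 2 by (intro mult_left_mono) (auto simp: q_def)
  finally show ?thesis unfolding S_def q_def .
qed

section \<open>Contours: connectedness and counting\<close>

text \<open>Connectedness is stated as indecomposability, the form in which it is used: a set has no
  proper nonempty part without an \<open>R\<close>-link to the rest.\<close>

definition conn :: "('a \<Rightarrow> 'a \<Rightarrow> bool) \<Rightarrow> 'a set \<Rightarrow> bool" where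
  "conn R X \<longleftrightarrow> (\<forall>Y. Y \<subseteq> X \<longrightarrow> Y \<noteq> {} \<longrightarrow> Y \<noteq> X \<longrightarrow> (\<exists>y\<in>Y. \<exists>z\<in>X - Y. R y z))"

lemma conn_split:
  assumes "conn R X" "Y \<subseteq> X" "Y \<noteq> {}" "Y \<noteq> X"
  shows "\<exists>y\<in>Y. \<exists>z\<in>X - Y. R y z"
  using assms unfolding conn_def by blast

lemma conn_const:
  assumes "conn R X" and "\<And>x y. x \<in> X \<Longrightarrow> y \<in> X \<Longrightarrow> R x y \<Longrightarrow> h x = h y"
    and "x \<in> X" "y \<in> X"
  shows "h x = h y"
proof (rule ccontr)
  assume ne: "h x \<noteq> h y"
  have "{z\<in>X. h z = h x} \<noteq> X" using ne assms(4) by force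
  moreover have "{z\<in>X. h z = h x} \<noteq> {}" using assms(3) by force
  ultimately have "\<exists>u\<in>{z\<in>X. h z = h x}. \<exists>z\<in>X - {z\<in>X. h z = h x}. R u z"
    by (intro conn_split[OF assms(1)]) auto
  then obtain u z where "u \<in> {z\<in>X. h z = h x}" "z \<in> X - {z\<in>X. h z = h x}" "R u z" by blast
  with assms(2)[of u z] show False by auto
qed

definition cluster :: "(int \<times> int) set \<Rightarrow> int \<times> int \<Rightarrow> (int \<times> int) set" where
  "cluster M x = {y. (\<lambda>u v. neighbours u v \<and> v \<in> M)\<^sup>*\<^sup>* x y}"

lemma cluster_self [simp]: "x \<in> cluster M x"
  by (simp add: cluster_def)

lemma cluster_step: "u \<in> cluster M x \<Longrightarrow> neighbours u v \<Longrightarrow> v \<in> M \<Longrightarrow> v \<in> cluster M x"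
  unfolding cluster_def by (auto intro: rtranclp.rtrancl_into_rtrancl)

lemma cluster_induct [consumes 1, case_names self step]:
  assumes "y \<in> cluster M x" "P x"
    "\<And>u v. u \<in> cluster M x \<Longrightarrow> P u \<Longrightarrow> neighbours u v \<Longrightarrow> v \<in> M \<Longrightarrow> v \<in> cluster M x \<Longrightarrow> P v"
  shows "P y"
proof -
  have "(\<lambda>u v. neighbours u v \<and> v \<in> M)\<^sup>*\<^sup>* x y" using assms(1) by (simp add: cluster_def)
  then have "y \<in> cluster M x \<and> P y"
  proof (induction rule: rtranclp_induct)
    case base show ?case using assms(2) by simp
  next
    case (step u v)
    then have "v \<in> cluster M x" by (auto intro: cluster_step)
    then show ?case using assms(3) step by blast
  qed
  then show ?thesis ..
qed

lemma cluster_subset: assumes "x \<in> M" shows "cluster M x \<subseteq> M"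
proof
  fix y assume "y \<in> cluster M x"
  then show "y \<in> M" by (induction rule: cluster_induct) (use assms in auto)
qed

lemma conn_cluster: "conn neighbours (cluster M x)"
  unfolding conn_def
proof (intro allI impI, rule ccontr)
  fix Y assume Y: "Y \<subseteq> cluster M x" "Y \<noteq> {}" "Y \<noteq> cluster M x"
    and no: "\<not> (\<exists>y\<in>Y. \<exists>z\<in>cluster M x - Y. neighbours y z)"
  have "y \<in> Y \<longleftrightarrow> x \<in> Y" if "y \<in> cluster M x" for y
    using that
  proof (induction rule: cluster_induct)
    case (step u v)
    then show ?case using no neighbours_sym[of u v] by blast
  qed simp
  then show False using Y by blast
qed

lemma int_const:
  fixes f :: "int \<Rightarrow> 'a"
  assumes "\<And>i. f i = f (i + 1)"
  shows "f i = f j"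
proof -
  have *: "f a = f (a + int k)" for a k
  proof (induction k)
    case (Suc k)
    then show ?case using assms[of "a + int k"] by (simp add: algebra_simps)
  qed simp
  show ?thesis
  proof (cases "i \<le> j")
    case True then show ?thesis using *[of i "nat (j - i)"] by simp
  next
    case False then show ?thesis using *[of j "nat (i - j)"] by simp
  qed
qed

lemma neighbours_simps [simp]:
  "neighbours (i, j) (i, j + 1)" "neighbours (i, j) (i + 1, j)"
  by (simp_all add: neighbours_def)

lemma neighboursE:
  assumes "neighbours x y"
  obtains i j where "{x, y} = {(i, j), (i, j + 1)}" | i j where "{x, y} = {(i, j), (i + 1, j)}"
proof -
  obtain a b c d where xy: "x = (a, b)" "y = (c, d)" by (cases x, cases y)
  with assms have "\<bar>a - c\<bar> + \<bar>b - d\<bar> = 1" by (simp add: neighbours_def)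
  then consider "c = a" "d = b + 1" | "c = a" "b = d + 1" | "d = b" "c = a + 1" | "d = b" "a = c + 1" by linarith
  then show thesis
  proof cases
    case 1
    show ?thesis by (rule that(1)[of a b]) (use 1 xy in simp)
  next
    case 2
    show ?thesis by (rule that(1)[of a d]) (use 2 xy in auto)
  next
    case 3
    show ?thesis by (rule that(2)[of a b]) (use 3 xy in simp)
  next
    case 4
    show ?thesis by (rule that(2)[of c b]) (use 4 xy in auto)
  qed
qed

lemma outside_box_const:
  assumes P: "\<And>x y. x \<notin> box n \<Longrightarrow> y \<notin> box n \<Longrightarrow> neighbours x y \<Longrightarrow> P x = (P y::bool)"
    and x: "x \<notin> box n" "y \<notin> box n"
  shows "P x = P y"
proof -
  define c where "c = int n + 1"
  have out: "(a, b) \<notin> box n" if "a > int n \<or> a < - int n \<or> b > int n \<or> b < - int n" for a b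
    using that by (auto simp: box_def)
  have V: "P (a, b) = P (a, b')" if "a > int n \<or> a < - int n" for a b b'
    by (rule int_const[of "\<lambda>b. P (a, b)"], rule P[OF out out]) (use that in auto)
  have H: "P (a, b) = P (a', b)" if "b > int n \<or> b < - int n" for a a' b
    by (rule int_const[of "\<lambda>a. P (a, b)"], rule P[OF out out]) (use that in auto)
  have "P z = P (c, c)" if zb: "z \<notin> box n" for z
  proof -
    obtain a b where z: "z = (a, b)" by (cases z)
    then consider "a > int n \<or> a < - int n" | "b > int n \<or> b < - int n"
      using zb z by (auto simp: box_def)
    then show ?thesis
    proof cases
      case 1
      have "P (a, b) = P (a, c)" by (rule V[OF 1])
      also have "\<dots> = P (c, c)" by (rule H) (simp add: c_def)
      finally show ?thesis using z by simp
    next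
      case 2
      have "P (a, b) = P (c, b)" by (rule H[OF 2])
      also have "\<dots> = P (c, c)" by (rule V) (simp add: c_def)
      finally show ?thesis using z by simp
    qed
  qed
  then show ?thesis using x by simp
qed

lemma finite_box [simp]: "finite (box n)"
  by (simp add: box_def)

lemma finite_has_boundary:
  assumes "finite Z" "Z \<noteq> {}"
  obtains x y where "x \<in> Z" "y \<notin> Z" "neighbours x y"
proof -
  have "finite (fst ` Z)" "fst ` Z \<noteq> {}" using assms by auto
  then have "Max (fst ` Z) \<in> fst ` Z" by (rule Max_in)
  then obtain b where b: "(Max (fst ` Z), b) \<in> Z" by auto
  have "(Max (fst ` Z) + 1, b) \<notin> Z"
  proof
    assume "(Max (fst ` Z) + 1, b) \<in> Z"
    then have "Max (fst ` Z) + 1 \<in> fst ` Z" by force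
    then show False using Max_ge[of "fst ` Z"] assms(1) by fastforce
  qed
  with b show ?thesis using that neighbours_simps(2) by blast
qed

text \<open>Sets are counted by counting their boundaries.\<close>

lemma cut_inject:
  assumes "finite F" "finite F'" "cut F = cut F'"
  shows "F = F'"
proof (rule ccontr)
  assume "F \<noteq> F'"
  then obtain x y where xy: "x \<in> (F - F') \<union> (F' - F)" "y \<notin> (F - F') \<union> (F' - F)" "neighbours x y"
    using assms finite_has_boundary[of "(F - F') \<union> (F' - F)"] by blast
  have "{x, y} \<in> cut F \<longleftrightarrow> {x, y} \<in> cut F'" using assms by simp
  then show False using xy by (auto simp: pair_in_cut[OF xy(3)])
qed

text \<open>Filling the holes of a cluster: the complement of the infinite component of its complement.\<close>

lemma fill_cluster:
  assumes C: "C \<subseteq> box n" "C \<noteq> {}" "conn neighbours C"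
  obtains F where "C \<subseteq> F" "F \<subseteq> box n" "conn neighbours F" "conn neighbours (- F)"
    "\<And>x y. x \<in> F \<Longrightarrow> y \<notin> F \<Longrightarrow> neighbours x y \<Longrightarrow> x \<in> C \<and> y \<notin> C"
proof -
  define z where "z = (int n + 1, int n + 1)"
  have z: "z \<notin> box n" by (auto simp: z_def box_def)
  define D where "D = cluster (- C) z"
  have D: "D \<subseteq> - C" unfolding D_def using z C by (intro cluster_subset) auto
  have Dstep: "y \<in> D" if "x \<in> D" "neighbours x y" "y \<notin> C" for x y
    using that unfolding D_def by (auto intro: cluster_step)
  have bx: "- box n \<subseteq> D"
  proof
    fix x assume "x \<in> - box n"
    then have x: "x \<notin> box n" by simp
    have "x \<in> D \<longleftrightarrow> z \<in> D"
    proof (rule outside_box_const[OF _ x z])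
      fix u v assume "u \<notin> box n" "v \<notin> box n" "neighbours u v"
      moreover from this have "u \<notin> C" "v \<notin> C" using C by blast+
      ultimately show "u \<in> D \<longleftrightarrow> v \<in> D" using Dstep[of u v] Dstep[of v u] neighbours_sym[of u v] by blast
    qed
    then show "x \<in> D" by (simp add: D_def)
  qed
  show thesis
  proof (rule that[of "- D"])
    show "C \<subseteq> - D" "- D \<subseteq> box n" using D bx by auto
    show "conn neighbours (- (- D))" unfolding D_def by (simp add: conn_cluster)
    show "x \<in> C \<and> y \<notin> C" if "x \<in> - D" "y \<notin> - D" "neighbours x y" for x y
      using that D Dstep[of y x] neighbours_sym[of x y] by auto
    show "conn neighbours (- D)"
      unfolding conn_def
    proof (intro allI impI, rule ccontr)
      fix Y assume Y: "Y \<subseteq> - D" "Y \<noteq> {}" "Y \<noteq> - D"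
        and no: "\<not> (\<exists>y\<in>Y. \<exists>z\<in>- D - Y. neighbours y z)"
      have "C \<subseteq> Y \<or> C \<inter> Y = {}"
      proof (rule ccontr)
        assume "\<not> (C \<subseteq> Y \<or> C \<inter> Y = {})"
        then have "\<exists>u\<in>C \<inter> Y. \<exists>v\<in>C - (C \<inter> Y). neighbours u v"
          by (intro conn_split[OF C(3)]) auto
        then obtain u v where "u \<in> C \<inter> Y" "v \<in> C - (C \<inter> Y)" "neighbours u v" by blast
        then show False using no D by auto
      qed
      then obtain Z where Z: "Z = Y \<or> Z = - D - Y" "C \<inter> Z = {}" by blast
      have "Z \<noteq> {}" "Z \<subseteq> - D" using Z Y by auto
      moreover have "finite Z" using \<open>Z \<subseteq> - D\<close> bx finite_subset[of Z "box n"] by auto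
      ultimately obtain u v where uv: "u \<in> Z" "v \<notin> Z" "neighbours u v"
        using finite_has_boundary by blast
      have "v \<in> D"
      proof (rule ccontr)
        assume "v \<notin> D"
        then show False using uv Z(1) no neighbours_sym[of u v] Y(1) \<open>Z \<subseteq> - D\<close> by blast
      qed
      then have "u \<in> D" using Dstep[of v u] uv neighbours_sym[of u v] Z(2) by auto
      then show False using uv \<open>Z \<subseteq> - D\<close> by auto
    qed
  qed
qed

definition plaquette :: "int \<times> int \<Rightarrow> (int \<times> int) set" where
  "plaquette p = {fst p, fst p + 1} \<times> {snd p, snd p + 1}"

definition touch :: "(int \<times> int) set \<Rightarrow> (int \<times> int) set \<Rightarrow> bool" where
  "touch e e' \<longleftrightarrow> (\<exists>p. e \<subseteq> plaquette p \<and> e' \<subseteq> plaquette p)"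

lemma touch_sym: "touch e e' \<longleftrightarrow> touch e' e"
  by (auto simp: touch_def)

text \<open>The boundary of a finite set that is connected together with its complement is connected
  (Timar's argument). If \<open>Y\<close> were a part of the boundary that touches no other part, then every
  plaquette would have an even number of edges in \<open>Y\<close>; so \<open>Y\<close> as a cochain modulo 2 would be
  the coboundary of some \<open>H\<close>. This \<open>H\<close> is constant on the set and on its complement, hence all
  boundary edges lie in \<open>Y\<close>, or none.\<close>

lemma conn_cut:
  assumes F: "finite F" "conn neighbours F" "conn neighbours (- F)"
  shows "conn touch (cut F)"
  unfolding conn_def
proof (intro allI impI, rule ccontr)
  fix Y assume Y: "Y \<subseteq> cut F" "Y \<noteq> {}" "Y \<noteq> cut F"
    and no: "\<not> (\<exists>y\<in>Y. \<exists>z\<in>cut F - Y. touch y z)"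
  define v where "v i j \<longleftrightarrow> {(i, j), (i, j + 1)} \<in> Y" for i j
  define h where "h i j \<longleftrightarrow> {(i, j), (i + 1, j)} \<in> Y" for i j
  define H where "H i j \<longleftrightarrow> odd (card {k. k \<ge> j \<and> v i k})" for i j
  have finY: "finite Y" using Y(1) F(1) finite_subset by (metis finite_cut)
  have fin: "finite {k. k \<ge> j \<and> v i k}" for i j
  proof -
    have "inj_on (\<lambda>k. {(i, k), (i, k + 1)}) {k. k \<ge> j \<and> v i k}"
      by (intro inj_onI) (auto simp: doubleton_eq_iff)
    moreover have "(\<lambda>k. {(i, k), (i, k + 1)}) ` {k. k \<ge> j \<and> v i k} \<subseteq> Y" by (auto simp: v_def)
    ultimately show ?thesis using finY by (meson finite_subset finite_imageD)
  qed
  have vert: "H i j \<longleftrightarrow> H i (j + 1) \<noteq> v i j" for i j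
  proof -
    have "{k. k \<ge> j \<and> v i k} = (if v i j then insert j {k. k \<ge> j + 1 \<and> v i k} else {k. k \<ge> j + 1 \<and> v i k})"
    proof -
      have "k \<ge> j \<longleftrightarrow> k = j \<or> k \<ge> j + 1" for k by presburger
      then show ?thesis by auto
    qed
    then show ?thesis using fin[of "j + 1" i] by (simp add: H_def)
  qed
  have plaq: "(h i j \<noteq> h i (j + 1)) = (v i j \<noteq> v (i + 1) j)" for i j
  proof -
    define Q where "Q = {{(i, j), (i + 1, j)}, {(i, j + 1), (i + 1, j + 1)}, {(i, j), (i, j + 1)}, {(i + 1, j), (i + 1, j + 1)}}"
    have Qp: "e \<subseteq> plaquette (i, j)" if "e \<in> Q" for e using that by (auto simp: Q_def plaquette_def)
    have "(\<forall>e\<in>Q. e \<in> Y \<longleftrightarrow> e \<in> cut F) \<or> (\<forall>e\<in>Q. e \<notin> Y)"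
    proof (cases "\<exists>e\<in>Q. e \<in> Y")
      case True
      then obtain e where e: "e \<in> Q" "e \<in> Y" by blast
      have "e' \<in> Y" if "e' \<in> Q" "e' \<in> cut F" for e'
      proof -
        have "touch e e'" unfolding touch_def using Qp e that by blast
        then show ?thesis using no e that by blast
      qed
      then show ?thesis using Y(1) by blast
    qed blast
    moreover have "neighbours (i, j + 1) (i + 1, j + 1)" "neighbours (i + 1, j) (i + 1, j + 1)"
      by (simp_all add: neighbours_def)
    note this[THEN pair_in_cut, of F]
    ultimately show ?thesis unfolding h_def v_def Q_def
      by (auto simp: pair_in_cut[OF neighbours_simps(1)] pair_in_cut[OF neighbours_simps(2)])
  qed
  have horiz: "(H i j \<noteq> H (i + 1) j) = h i j" for i j
  proof -
    define P where "P j \<longleftrightarrow> (H i j \<noteq> H (i + 1) j) = h i j" for j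
    have step: "P j = P (j + 1)" for j
      unfolding P_def vert[of i j] vert[of "i + 1" j] using plaq[of i j] by argo
    have "finite (snd ` \<Union>Y)" using finY Y(1) by (auto elim!: cutE)
    then have "bdd_above (snd ` \<Union>Y)" by simp
    then obtain m where "\<forall>k\<in>snd ` \<Union>Y. k \<le> m" unfolding bdd_above_def by blast
    then obtain m where "\<forall>k\<in>snd ` \<Union>Y. k < m" by (meson zle_add1_eq_le)
    then have m: "k < m" if "(a, k) \<in> e" "e \<in> Y" for a k e using that by force
    have nv: "\<not> v a k" "\<not> h a k" if "k \<ge> m" for a k
      using that m[of a k] unfolding v_def h_def by fastforce+
    have "{k. m \<le> k \<and> v a k} = {}" for a using nv(1) by auto
    then have c0: "card {k. m \<le> k \<and> v a k} = 0" for a by (simp only: card.empty)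
    have "\<not> H i m" "\<not> H (i + 1) m" by (simp_all only: H_def c0) simp_all
    then have "P m" unfolding P_def using nv(2)[of m i] by simp
    then have "P j" using int_const[of P j m] step by simp
    then show ?thesis by (simp add: P_def)
  qed
  define G where "G x = H (fst x) (snd x)" for x
  have G: "(G x \<noteq> G y) = ({x, y} \<in> Y)" if "neighbours x y" for x y
    using that
  proof (cases rule: neighboursE)
    case (1 i j)
    then have "(G x \<noteq> G y) = (G (i, j) \<noteq> G (i, j + 1))" by (auto simp: doubleton_eq_iff)
    then show ?thesis using vert[of i j] 1 by (auto simp: v_def G_def)
  next
    case (2 i j)
    then have "(G x \<noteq> G y) = (G (i, j) \<noteq> G (i + 1, j))" by (auto simp: doubleton_eq_iff)
    then show ?thesis using horiz[of i j] 2 by (auto simp: h_def G_def)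
  qed
  have GF: "G x = G y" if "x \<in> F \<and> y \<in> F \<or> x \<notin> F \<and> y \<notin> F" for x y
  proof -
    have *: "G x = G y" if "neighbours x y" "(x \<in> F) = (y \<in> F)" for x y
      using G[OF that(1)] Y(1) that(2) pair_in_cut[OF that(1), of F] by blast
    show ?thesis using that
    proof
      assume "x \<in> F \<and> y \<in> F" then show ?thesis by (rule_tac conn_const[OF F(2)]) (use * in auto)
    next
      assume "x \<notin> F \<and> y \<notin> F" then show ?thesis by (rule_tac conn_const[OF F(3)]) (use * in auto)
    qed
  qed
  from Y obtain e e' where e: "e \<in> Y" "e' \<in> cut F" "e' \<notin> Y" by blast
  then have "e \<in> cut F" using Y by auto
  then obtain x y where xy: "e = {x, y}" "neighbours x y" "x \<in> F" "y \<notin> F" by (rule cutE)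
  obtain x' y' where xy': "e' = {x', y'}" "neighbours x' y'" "x' \<in> F" "y' \<notin> F" using e(2) by (rule cutE)
  have "G x = G x'" by (rule GF) (use xy xy' in blast)
  moreover have "G y = G y'" by (rule GF) (use xy xy' in blast)
  ultimately have "e \<in> Y \<longleftrightarrow> e' \<in> Y" unfolding xy(1) xy'(1) G[OF xy(2), symmetric] G[OF xy'(2), symmetric] by simp
  then show False using e by blast
qed


subsection \<open>Counting\<close>

text \<open>Edges that touch \<open>e\<close> consist of sites in a 3 by 3 square around a site of \<open>e\<close>, and \<open>2\<^sup>9 = 512\<close>.\<close>

lemma card_touch_le:
  assumes "e \<in> edges"
  shows "finite {e'. touch e e'}" "card {e'. touch e e'} \<le> 512"
proof -
  from assms obtain x y where "e = {x, y}" unfolding edges_def by blast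
  then obtain a b where ab: "(a, b) \<in> e" by (cases x) auto
  define N where "N = {a - 1..a + 1} \<times> {b - 1..b + 1}"
  have sub: "{e'. touch e e'} \<subseteq> Pow N"
  proof
    fix e' assume "e' \<in> {e'. touch e e'}"
    then obtain c d where p: "e \<subseteq> plaquette (c, d)" "e' \<subseteq> plaquette (c, d)" by (auto simp: touch_def)
    then have "(a, b) \<in> plaquette (c, d)" using ab by blast
    then have "plaquette (c, d) \<subseteq> N" by (auto simp: plaquette_def N_def)
    then show "e' \<in> Pow N" using p by auto
  qed
  have "finite N" by (simp add: N_def)
  moreover have "card (Pow N) = 512" by (simp add: card_Pow N_def card_cartesian_product)
  ultimately show "finite {e'. touch e e'}" "card {e'. touch e e'} \<le> 512"
    using sub card_mono[of "Pow N"] finite_subset[OF sub] by auto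
qed

definition walks :: "nat \<Rightarrow> (int \<times> int) set \<Rightarrow> (int \<times> int) set list set" where
  "walks n e = {w. length w = Suc n \<and> hd w = e \<and> successively touch w \<and> set w \<subseteq> edges}"

lemma walks_bound:
  "finite (walks n e) \<and> card (walks n e) \<le> 512 ^ n"
proof (induction n arbitrary: e)
  case 0
  have "walks 0 e \<subseteq> {[e]}" by (auto simp: walks_def length_Suc_conv)
  then show ?case using card_mono[of "{[e]}" "walks 0 e"] finite_subset by auto
next
  case (Suc n)
  show ?case
  proof (cases "e \<in> edges")
    case False
    have "walks (Suc n) e = {}"
      using False by (auto simp: walks_def length_Suc_conv)
    then show ?thesis by simp
  next
    case True
    have sub: "walks (Suc n) e \<subseteq> (\<Union>e'\<in>{e'. touch e e'}. (#) e ` walks n e')"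
    proof
      fix w assume "w \<in> walks (Suc n) e"
      then obtain e' w' where w: "w = e # e' # w'" "length w' = n" "touch e e'" "successively touch (e' # w')" "set (e' # w') \<subseteq> edges"
        by (auto simp: walks_def length_Suc_conv)
      then have "e' # w' \<in> walks n e'" by (simp add: walks_def)
      then show "w \<in> (\<Union>e'\<in>{e'. touch e e'}. (#) e ` walks n e')" using w by blast
    qed
    have fin: "finite (\<Union>e'\<in>{e'. touch e e'}. (#) e ` walks n e')"
      using Suc card_touch_le[OF True] by auto
    have "card (walks (Suc n) e) \<le> card (\<Union>e'\<in>{e'. touch e e'}. (#) e ` walks n e')"
      by (rule card_mono[OF fin sub])
    also have "\<dots> \<le> (\<Sum>e'\<in>{e'. touch e e'}. card ((#) e ` walks n e'))"
      using card_touch_le(1)[OF True] by (rule card_UN_le)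
    also have "\<dots> \<le> (\<Sum>e'\<in>{e'. touch e e'}. 512 ^ n)"
      using Suc by (intro sum_mono order_trans[OF card_image_le]) auto
    also have "\<dots> \<le> 512 * 512 ^ n" using card_touch_le(2)[OF True] by simp
    finally show ?thesis using finite_subset[OF sub fin] by simp
  qed
qed

text \<open>A connected set is explored by a walk in which every new element \<open>z\<close> is visited by a
  detour \<open>y, z, y\<close> from an element already visited.\<close>

lemma conn_walk:
  assumes X: "finite X" "conn touch X" "e \<in> X" "X \<subseteq> edges"
  shows "\<exists>w\<in>walks (2 * (card X - 1)) e. set w = X"
proof -
  have "\<exists>w. length w = Suc (2 * m) \<and> hd w = e \<and> successively touch w \<and> set w \<subseteq> X \<and> card (set w) = Suc m"
    if "m < card X" for m
    using that
  proof (induction m)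
    case 0 then show ?case using X by (intro exI[of _ "[e]"]) auto
  next
    case (Suc m)
    then obtain w where w: "length w = Suc (2 * m)" "hd w = e" "successively touch w" "set w \<subseteq> X" "card (set w) = Suc m"
      by auto
    then have "set w \<noteq> {}" "set w \<noteq> X" using Suc by auto
    with w(4) obtain y z where yz: "y \<in> set w" "z \<in> X - set w" "touch y z"
      using conn_split[OF X(2)] by metis
    then obtain us vs where us: "w = us @ y # vs" by (meson split_list)
    let ?w = "us @ y # z # y # vs"
    have "hd ?w = e" using w(2) us by (cases us) auto
    moreover have "successively touch ?w"
      using w(3) yz(3) touch_sym[of y z] unfolding us by (auto simp: successively_append_iff successively_Cons)
    moreover have "set ?w = insert z (set w)" using us by auto
    moreover have "length ?w = Suc (2 * Suc m)" using w(1) us by simp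
    moreover have "card (set ?w) = Suc (Suc m)" using calculation(3) w(5) yz(2) by simp
    moreover have "set ?w \<subseteq> X" using calculation(3) w(4) yz(2) by auto
    ultimately show ?case by blast
  qed
  moreover have pos: "card X > 0" using X card_gt_0_iff by blast
  ultimately obtain w where w: "length w = Suc (2 * (card X - 1))" "hd w = e"
    "successively touch w" "set w \<subseteq> X" "card (set w) = Suc (card X - 1)"
    by (metis diff_less zero_less_one)
  moreover note pos
  ultimately have "set w = X" using X(1) by (intro card_subset_eq) auto
  then show ?thesis using w X(4) unfolding walks_def by blast
qed

text \<open>The possible interiors of contours of length \<open>k\<close> around the site \<open>v\<close> of the line.\<close>

definition contours :: "int \<Rightarrow> nat \<Rightarrow> (int \<times> int) set set" where
  "contours v k = {F. finite F \<and> conn neighbours F \<and> conn neighbours (- F) \<and> (v, 0) \<in> F \<and> card (cut F) = k}"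

text \<open>Above the topmost site of each column there is a boundary edge.\<close>

lemma card_columns_le:
  assumes "finite F"
  shows "card (fst ` F) \<le> card (cut F)"
proof -
  define t where "t c = Max {y. (c, y) \<in> F}" for c
  have fin: "finite {y. (c, y) \<in> F}" for c
    by (rule finite_subset[of _ "snd ` F"]) (use assms in force)+
  have t: "(c, t c) \<in> F" "(c, t c + 1) \<notin> F" if "c \<in> fst ` F" for c
  proof -
    have "{y. (c, y) \<in> F} \<noteq> {}" using that by auto
    then show "(c, t c) \<in> F" using Max_in[OF fin] unfolding t_def by blast
    show "(c, t c + 1) \<notin> F" using Max_ge[OF fin, of "t c + 1" c] unfolding t_def by auto
  qed
  have "inj_on (\<lambda>c. {(c, t c), (c, t c + 1)}) (fst ` F)"
    by (intro inj_onI) (auto simp: doubleton_eq_iff)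
  moreover have "(\<lambda>c. {(c, t c), (c, t c + 1)}) ` (fst ` F) \<subseteq> cut F"
  proof (rule image_subsetI)
    fix c assume "c \<in> fst ` F"
    from t[OF this] show "{(c, t c), (c, t c + 1)} \<in> cut F"
      by (simp add: pair_in_cut[OF neighbours_simps(1)])
  qed
  ultimately show ?thesis using finite_cut[OF assms] by (rule card_inj_on_le)
qed

lemma conn_columns:
  assumes "conn neighbours F" "a \<in> fst ` F" "b \<in> fst ` F"
  shows "{a..b} \<subseteq> fst ` F"
proof
  fix c assume c: "c \<in> {a..b}"
  show "c \<in> fst ` F"
  proof (rule ccontr)
    assume n: "c \<notin> fst ` F"
    then have "a < c" "c < b" using c assms by (auto simp: order_le_less)
    then have "\<exists>y\<in>{x\<in>F. fst x < c}. \<exists>z\<in>F - {x\<in>F. fst x < c}. neighbours y z"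
      using assms(2,3) by (intro conn_split[OF assms(1)]) force+
    then obtain y z where "y \<in> {x\<in>F. fst x < c}" "z \<in> F - {x\<in>F. fst x < c}" "neighbours y z" by blast
    moreover have "fst z \<noteq> c" using n calculation by auto
    ultimately show False unfolding neighbours_def by auto
  qed
qed

text \<open>Going right from \<open>(v, 0)\<close> one crosses the boundary within \<open>k\<close> steps, since every step is a new
  column of \<open>F\<close>. So the boundary contains one of \<open>k\<close> given edges, at which its exploration starts.\<close>

lemma contours_row_edge:
  assumes "F \<in> contours v k"
  obtains j where "j < k" "{(v + int j, 0), (v + int j + 1, 0)} \<in> cut F"
proof -
  have F: "finite F" "(v, 0) \<in> F" "card (cut F) = k" using assms by (auto simp: contours_def)
  have "\<exists>j. (v + int j + 1, 0) \<notin> F"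
  proof (rule ccontr)
    assume "\<not> ?thesis"
    then have "range (\<lambda>j. (v + int j + 1, 0)) \<subseteq> F" by auto
    moreover have "inj (\<lambda>j. (v + int j + 1, 0::int))" by (intro injI) auto
    ultimately show False using F(1) finite_subset range_inj_infinite by blast
  qed
  define j where "j = (LEAST j. (v + int j + 1, 0) \<notin> F)"
  have j: "(v + int j + 1, 0) \<notin> F" unfolding j_def using \<open>\<exists>j. _\<close> by (rule LeastI_ex)
  have i: "(v + int i, 0) \<in> F" if "i \<le> j" for i
  proof (cases i)
    case 0 then show ?thesis using F by simp
  next
    case (Suc m)
    then have "(v + int m + 1, 0) \<in> F" using that not_less_Least[of m "\<lambda>j. (v + int j + 1, 0) \<notin> F"] by (auto simp: j_def)
    then show ?thesis using Suc by (simp add: algebra_simps)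
  qed
  have "(\<lambda>i. v + int i) ` {..j} \<subseteq> fst ` F" using i by force
  then have "card ((\<lambda>i. v + int i) ` {..j}) \<le> card (fst ` F)" using F by (intro card_mono) auto
  also have "\<dots> \<le> k" using card_columns_le[OF F(1)] F by simp
  finally have "j < k" by (subst (asm) card_image) (auto simp: inj_on_def)
  moreover have "{(v + int j, 0), (v + int j + 1, 0)} \<in> cut F"
    using i[of j] j by (simp add: pair_in_cut[OF neighbours_simps(2)])
  ultimately show ?thesis using that by blast
qed

lemma contours_bound:
  "finite (contours v k)" "card (contours v k) \<le> k * 512 ^ (2 * k)"
proof -
  define E where "E j = {(v + int j, 0), (v + int j + 1, 0::int)}" for j
  define U where "U = (\<Union>j\<in>{..<k}. set ` walks (2 * (k - 1)) (E j))"
  have sub: "cut ` contours v k \<subseteq> U"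
  proof
    fix X assume "X \<in> cut ` contours v k"
    then obtain F where F: "F \<in> contours v k" "X = cut F" by auto
    obtain j where j: "j < k" "E j \<in> cut F" using contours_row_edge[OF F(1)] unfolding E_def by metis
    have "\<exists>w\<in>walks (2 * (card (cut F) - 1)) (E j). set w = cut F"
      using F(1) j by (intro conn_walk conn_cut finite_cut cut_subset_edges) (auto simp: contours_def)
    moreover have "card (cut F) = k" using F(1) by (simp add: contours_def)
    ultimately show "X \<in> U" unfolding U_def using j F(2) by auto
  qed
  have finU: "finite U" unfolding U_def using walks_bound by auto
  have inj: "inj_on cut (contours v k)"
    by (intro inj_onI cut_inject) (auto simp: contours_def)
  show fin: "finite (contours v k)" using inj sub finU by (metis finite_subset inj_on_finite)
  have "card (contours v k) \<le> card U" using inj sub finU by (rule card_inj_on_le)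
  also have "\<dots> \<le> (\<Sum>j\<in>{..<k}. card (set ` walks (2 * (k - 1)) (E j)))"
    unfolding U_def by (intro card_UN_le) simp
  also have "\<dots> \<le> (\<Sum>j\<in>{..<k}. 512 ^ (2 * k))"
  proof (intro sum_mono)
    fix j
    have "card (set ` walks (2 * (k - 1)) (E j)) \<le> card (walks (2 * (k - 1)) (E j))"
      using walks_bound by (intro card_image_le) auto
    also have "\<dots> \<le> 512 ^ (2 * (k - 1))" using walks_bound by auto
    also have "\<dots> \<le> 512 ^ (2 * k)" by (intro power_increasing) auto
    finally show "card (set ` walks (2 * (k - 1)) (E j)) \<le> 512 ^ (2 * k)" .
  qed
  finally show "card (contours v k) \<le> k * 512 ^ (2 * k)" by simp
qed

section \<open>Decoupling the line from its far part\<close>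

definition hit :: "(int \<times> int) set \<Rightarrow> (int \<times> int) set \<Rightarrow> real" where
  "hit A M = of_bool (M \<inter> A \<noteq> {})"

definition pattern :: "(int \<times> int) set \<Rightarrow> (int \<times> int) set \<Rightarrow> (int \<times> int) set \<Rightarrow> real" where
  "pattern A E M = of_bool (M \<inter> A = E)"

lemma mono_hit: "mono (hit A)" and hit_nonneg: "hit A M \<ge> 0"
  by (auto simp: hit_def mono_def)

text \<open>Patterns are linear combinations of the increasing functions \<open>hit\<close>, to which the
  correlation inequality applies.\<close>

lemma pattern_induct:
  assumes "finite E" "E \<subseteq> A" "Q (\<lambda>_. 1)" "\<And>f g. Q f \<Longrightarrow> Q g \<Longrightarrow> Q (\<lambda>M. f M - g M)"
    "\<And>A'. A' \<subseteq> A \<Longrightarrow> Q (hit A')"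
  shows "Q (pattern A E)"
  using assms(1,2,5)
proof (induction E arbitrary: A rule: finite_induct)
  case empty
  have "pattern A {} = (\<lambda>M. 1 - hit A M)" by (auto simp: pattern_def hit_def)
  then show ?case using assms(3,4) empty by auto
next
  case (insert x E)
  have "pattern A (insert x E) = (\<lambda>M. pattern (A - {x}) E M - pattern A E M)"
  proof
    fix M
    have "M \<inter> (A - {x}) = E \<longleftrightarrow> M \<inter> A = E \<or> M \<inter> A = insert x E" "M \<inter> A = E \<longrightarrow> M \<inter> A \<noteq> insert x E"
      using insert.hyps insert.prems by auto
    then show "pattern A (insert x E) M = pattern (A - {x}) E M - pattern A E M"
      by (auto simp: pattern_def)
  qed
  moreover have "Q (pattern (A - {x}) E)"
    by (rule insert.IH) (use insert.hyps insert.prems in auto)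
  moreover have "Q (pattern A E)"
    by (rule insert.IH) (use insert.hyps insert.prems in auto)
  ultimately show ?case using assms(4) by simp
qed

lemma avg_diff: "avg \<beta> I (\<lambda>M. f M - g M) = avg \<beta> I f - avg \<beta> I g"
  by (simp add: avg_def right_diff_distrib sum_subtractf diff_divide_distrib)

lemma avg_one: "part \<beta> I > 0 \<Longrightarrow> avg \<beta> I (\<lambda>_. 1) = 1"
  by (simp add: avg_def part_def)

lemma avg_mono: "(\<And>M. M \<in> I \<Longrightarrow> f M \<le> g M) \<Longrightarrow> avg \<beta> I f \<le> avg \<beta> I g"
  unfolding avg_def by (intro divide_right_mono sum_mono mult_left_mono) auto

lemma avg_hit_le_1: "avg \<beta> I (hit A) \<le> 1"
proof (cases "part \<beta> I > 0")
  case True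
  have "avg \<beta> I (hit A) \<le> avg \<beta> I (\<lambda>_. 1)" by (intro avg_mono) (simp add: hit_def)
  then show ?thesis using avg_one[OF True] by simp
next
  case False
  then have "part \<beta> I = 0" using part_nonneg[of \<beta> I] by linarith
  then show ?thesis by (simp add: avg_def)
qed

lemma avg_nonneg: "(\<And>M. M \<in> I \<Longrightarrow> f M \<ge> 0) \<Longrightarrow> avg \<beta> I f \<ge> 0"
  unfolding avg_def by (intro divide_nonneg_nonneg sum_nonneg mult_nonneg_nonneg) auto

text \<open>The minus clusters of \<open>M\<close> that meet \<open>L\<close>. Given these clusters, all spins next to them are
  plus, so the remaining spins feel only plus spins on \<open>L\<close>.\<close>

definition reached :: "(int \<times> int) set \<Rightarrow> (int \<times> int) set \<Rightarrow> (int \<times> int) set" where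
  "reached L M = (\<Union>x\<in>M \<inter> L. cluster M x)"

lemma reached_subset: "reached L M \<subseteq> M"
  unfolding reached_def using cluster_subset by blast

lemma reached_superset: "M \<inter> L \<subseteq> reached L M"
  unfolding reached_def using cluster_self by blast

lemma reached_step: "u \<in> reached L M \<Longrightarrow> neighbours u v \<Longrightarrow> v \<in> M \<Longrightarrow> v \<in> reached L M"
  unfolding reached_def using cluster_step by blast

lemma reached_Un:
  assumes s: "s = reached L M0" and M': "M' \<inter> L = {}" "nonadjacent s M'"
  shows "reached L (s \<union> M') = s"
proof -
  have "s \<inter> L = M0 \<inter> L" using s reached_subset[of L M0] reached_superset[of M0 L] by auto
  then have L: "(s \<union> M') \<inter> L = M0 \<inter> L" using M'(1) by auto
  have "cluster (s \<union> M') x = cluster M0 x" if x: "x \<in> M0 \<inter> L" for x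
  proof (intro set_eqI iffI)
    have xs: "x \<in> s" using x s reached_superset[of M0 L] by auto
    fix y assume "y \<in> cluster (s \<union> M') x"
    then have "y \<in> s \<and> y \<in> cluster M0 x"
    proof (induction rule: cluster_induct)
      case self then show ?case using xs by simp
    next
      case (step u v)
      then have v: "v \<in> s" using M'(2) unfolding nonadjacent_def by blast
      then have "v \<in> M0" using s reached_subset by blast
      then show ?case using v step by (auto intro: cluster_step)
    qed
    then show "y \<in> cluster M0 x" ..
  next
    fix y assume "y \<in> cluster M0 x"
    then show "y \<in> cluster (s \<union> M') x"
    proof (induction rule: cluster_induct)
      case self then show ?case by simp
    next
      case (step u v)
      have "v \<in> reached L M0" unfolding reached_def using x step(4) by (rule UN_I)
      then have "v \<in> s \<union> M'" using s by simp
      with step(5,2) show ?case by (rule cluster_step)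
    qed
  qed
  then have "reached L (s \<union> M') = (\<Union>x\<in>M0 \<inter> L. cluster M0 x)"
    unfolding reached_def[of L "s \<union> M'"] L by simp
  then show ?thesis using s by (simp add: reached_def)
qed

text \<open>The spatial Markov property: given the reached clusters \<open>s\<close>, the remaining minus spins are any set
  that avoids \<open>s\<close>, its neighbours and \<open>L\<close>.\<close>

lemma reached_fibre:
  assumes T: "finite T" and L: "L \<inter> B = {}" and M0: "M0 \<in> {B..T}" and s: "s = reached L M0"
  defines "T' \<equiv> {y\<in>T. y \<notin> s \<and> y \<notin> L \<and> (\<forall>x\<in>s. \<not> neighbours x y)}"
  shows "{M\<in>{B..T}. reached L M = s} = (\<lambda>M'. s \<union> M') ` {B - s..T'}"
    and "\<And>M'. M' \<in> {B - s..T'} \<Longrightarrow> nonadjacent s M' \<and> s \<inter> M' = {}"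
proof -
  show na: "nonadjacent s M' \<and> s \<inter> M' = {}" if "M' \<in> {B - s..T'}" for M'
    using that unfolding T'_def nonadjacent_def by auto
  show "{M\<in>{B..T}. reached L M = s} = (\<lambda>M'. s \<union> M') ` {B - s..T'}"
  proof (intro set_eqI iffI)
    fix M assume "M \<in> {M\<in>{B..T}. reached L M = s}"
    then have M: "B \<subseteq> M" "M \<subseteq> T" "reached L M = s" by auto
    have "M - s \<subseteq> T'"
      using M(2) reached_superset[of M L] reached_step[of _ L M] unfolding T'_def M(3) by blast
    then have "M - s \<in> {B - s..T'}" using M by auto
    moreover have "M = s \<union> (M - s)" using reached_subset[of L M] M(3) by auto
    ultimately show "M \<in> (\<lambda>M'. s \<union> M') ` {B - s..T'}" by blast
  next
    fix M assume "M \<in> (\<lambda>M'. s \<union> M') ` {B - s..T'}"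
    then obtain M' where M': "M' \<in> {B - s..T'}" "M = s \<union> M'" by auto
    then have "M' \<inter> L = {}" "M' \<subseteq> T" unfolding T'_def by auto
    moreover have "s \<subseteq> T" using reached_subset[of L M0] M0 s by auto
    ultimately show "M \<in> {M\<in>{B..T}. reached L M = s}"
      using reached_Un[OF s, of M'] na[OF M'(1)] M' by auto
  qed
qed

text \<open>Unless a minus cluster joins \<open>L\<close> to \<open>A\<close>, the minus spins in \<open>A\<close> see plus spins around the
  reached clusters. By monotonicity this makes them at most as likely as plus spins on \<open>L\<close> do.\<close>

lemma exploration:
  assumes \<beta>: "\<beta> \<ge> 0" and T: "finite T" "B \<subseteq> T" and L: "L \<inter> B = {}"
  shows "avg \<beta> {B..T} (hit A) \<le> avg \<beta> {B..T} (\<lambda>M. of_bool (reached L M \<inter> A \<noteq> {})) + avg \<beta> {B..T - L} (hit A)"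
proof -
  define I where "I = {B..T}"
  define G where "G = {M\<in>I. reached L M \<inter> A = {}}"
  define c where "c = avg \<beta> {B..T - L} (hit A)"
  have finI: "finite I" unfolding I_def using T by simp
  have finG: "finite G" unfolding G_def using finI by simp
  have fibre: "(\<Sum>M\<in>{M\<in>G. reached L M = s}. bw \<beta> M * hit A M) \<le> c * (\<Sum>M\<in>{M\<in>G. reached L M = s}. bw \<beta> M)"
    if s: "s \<in> reached L ` G" for s
  proof -
    from s obtain M0 where M0: "M0 \<in> {B..T}" "s = reached L M0" "s \<inter> A = {}" by (auto simp: G_def I_def)
    define T' where "T' = {y\<in>T. y \<notin> s \<and> y \<notin> L \<and> (\<forall>x\<in>s. \<not> neighbours x y)}"
    define J where "J = {B - s..T'}"
    note fib = reached_fibre[OF T(1) L M0(1,2), folded T'_def J_def]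
    have eq: "{M\<in>G. reached L M = s} = (\<lambda>M'. s \<union> M') ` J"
    proof -
      have "{M\<in>G. reached L M = s} = {M\<in>{B..T}. reached L M = s}"
        unfolding G_def I_def using M0(3) by blast
      then show ?thesis using fib(1) by (rule trans)
    qed
    have inj: "inj_on (\<lambda>M'. s \<union> M') J" using fib(2) by (intro inj_onI) blast
    have fT': "finite T'" unfolding T'_def using T by simp
    have "s \<subseteq> T" using M0(1,2) reached_subset[of L M0] by auto
    then have s_fin: "finite s" using T(1) by (rule finite_subset)
    have ne: "B - s \<subseteq> T'"
    proof -
      have "M0 \<in> (\<lambda>M'. s \<union> M') ` J" using M0(1,2) fib(1) by blast
      then show ?thesis unfolding J_def by (metis atLeastAtMost_iff imageE order_trans)
    qed
    have w: "bw \<beta> (s \<union> M') = bw \<beta> s * bw \<beta> M'" if "M' \<in> J" for M'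
    proof -
      have "finite M'" using that fT' finite_subset unfolding J_def by auto
      then have "card (cut (s \<union> M')) = card (cut s) + card (cut M')"
        using fib(2)[OF that] s_fin by (intro card_cut_Un) auto
      then show ?thesis unfolding bw_def exp_add[symmetric] by (simp add: algebra_simps)
    qed
    have h: "hit A (s \<union> M') = hit A M'" for M' using M0(3) by (simp add: hit_def Int_Un_distrib2)
    have pJ: "part \<beta> J > 0" unfolding J_def using fT' ne by (intro part_pos) auto
    have sum1: "(\<Sum>M\<in>{M\<in>G. reached L M = s}. bw \<beta> M) = bw \<beta> s * part \<beta> J"
      unfolding eq part_def sum.reindex[OF inj] by (simp add: w sum_distrib_left)
    have "(\<Sum>M\<in>{M\<in>G. reached L M = s}. bw \<beta> M * hit A M) = bw \<beta> s * (\<Sum>M'\<in>J. bw \<beta> M' * hit A M')"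
      unfolding eq sum.reindex[OF inj] by (simp add: w h sum_distrib_left mult.assoc)
    also have "\<dots> = bw \<beta> s * (avg \<beta> J (hit A) * part \<beta> J)" unfolding avg_def using pJ by simp
    also have "\<dots> \<le> bw \<beta> s * (c * part \<beta> J)"
      unfolding c_def J_def using \<beta> T L ne
      by (intro mult_left_mono mult_right_mono avg_mono_interval mono_hit hit_nonneg) (auto simp: T'_def)
    finally show ?thesis unfolding sum1 by (simp add: algebra_simps)
  qed
  have "(\<Sum>M\<in>G. bw \<beta> M * hit A M) = (\<Sum>s\<in>reached L ` G. \<Sum>M\<in>{M\<in>G. reached L M = s}. bw \<beta> M * hit A M)"
    by (rule sum.image_gen[OF finG])
  also have "\<dots> \<le> (\<Sum>s\<in>reached L ` G. c * (\<Sum>M\<in>{M\<in>G. reached L M = s}. bw \<beta> M))"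
    by (intro sum_mono fibre)
  also have "\<dots> = c * (\<Sum>M\<in>G. bw \<beta> M)"
    unfolding sum_distrib_left[symmetric] by (subst sum.image_gen[OF finG, of _ "reached L"]) simp
  also have "\<dots> \<le> c * part \<beta> I"
    unfolding part_def c_def using finI by (intro mult_left_mono sum_mono2 avg_nonneg) (auto simp: G_def hit_def)
  finally have good: "(\<Sum>M\<in>G. bw \<beta> M * hit A M) \<le> c * part \<beta> I" .
  have "(\<Sum>M\<in>I. bw \<beta> M * hit A M) \<le> (\<Sum>M\<in>I. bw \<beta> M * of_bool (reached L M \<inter> A \<noteq> {}) + (if M \<in> G then bw \<beta> M * hit A M else 0))"
    by (intro sum_mono) (auto simp: G_def hit_def)
  also have "\<dots> = (\<Sum>M\<in>I. bw \<beta> M * of_bool (reached L M \<inter> A \<noteq> {})) + (\<Sum>M\<in>G. bw \<beta> M * hit A M)"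
  proof -
    have "G \<subseteq> I" by (auto simp: G_def)
    then have "(\<Sum>M\<in>I. if M \<in> G then bw \<beta> M * hit A M else 0) = (\<Sum>M\<in>G. bw \<beta> M * hit A M)"
      using finI by (simp add: sum.If_cases Int_absorb1)
    then show ?thesis by (simp add: sum.distrib)
  qed
  finally have le: "(\<Sum>M\<in>I. bw \<beta> M * hit A M) \<le> (\<Sum>M\<in>I. bw \<beta> M * of_bool (reached L M \<inter> A \<noteq> {})) + c * part \<beta> I"
    using good by linarith
  have pI: "part \<beta> I > 0" unfolding I_def using T by (intro part_pos) auto
  have "avg \<beta> I (hit A) \<le> ((\<Sum>M\<in>I. bw \<beta> M * of_bool (reached L M \<inter> A \<noteq> {})) + c * part \<beta> I) / part \<beta> I"
    unfolding avg_def using pI le by (intro divide_right_mono) auto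
  also have "\<dots> = avg \<beta> I (\<lambda>M. of_bool (reached L M \<inter> A \<noteq> {})) + c"
    unfolding avg_def using pI by (simp add: add_divide_distrib)
  finally show ?thesis unfolding I_def c_def .
qed


subsection \<open>Long contours are unlikely when minus spins are sparse on the line\<close>

definition row :: "int set \<Rightarrow> (int \<times> int) set" where
  "row I = (\<lambda>i. (i, 0)) ` I"

lemma in_row [simp]: "(i, j) \<in> row I \<longleftrightarrow> j = 0 \<and> i \<in> I"
  by (auto simp: row_def)

text \<open>Density \<open>1/18\<close> of minus spins is magnetization \<open>8/9\<close>. The constant \<open>c\<close> absorbs the
  neighbourhood of the origin, where the density is not controlled.\<close>

definition sparse :: "real \<Rightarrow> int set \<Rightarrow> bool" where
  "sparse c P \<longleftrightarrow> (\<forall>k::nat. real (card (P \<inter> {0..<int k})) \<le> c + k / 18 \<and>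
                          real (card (P \<inter> {- int k<..0})) \<le> c + k / 18)"

lemma sparse_interval:
  assumes P: "sparse c P" and v: "p \<le> v" "v \<le> q" "\<bar>v\<bar> \<le> int r"
  shows "real (card (P \<inter> {p..q})) \<le> 2 * c + (real r + 1) + real_of_int (q - p + 1) / 18"
proof -
  define k where "k = nat (q + 1)"
  define l where "l = nat (1 - p)"
  have "P \<inter> {p..q} \<subseteq> (P \<inter> {0..<int k}) \<union> (P \<inter> {- int l<..0})" by (auto simp: k_def l_def)
  then have "card (P \<inter> {p..q}) \<le> card ((P \<inter> {0..<int k}) \<union> (P \<inter> {- int l<..0}))"
    by (intro card_mono) auto
  also have "\<dots> \<le> card (P \<inter> {0..<int k}) + card (P \<inter> {- int l<..0})" by (rule card_Un_le)
  finally have "real (card (P \<inter> {p..q})) \<le> real (card (P \<inter> {0..<int k})) + real (card (P \<inter> {- int l<..0}))"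
    by linarith
  also have "\<dots> \<le> (c + k / 18) + (c + l / 18)" using P unfolding sparse_def by (intro add_mono) auto
  also have "real k + real l \<le> real_of_int (q - p + 1) + real r + 1"
    unfolding k_def l_def using v by linarith
  then have "(c + k / 18) + (c + l / 18) \<le> 2 * c + (real r + 1) + real_of_int (q - p + 1) / 18"
    by (simp add: field_simps)
  finally show ?thesis .
qed

text \<open>The columns of \<open>F\<close> form an interval of length at most \<open>k\<close> around \<open>v\<close>.\<close>

lemma contour_minus_count:
  assumes P: "sparse c P" and F: "F \<in> contours v k" and v: "\<bar>v\<bar> \<le> int r"
  shows "real (card (row P \<inter> F)) \<le> 2 * c + (real r + 1) + k / 18"
proof -
  have F': "finite F" "conn neighbours F" "(v, 0) \<in> F" "card (cut F) = k" using F by (auto simp: contours_def)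
  define p q where "p = Min (fst ` F)" and "q = Max (fst ` F)"
  have ne: "finite (fst ` F)" "fst ` F \<noteq> {}" using F' by auto
  have v': "v \<in> fst ` F" using F'(3) by force
  have "p \<in> fst ` F" "q \<in> fst ` F" unfolding p_def q_def using ne by (auto intro: Min_in Max_in)
  then have "{p..q} \<subseteq> fst ` F" using conn_columns[OF F'(2)] by blast
  then have "card {p..q} \<le> card (fst ` F)" using ne by (intro card_mono) auto
  also have "\<dots> \<le> k" using card_columns_le[OF F'(1)] F'(4) by simp
  finally have len: "real_of_int (q - p + 1) \<le> real k" by simp
  have pq: "p \<le> v" "v \<le> q" unfolding p_def q_def using ne v' by auto
  have "row P \<inter> F \<subseteq> (\<lambda>i. (i, 0)) ` (P \<inter> {p..q})"
  proof
    fix z assume z: "z \<in> row P \<inter> F"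
    then obtain i where i: "z = (i, 0)" "i \<in> P" by (auto simp: row_def)
    then have "i \<in> fst ` F" using z by force
    then have "p \<le> i" "i \<le> q" unfolding p_def q_def using ne by auto
    then show "z \<in> (\<lambda>i. (i, 0)) ` (P \<inter> {p..q})" using i by auto
  qed
  then have "card (row P \<inter> F) \<le> card ((\<lambda>i. (i, 0::int)) ` (P \<inter> {p..q}))" by (intro card_mono) auto
  also have "\<dots> \<le> card (P \<inter> {p..q})" by (rule card_image_le) simp
  finally have "real (card (row P \<inter> F)) \<le> real (card (P \<inter> {p..q}))" by simp
  also have "\<dots> \<le> 2 * c + (real r + 1) + real_of_int (q - p + 1) / 18"
    by (rule sparse_interval[OF P pq v])
  finally show ?thesis using divide_right_mono[OF len, of 18] by linarith
qed

lemma contour_length: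
  assumes F: "F \<in> contours v k" "(x, 0) \<in> F" and v: "\<bar>v\<bar> \<le> int r" and x: "\<bar>x\<bar> > int m + int r"
  shows "m \<le> k"
proof -
  have F': "finite F" "conn neighbours F" "(v, 0) \<in> F" "card (cut F) = k" using F by (auto simp: contours_def)
  have "v \<in> fst ` F" "x \<in> fst ` F" using F' F(2) by force+
  then have "{min v x..max v x} \<subseteq> fst ` F"
    using conn_columns[OF F'(2)] by (auto simp: min_def max_def)
  then have "card {min v x..max v x} \<le> card (fst ` F)" using F' by (intro card_mono) auto
  also have "\<dots> \<le> k" using card_columns_le[OF F'(1)] F'(4) by simp
  finally show ?thesis using v x by (auto simp: min_def max_def split: if_splits)
qed

lemma two_pow_exp: "exp (- 20 :: real) \<le> 1 / 2 ^ 20"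
proof -
  have "(2::real) ^ 20 \<le> exp 1 ^ 20" using exp_ge_add_one_self[of 1] by (intro power_mono) auto
  also have "exp (1::real) ^ 20 = exp 20" by (simp add: exp_of_nat_mult[symmetric])
  finally show ?thesis by (simp add: exp_minus field_simps)
qed

text \<open>Flipping a contour of length \<open>k\<close> gains \<open>2 \<beta> k\<close>, and the minus spins inside cost
  \<open>16 \<beta> k / 18\<close>; what remains is \<open>10 \<beta> k / 9\<close>. For \<open>\<beta> \<ge> 20\<close> this beats the number
  \<open>k * 512 ^ (2 * k) \<le> 2 ^ (19 * k)\<close> of contours.\<close>

lemma contour_sum:
  assumes \<beta>: "\<beta> \<ge> 20"
  shows "real (card (contours v k)) * exp (- (10 / 9) * \<beta> * real k) \<le> (1 / 2) ^ k"
proof -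
  have "exp (- (10 / 9) * \<beta>) \<le> exp (- 20)" using \<beta> by simp
  also have "\<dots> \<le> 1 / 2 ^ 20" by (rule two_pow_exp)
  finally have e: "exp (- (10 / 9) * \<beta>) \<le> 1 / 2 ^ 20" .
  have "real (card (contours v k)) \<le> real (k * 512 ^ (2 * k))" using contours_bound(2) by (simp only: of_nat_le_iff)
  also have "\<dots> = real k * (512 ^ 2) ^ k" unfolding power_mult of_nat_mult of_nat_power by simp
  also have "\<dots> \<le> 2 ^ k * (512 ^ 2) ^ k"
    using of_nat_less_two_power[of k, where 'a=real] by (intro mult_right_mono) auto
  also have "\<dots> = (2 ^ 19) ^ k" by (simp add: power_mult_distrib[symmetric])
  finally have c: "real (card (contours v k)) \<le> (2 ^ 19) ^ k" .
  have "exp (- (10 / 9) * \<beta> * real k) = exp (- (10 / 9) * \<beta>) ^ k" by (simp add: exp_of_nat_mult[symmetric] algebra_simps)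
  also have "\<dots> \<le> (1 / 2 ^ 20) ^ k" using e by (intro power_mono) auto
  finally have "real (card (contours v k)) * exp (- (10 / 9) * \<beta> * real k) \<le> (2 ^ 19) ^ k * (1 / 2 ^ 20) ^ k"
    using c by (intro mult_mono) auto
  also have "\<dots> = (1 / 2) ^ k" by (simp add: power_mult_distrib[symmetric])
  finally show ?thesis .
qed

lemma geometric_tail: "(\<Sum>k\<in>{m..n::nat}. (1 / 2 :: real) ^ k) \<le> 2 * (1 / 2) ^ m"
proof (cases "m \<le> n")
  case True
  have "(\<Sum>k\<in>{m..n}. (1 / 2 :: real) ^ k) = (1 / 2) ^ m * (\<Sum>k\<in>{0..n - m}. (1 / 2) ^ k)"
    using True by (simp add: sum_distrib_left sum.shift_bounds_cl_nat_ivl[of _ 0 m "n - m", symmetric, simplified] power_add[symmetric] add.commute)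
  also have "(\<Sum>k\<in>{0..n - m}. (1 / 2 :: real) ^ k) \<le> 2"
  proof -
    define S where "S = (\<Sum>k\<le>n - m. (1 / 2 :: real) ^ k)"
    have "(1 - 1 / 2) * S = 1 - (1 / 2) ^ Suc (n - m)" unfolding S_def by (rule sum_gp_basic)
    moreover have "(1 / 2 :: real) ^ Suc (n - m) \<ge> 0" by simp
    moreover have "(1 - 1 / 2) * S = S / 2" by simp
    ultimately have "S \<le> 2" by linarith
    then show ?thesis by (simp add: S_def atLeast0AtMost)
  qed
  finally show ?thesis by (simp add: mult.commute)
qed simp

lemma sum_UN_le:
  fixes g :: "'b \<Rightarrow> real"
  assumes "finite I" "\<And>i. i \<in> I \<Longrightarrow> finite (X i)" "\<And>x. g x \<ge> 0"
  shows "sum g (\<Union>i\<in>I. X i) \<le> (\<Sum>i\<in>I. sum g (X i))"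
  using assms(1,2)
proof (induction I rule: finite_induct)
  case (insert i I)
  have "sum g (X i \<union> (\<Union>i\<in>I. X i)) \<le> sum g (X i) + sum g (\<Union>i\<in>I. X i)"
    using insert by (subst sum_Un) (auto intro!: sum_nonneg assms(3))
  then show ?case using insert by simp
qed simp

text \<open>The Peierls argument, uniformly in the box: a minus cluster from \<open>V\<close> to \<open>L\<close> lies in the interior
  of a contour of length at least \<open>m\<close>.\<close>

lemma far_influence:
  assumes \<beta>: "\<beta> \<ge> 20" and V: "finite V" "V \<subseteq> {- int r..int r}"
    and P: "sparse c P" and W: "W \<subseteq> row UNIV" and B: "B = row P \<inter> W"
    and T: "T = (box N - W) \<union> B" and BN: "B \<subseteq> box N"
    and L: "L \<subseteq> row {x. \<bar>x\<bar> > int m + int r}"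
  shows "avg \<beta> {B..T} (\<lambda>M. of_bool (reached L M \<inter> row V \<noteq> {}))
     \<le> card V * exp (16 * \<beta> * (2 * c + real r + 1)) * (2 * (1 / 2) ^ m)"
proof -
  have finT: "finite T" unfolding T using finite_subset[OF BN finite_box] by simp
  have TN: "T \<subseteq> box N" unfolding T using BN by auto
  define Fs where "Fs v = {F. F \<subseteq> box N \<and> (\<exists>k. F \<in> contours v k) \<and> (\<exists>x. (x, 0) \<in> F \<inter> L)}" for v
  define cs where "cs F = {M\<in>{B..T}. contour F M}" for F
  define w where "w F = (\<Sum>M\<in>cs F. bw \<beta> M)" for F
  define E where "E = exp (16 * \<beta> * (2 * c + real r + 1))"
  have finFs: "finite (Fs v)" for v by (rule finite_subset[of _ "Pow (box N)"]) (auto simp: Fs_def)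
  have fincs: "finite (cs F)" for F unfolding cs_def using finT by simp
  have pos: "part \<beta> {B..T} > 0" using finT by (intro part_pos) (auto simp: T)
  have sub: "{M\<in>{B..T}. reached L M \<inter> row V \<noteq> {}} \<subseteq> (\<Union>v\<in>V. \<Union>F\<in>Fs v. cs F)"
  proof
    fix M assume "M \<in> {M\<in>{B..T}. reached L M \<inter> row V \<noteq> {}}"
    then obtain y v where M: "M \<in> {B..T}" and y: "y \<in> M \<inter> L" "(v, 0) \<in> cluster M y" "v \<in> V"
      by (auto simp: reached_def row_def)
    have CM: "cluster M y \<subseteq> M" using y by (intro cluster_subset) auto
    then have "cluster M y \<subseteq> box N" using M TN by auto
    then obtain F where F: "cluster M y \<subseteq> F" "F \<subseteq> box N" "conn neighbours F" "conn neighbours (- F)"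
      "\<And>u z. u \<in> F \<Longrightarrow> z \<notin> F \<Longrightarrow> neighbours u z \<Longrightarrow> u \<in> cluster M y \<and> z \<notin> cluster M y"
      using fill_cluster[of "cluster M y" N] conn_cluster cluster_self by (metis empty_iff)
    have "F \<in> contours v (card (cut F))"
      using F y(2) finite_subset[OF F(2)] by (auto simp: contours_def)
    moreover obtain x where "y = (x, 0)" using y(1) L by (auto simp: row_def)
    moreover have "y \<in> F" using F(1) cluster_self by blast
    ultimately have "F \<in> Fs v" unfolding Fs_def using F(2) y(1) by auto
    moreover have "contour F M" unfolding contour_def
    proof (intro ballI allI impI)
      fix u z assume uz: "u \<in> F" "z \<notin> F" "neighbours u z"
      then have "u \<in> cluster M y" "z \<notin> cluster M y" using F(5) by blast+
      then show "u \<in> M \<and> z \<notin> M" using CM cluster_step[of u M y z] uz by blast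
    qed
    ultimately show "M \<in> (\<Union>v\<in>V. \<Union>F\<in>Fs v. cs F)" using M y(3) unfolding cs_def by blast
  qed
  have wF: "w F \<le> E * exp (- (10 / 9) * \<beta> * real k) * part \<beta> {B..T}"
    if F: "F \<in> contours v k" "F \<subseteq> box N" and v: "v \<in> V" for F v k
  proof -
    have v': "\<bar>v\<bar> \<le> int r" using subsetD[OF V(2) v] by (simp add: abs_le_iff)
    have k: "card (cut F) = k" using F by (simp add: contours_def)
    have "card (B \<inter> F) \<le> card (row P \<inter> F)"
      using F by (intro card_mono) (auto simp: B contours_def)
    then have "real (card (B \<inter> F)) \<le> 2 * c + (real r + 1) + k / 18"
      using contour_minus_count[OF P F(1) v'] by linarith
    then have "16 * \<beta> * real (card (B \<inter> F)) \<le> 16 * \<beta> * (2 * c + (real r + 1) + k / 18)"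
      using \<beta> by (intro mult_left_mono) auto
    then have "exp (- 2 * \<beta> * k) * exp (16 * \<beta> * card (B \<inter> F)) \<le> E * exp (- (10 / 9) * \<beta> * k)"
      unfolding E_def exp_add[symmetric] by (simp add: algebra_simps)
    moreover have "w F \<le> exp (- 2 * \<beta> * card (cut F)) * exp (16 * \<beta> * card (B \<inter> F)) * part \<beta> {B..T}"
      unfolding w_def cs_def
      by (rule contour_weight[where \<Lambda>="box N" and W=W]) (use \<beta> F finT T B in auto)
    ultimately show ?thesis unfolding k by (meson mult_right_mono order_trans part_nonneg)
  qed
  have sumF: "(\<Sum>F\<in>Fs v. w F) \<le> E * (2 * (1 / 2) ^ m) * part \<beta> {B..T}" if v: "v \<in> V" for v
  proof -
    define K where "K = card (bonds (box N))"
    have Fs_sub: "Fs v \<subseteq> (\<Union>k\<in>{m..K}. {F\<in>contours v k. F \<subseteq> box N})"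
    proof
      fix F assume "F \<in> Fs v"
      then obtain k x where F: "F \<subseteq> box N" "F \<in> contours v k" "(x, 0) \<in> F" "(x, 0) \<in> L" by (auto simp: Fs_def)
      have "\<bar>v\<bar> \<le> int r" using subsetD[OF V(2) v] by (simp add: abs_le_iff)
      then have "m \<le> k" using F(4) L by (intro contour_length[OF F(2,3), of r]) auto
      moreover have "k \<le> K" unfolding K_def using F(2) cut_subset_bonds[OF F(1)] finite_bonds[OF finite_box]
        by (auto simp: contours_def intro: card_mono)
      ultimately show "F \<in> (\<Union>k\<in>{m..K}. {F\<in>contours v k. F \<subseteq> box N})" using F by auto
    qed
    have w0: "w F \<ge> 0" for F unfolding w_def by (intro sum_nonneg) simp
    have finc: "finite {F\<in>contours v k. F \<subseteq> box N}" for k using contours_bound(1) by simp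
    have "(\<Sum>F\<in>Fs v. w F) \<le> sum w (\<Union>k\<in>{m..K}. {F\<in>contours v k. F \<subseteq> box N})"
      using Fs_sub w0 finc by (intro sum_mono2) auto
    also have "\<dots> = (\<Sum>k\<in>{m..K}. sum w {F\<in>contours v k. F \<subseteq> box N})"
      using finc by (intro sum.UNION_disjoint) (auto simp: contours_def)
    also have "\<dots> \<le> (\<Sum>k\<in>{m..K}. E * (1 / 2) ^ k * part \<beta> {B..T})"
    proof (intro sum_mono)
      fix k
      have "sum w {F\<in>contours v k. F \<subseteq> box N} \<le> (\<Sum>F\<in>{F\<in>contours v k. F \<subseteq> box N}. E * exp (- (10 / 9) * \<beta> * real k) * part \<beta> {B..T})"
        using wF v by (intro sum_mono) auto
      also have "\<dots> = real (card {F\<in>contours v k. F \<subseteq> box N}) * (E * exp (- (10 / 9) * \<beta> * real k) * part \<beta> {B..T})"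
        by simp
      also have "\<dots> \<le> real (card (contours v k)) * (E * exp (- (10 / 9) * \<beta> * real k) * part \<beta> {B..T})"
        using contours_bound(1) by (intro mult_right_mono) (auto simp: E_def intro: card_mono)
      also have "\<dots> = E * (real (card (contours v k)) * exp (- (10 / 9) * \<beta> * real k)) * part \<beta> {B..T}"
        by (simp add: algebra_simps)
      also have "\<dots> \<le> E * (1 / 2) ^ k * part \<beta> {B..T}"
        using contour_sum[OF \<beta>] by (intro mult_right_mono mult_left_mono) (auto simp: E_def)
      finally show "sum w {F\<in>contours v k. F \<subseteq> box N} \<le> E * (1 / 2) ^ k * part \<beta> {B..T}" .
    qed
    also have "\<dots> = E * (\<Sum>k\<in>{m..K}. (1 / 2) ^ k) * part \<beta> {B..T}" by (simp add: sum_distrib_left sum_distrib_right)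
    also have "\<dots> \<le> E * (2 * (1 / 2) ^ m) * part \<beta> {B..T}"
      using geometric_tail by (intro mult_right_mono mult_left_mono) (auto simp: E_def)
    finally show ?thesis .
  qed
  have "(\<Sum>M\<in>{B..T}. bw \<beta> M * of_bool (reached L M \<inter> row V \<noteq> {})) = (\<Sum>M\<in>{M\<in>{B..T}. reached L M \<inter> row V \<noteq> {}}. bw \<beta> M)"
    using finT by (intro sum.mono_neutral_cong_right) auto
  also have "\<dots> \<le> sum (bw \<beta>) (\<Union>v\<in>V. \<Union>F\<in>Fs v. cs F)"
    using sub V finFs fincs by (intro sum_mono2) auto
  also have "\<dots> \<le> (\<Sum>v\<in>V. sum (bw \<beta>) (\<Union>F\<in>Fs v. cs F))"
    using V finFs fincs by (intro sum_UN_le) auto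
  also have "\<dots> \<le> (\<Sum>v\<in>V. \<Sum>F\<in>Fs v. w F)"
    unfolding w_def using finFs fincs by (intro sum_mono sum_UN_le) auto
  also have "\<dots> \<le> (\<Sum>v\<in>V. E * (2 * (1 / 2) ^ m) * part \<beta> {B..T})" by (intro sum_mono sumF)
  finally show ?thesis unfolding avg_def E_def using pos by (simp add: field_simps)
qed

section \<open>Conditioning on the line\<close>

definition window :: "int set \<Rightarrow> nat \<Rightarrow> nat \<Rightarrow> int set" where
  "window V a b = {- int a..int b} - V"

text \<open>Conditioning on the spins of \<open>P\<close> in the window, in \<open>box N\<close> with plus spins outside.\<close>

definition given :: "int set \<Rightarrow> int set \<Rightarrow> nat \<Rightarrow> nat \<Rightarrow> nat \<Rightarrow> (int \<times> int) set set" where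
  "given V P a b N =
     {row (P \<inter> window V a b)..(box N - row (window V a b)) \<union> row (P \<inter> window V a b)}"

lemma finite_row [simp]: "finite I \<Longrightarrow> finite (row I)"
  by (simp add: row_def)

lemma finite_window [simp]: "finite (window V a b)" "finite (P \<inter> window V a b)"
  by (simp_all add: window_def)

lemma finite_given [simp]: "finite (given V P a b N)"
  unfolding given_def by simp

lemma part_given_pos: "part \<beta> (given V P a b N) > 0"
  by (intro part_pos) (simp_all add: given_def)

lemma in_box [simp]: "(i, j) \<in> box N \<longleftrightarrow> \<bar>i\<bar> \<le> int N \<and> \<bar>j\<bar> \<le> int N"
  by (auto simp: box_def)

lemma given_mono_window:
  assumes "\<beta> \<ge> 0" "n \<le> a" "n \<le> b" "n \<le> N"
  shows "avg \<beta> (given V P n n n) (hit A) \<le> avg \<beta> (given V P a b N) (hit A)"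
  unfolding given_def using assms
  by (intro avg_mono_interval mono_hit hit_nonneg) (auto simp: window_def)

lemma given_mono_box:
  assumes "\<beta> \<ge> 0" "N \<le> N'"
  shows "avg \<beta> (given V P a b N) (hit A) \<le> avg \<beta> (given V P a b N') (hit A)"
  unfolding given_def using assms
  by (intro avg_mono_interval mono_hit hit_nonneg) auto

lemma bounded_mono_convergent:
  fixes X :: "nat \<Rightarrow> real"
  assumes "incseq X" "\<And>n. X n \<le> B"
  obtains L where "X \<longlonglongrightarrow> L" "\<And>n. X n \<le> L" "L \<le> B"
proof -
  obtain L where L: "X \<longlonglongrightarrow> L" "\<And>n. X n \<le> L" using incseq_convergent[OF assms(1)] assms(2) by metis
  moreover have "L \<le> B" by (rule LIMSEQ_le_const2[OF L(1)]) (use assms(2) in auto)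
  ultimately show ?thesis using that by blast
qed

text \<open>Pushing the window to infinity and the box to infinity commute when the minus spins of the
  condition are sparse: more conditioning only raises the probability of minus spins, and by
  exploring from the unconditioned part of the line the increase is at most the probability of a
  contour that reaches out of the window.\<close>

lemma given_gap:
  assumes \<beta>: "\<beta> \<ge> 20" and V: "finite V" "V \<subseteq> {- int r..int r}" and P: "sparse c P"
    and ab: "m + r \<le> a" "m + r \<le> b" "a \<le> N" "b \<le> N" and A: "A \<subseteq> V"
  shows "avg \<beta> (given V P a b N) (hit (row A)) \<le> avg \<beta> (given V P N N N) (hit (row A))
      + card V * exp (16 * \<beta> * (2 * c + real r + 1)) * (2 * (1 / 2) ^ m)"
proof -
  define W where "W = row (window V a b)"
  define B where "B = row (P \<inter> window V a b)"
  define T where "T = (box N - W) \<union> B"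
  define L where "L = row {x. x \<notin> {- int a..int b}}"
  have "V \<subseteq> {- int a..int b}" using V ab by auto
  have BW: "B = row P \<inter> W" by (auto simp: B_def W_def)
  have "avg \<beta> {B..T} (hit (row A)) \<le> avg \<beta> {B..T} (\<lambda>M. of_bool (reached L M \<inter> row A \<noteq> {})) + avg \<beta> {B..T - L} (hit (row A))"
    using \<beta> by (intro exploration) (auto simp: T_def L_def B_def window_def)
  also have "avg \<beta> {B..T} (\<lambda>M. of_bool (reached L M \<inter> row A \<noteq> {})) \<le> avg \<beta> {B..T} (\<lambda>M. of_bool (reached L M \<inter> row V \<noteq> {}))"
  proof (rule avg_mono)
    fix M
    have "row A \<subseteq> row V" using A by (auto simp: row_def)
    then show "of_bool (reached L M \<inter> row A \<noteq> {}) \<le> (of_bool (reached L M \<inter> row V \<noteq> {}) :: real)"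
      by (auto simp: of_bool_def)
  qed
  also have "\<dots> \<le> card V * exp (16 * \<beta> * (2 * c + real r + 1)) * (2 * (1 / 2) ^ m)"
  proof (rule far_influence[OF \<beta> V P _ BW T_def])
    show "W \<subseteq> row UNIV" by (auto simp: W_def)
    show "B \<subseteq> box N" using ab by (auto simp: B_def window_def)
    show "L \<subseteq> row {x. \<bar>x\<bar> > int m + int r}" using ab by (auto simp: L_def)
  qed
  also have "avg \<beta> {B..T - L} (hit (row A)) \<le> avg \<beta> (given V P N N N) (hit (row A))"
    unfolding given_def using \<beta> ab
    by (intro avg_mono_interval mono_hit hit_nonneg) (auto simp: window_def T_def L_def B_def W_def)
  finally show ?thesis unfolding given_def B_def T_def W_def by simp
qed

text \<open>Sending \<open>N\<close> to infinity for a fixed window gives conditional probabilities of the plus phase, and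
  letting the window grow with the box gives the specification.\<close>

definition limit_box :: "real \<Rightarrow> int set \<Rightarrow> int set \<Rightarrow> nat \<Rightarrow> nat \<Rightarrow> ((int \<times> int) set \<Rightarrow> real) \<Rightarrow> real" where
  "limit_box \<beta> V P a b f = lim (\<lambda>N. avg \<beta> (given V P a b N) f)"

definition limit_window :: "real \<Rightarrow> int set \<Rightarrow> int set \<Rightarrow> ((int \<times> int) set \<Rightarrow> real) \<Rightarrow> real" where
  "limit_window \<beta> V P f = lim (\<lambda>n. avg \<beta> (given V P n n n) f)"

lemma convergent_hit:
  assumes "\<beta> \<ge> 0"
  shows "convergent (\<lambda>N. avg \<beta> (given V P a b N) (hit A))"
    and "convergent (\<lambda>n. avg \<beta> (given V P n n n) (hit A))"
proof -
  have "incseq (\<lambda>N. avg \<beta> (given V P a b N) (hit A))"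
    using given_mono_box[OF assms] by (auto simp: incseq_def)
  then show "convergent (\<lambda>N. avg \<beta> (given V P a b N) (hit A))"
    using avg_hit_le_1 by (elim bounded_mono_convergent) (auto simp: convergent_def)
  have "incseq (\<lambda>n. avg \<beta> (given V P n n n) (hit A))"
    using given_mono_window[OF assms] by (auto simp: incseq_def)
  then show "convergent (\<lambda>n. avg \<beta> (given V P n n n) (hit A))"
    using avg_hit_le_1 by (elim bounded_mono_convergent) (auto simp: convergent_def)
qed

lemma convergent_pattern:
  assumes "\<beta> \<ge> 0" "finite E" "E \<subseteq> A"
  shows "convergent (\<lambda>N. avg \<beta> (given V P a b N) (pattern A E))"
    and "convergent (\<lambda>n. avg \<beta> (given V P n n n) (pattern A E))"
proof -
  show "convergent (\<lambda>N. avg \<beta> (given V P a b N) (pattern A E))"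
    by (rule pattern_induct[where Q="\<lambda>f. convergent (\<lambda>N. avg \<beta> (given V P a b N) f)"])
       (use assms in \<open>auto simp: avg_diff avg_one part_given_pos convergent_const intro: convergent_diff convergent_hit\<close>)
  show "convergent (\<lambda>n. avg \<beta> (given V P n n n) (pattern A E))"
    by (rule pattern_induct[where Q="\<lambda>f. convergent (\<lambda>n. avg \<beta> (given V P n n n) f)"])
       (use assms in \<open>auto simp: avg_diff avg_one part_given_pos convergent_const intro: convergent_diff convergent_hit\<close>)
qed

lemma finite_int_subset_interval:
  assumes "finite (X :: int set)"
  obtains r where "X \<subseteq> {- int r..int r}"
proof -
  have "finite (nat ` abs ` X)" using assms by simp
  then obtain r where "\<forall>x\<in>nat ` abs ` X. x \<le> r" using finite_nat_set_iff_bounded_le by blast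
  then have "X \<subseteq> {- int r..int r}" by fastforce
  then show ?thesis by (rule that)
qed

text \<open>The means with growing window increase to the specification. They bound the conditional
  probabilities of the plus phase from below by monotonicity, and from above up to the gap.\<close>

lemma windows_converge_hit:
  assumes \<beta>: "\<beta> \<ge> 20" and V: "finite V" and P: "sparse c P" and A: "A \<subseteq> V"
    and ab: "filterlim a at_top sequentially" "filterlim b at_top sequentially"
  shows "(\<lambda>j. limit_box \<beta> V P (a j) (b j) (hit (row A))) \<longlonglongrightarrow> limit_window \<beta> V P (hit (row A))"
proof -
  have \<beta>0: "\<beta> \<ge> 0" using \<beta> by simp
  let ?g = "\<lambda>n. avg \<beta> (given V P n n n) (hit (row A))"
  let ?e = "\<lambda>a b N. avg \<beta> (given V P a b N) (hit (row A))"
  define G where "G = limit_window \<beta> V P (hit (row A))"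
  define C where "C a b = limit_box \<beta> V P a b (hit (row A))" for a b
  obtain r where r: "V \<subseteq> {- int r..int r}" by (rule finite_int_subset_interval[OF V])
  have g: "?g \<longlonglongrightarrow> G" unfolding G_def limit_window_def
    using convergent_hit(2)[OF \<beta>0] by (simp add: convergent_LIMSEQ_iff)
  have e: "?e a b \<longlonglongrightarrow> C a b" for a b unfolding C_def limit_box_def
    using convergent_hit(1)[OF \<beta>0] by (simp add: convergent_LIMSEQ_iff)
  have gG: "?g n \<le> G" for n
    by (rule incseq_le[OF _ g]) (use given_mono_window[OF \<beta>0] in \<open>auto simp: incseq_def\<close>)
  define K where "K = card V * exp (16 * \<beta> * (2 * c + real r + 1))"
  have lower: "?g n \<le> C a b" if "n \<le> a" "n \<le> b" for a b n
    by (rule LIMSEQ_le_const[OF e]) (use given_mono_window[OF \<beta>0 that] in blast)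
  have upper: "C a b \<le> G + K * (2 * (1 / 2) ^ m)" if "m + r \<le> a" "m + r \<le> b" for a b m
  proof (rule LIMSEQ_le_const2[OF e], intro exI allI impI)
    fix N assume "max a b \<le> N"
    then have "?e a b N \<le> ?g N + K * (2 * (1 / 2) ^ m)"
      unfolding K_def using given_gap[OF \<beta> V r P that _ _ A, of N] by simp
    then show "?e a b N \<le> G + K * (2 * (1 / 2) ^ m)" using gG[of N] by linarith
  qed
  have "(\<lambda>j. C (a j) (b j)) \<longlonglongrightarrow> G"
  proof (rule LIMSEQ_I)
    fix \<epsilon> :: real assume "\<epsilon> > 0"
    have "(\<lambda>m. K * (2 * (1 / 2) ^ m)) \<longlonglongrightarrow> K * (2 * 0)"
      by (intro tendsto_intros LIMSEQ_realpow_zero) auto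
    then obtain m where m: "K * (2 * (1 / 2) ^ m) < \<epsilon>"
      using \<open>\<epsilon> > 0\<close> by (metis (mono_tags, lifting) mult_zero_right order_tendstoD(2) eventually_sequentially order_refl)
    obtain n where n: "norm (?g n - G) < \<epsilon>" using LIMSEQ_D[OF g \<open>\<epsilon> > 0\<close>] by blast
    have "eventually (\<lambda>j. a j \<ge> max n (m + r) \<and> b j \<ge> max n (m + r)) sequentially"
      using ab unfolding filterlim_at_top by (intro eventually_conj) blast+
    then obtain j0 where j0: "\<And>j. j \<ge> j0 \<Longrightarrow> a j \<ge> max n (m + r) \<and> b j \<ge> max n (m + r)"
      by (auto simp: eventually_sequentially)
    show "\<exists>j0. \<forall>j\<ge>j0. norm (C (a j) (b j) - G) < \<epsilon>"
    proof (intro exI allI impI)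
      fix j assume "j \<ge> j0"
      then have "?g n \<le> C (a j) (b j)" "C (a j) (b j) \<le> G + K * (2 * (1 / 2) ^ m)"
        using j0[of j] by (auto intro!: lower upper)
      then show "norm (C (a j) (b j) - G) < \<epsilon>" using m n gG[of n] by (simp add: abs_less_iff)
    qed
  qed
  then show ?thesis by (simp add: C_def G_def)
qed

lemma windows_converge:
  assumes \<beta>: "\<beta> \<ge> 20" and V: "finite V" and P: "sparse c P" and E: "E \<subseteq> V"
    and ab: "filterlim a at_top sequentially" "filterlim b at_top sequentially"
  shows "(\<lambda>j. limit_box \<beta> V P (a j) (b j) (pattern (row V) (row E))) \<longlonglongrightarrow> limit_window \<beta> V P (pattern (row V) (row E))"
proof -
  have \<beta>0: "\<beta> \<ge> 0" using \<beta> by simp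
  define Q where "Q f \<longleftrightarrow> (\<forall>a b. convergent (\<lambda>N. avg \<beta> (given V P a b N) f))
     \<and> convergent (\<lambda>n. avg \<beta> (given V P n n n) f)
     \<and> (\<lambda>j. limit_box \<beta> V P (a j) (b j) f) \<longlonglongrightarrow> limit_window \<beta> V P f" for f
  have "Q (pattern (row V) (row E))"
  proof (rule pattern_induct[where Q=Q])
    show "finite (row E)" "row E \<subseteq> row V" using E V finite_subset by (auto simp: row_def)
    show "Q (\<lambda>_. 1)"
      by (simp add: Q_def limit_box_def limit_window_def avg_one part_given_pos convergent_const)
  next
    fix f g assume fg: "Q f" "Q g"
    have box: "limit_box \<beta> V P a b (\<lambda>M. f M - g M) = limit_box \<beta> V P a b f - limit_box \<beta> V P a b g" for a b
      unfolding limit_box_def avg_diff using fg by (intro limI tendsto_diff) (auto simp: Q_def convergent_LIMSEQ_iff)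
    have win: "limit_window \<beta> V P (\<lambda>M. f M - g M) = limit_window \<beta> V P f - limit_window \<beta> V P g"
      unfolding limit_window_def avg_diff using fg by (intro limI tendsto_diff) (auto simp: Q_def convergent_LIMSEQ_iff)
    show "Q (\<lambda>M. f M - g M)" using fg unfolding Q_def box win
      by (auto simp: avg_diff intro: convergent_diff tendsto_diff)
  next
    fix A' assume "A' \<subseteq> row V"
    then have "A' = row (fst ` A')" "fst ` A' \<subseteq> V" by (force simp: row_def)+
    then show "Q (hit A')" unfolding Q_def
      using windows_converge_hit[OF \<beta> V P _ ab, of "fst ` A'"] convergent_hit[OF \<beta>0] by simp
  qed
  then show ?thesis by (simp add: Q_def)
qed

section \<open>Spin configurations and their minus sets\<close>

definition minus_set :: "('s \<Rightarrow> real) \<Rightarrow> 's set" where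
  "minus_set X = {x. X x = - 1}"

definition spin_on :: "'s set \<Rightarrow> 's set \<Rightarrow> 's \<Rightarrow> real" where
  "spin_on S M = (\<lambda>x\<in>S. if x \<in> M then - 1 else 1)"

definition cyl :: "'s set \<Rightarrow> 's set \<Rightarrow> ('s \<Rightarrow> real) set" where
  "cyl D E = {X \<in> space (configs UNIV). minus_set X \<inter> D = E}"

lemma in_minus_set [simp]: "x \<in> minus_set X \<longleftrightarrow> X x = - 1"
  by (simp add: minus_set_def)

lemma space_configs: "space (configs S) = (\<Pi>\<^sub>E x\<in>S. {- 1, 1})"
  by (simp add: configs_def space_PiM spins_def)

lemma in_configs_UNIV: "X \<in> space (configs UNIV) \<longleftrightarrow> (\<forall>x. X x = - 1 \<or> X x = 1)"
  by (auto simp: space_configs PiE_UNIV_domain Pi_iff)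

lemma finite_space_configs: "finite S \<Longrightarrow> finite (space (configs S))"
  by (simp add: space_configs finite_PiE)

lemma spin_on_in_configs [simp]: "spin_on S M \<in> space (configs S)"
  by (auto simp: space_configs spin_on_def)

lemma spin_on_minus_set: "X \<in> space (configs S) \<Longrightarrow> spin_on S (minus_set X \<inter> S) = X"
  by (auto simp: space_configs spin_on_def PiE_iff extensional_def fun_eq_iff)

lemma minus_set_spin_on: "minus_set (spin_on S M) \<inter> S = M \<inter> S"
  by (auto simp: spin_on_def split: if_splits)

lemma minus_set_Int_eq_iff:
  assumes "X \<in> space (configs UNIV)" "E \<subseteq> D"
  shows "minus_set X \<inter> D = E \<longleftrightarrow> (\<forall>x\<in>D. X x = (if x \<in> E then - 1 else 1))"
proof -
  have "minus_set X \<inter> D = E \<longleftrightarrow> (\<forall>x\<in>D. X x = - 1 \<longleftrightarrow> x \<in> E)" using assms(2) by auto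
  also have "\<dots> \<longleftrightarrow> (\<forall>x\<in>D. X x = (if x \<in> E then - 1 else 1))"
  proof (intro ball_cong refl)
    fix x
    have "X x = - 1 \<or> X x = 1" using assms(1) by (simp add: in_configs_UNIV)
    then show "(X x = - 1 \<longleftrightarrow> x \<in> E) \<longleftrightarrow> X x = (if x \<in> E then - 1 else 1)" by auto
  qed
  finally show ?thesis .
qed

lemma spin_on_eq_iff:
  assumes "E \<subseteq> A" "A \<subseteq> S"
  shows "(\<forall>x\<in>A. spin_on S M x = spin_on A E x) \<longleftrightarrow> M \<inter> A = E"
proof -
  have "spin_on S M x = spin_on A E x \<longleftrightarrow> (x \<in> M \<longleftrightarrow> x \<in> E)" if "x \<in> A" for x
    using that assms by (auto simp: spin_on_def)
  then show ?thesis using assms(1) by blast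
qed

lemma bij_spin_on: "bij_betw (spin_on S) (Pow S) (space (configs S))"
proof (rule bij_betw_byWitness[where f'="\<lambda>X. minus_set X \<inter> S"])
  show "\<forall>M\<in>Pow S. minus_set (spin_on S M) \<inter> S = M" using minus_set_spin_on[of S] by auto
  show "\<forall>X\<in>space (configs S). spin_on S (minus_set X \<inter> S) = X" by (simp add: spin_on_minus_set)
qed auto

lemma sets_configs_component: "{X \<in> space (configs UNIV). X x = v} \<in> sets (configs UNIV)"
proof -
  have "(\<lambda>X. X x) \<in> measurable (configs UNIV) (count_space spins)"
    unfolding configs_def by (rule measurable_component_singleton) simp
  then have "(\<lambda>X. X x) -` ({v} \<inter> spins) \<inter> space (configs UNIV) \<in> sets (configs UNIV)"
    by (rule measurable_sets) simp
  also have "(\<lambda>X. X x) -` ({v} \<inter> spins) \<inter> space (configs UNIV) = {X \<in> space (configs UNIV). X x = v}"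
    by (auto simp: in_configs_UNIV spins_def)
  finally show ?thesis .
qed

lemma sets_cyl [simp]: assumes "finite D" shows "cyl D E \<in> sets (configs UNIV)"
proof (cases "E \<subseteq> D")
  case True
  then have "cyl D E = {X \<in> space (configs UNIV). \<forall>x\<in>D. X x = (if x \<in> E then - 1 else 1)}"
    using minus_set_Int_eq_iff[OF _ True] unfolding cyl_def by blast
  moreover have "\<dots> \<in> sets (configs UNIV)"
    using assms sets_configs_component by (intro sets.sets_Collect_finite_All) auto
  ultimately show ?thesis by simp
next
  case False
  then have "cyl D E = {}" by (auto simp: cyl_def)
  then show ?thesis by simp
qed

text \<open>An event that depends on the spins in a finite \<open>D\<close> is a finite union of cylinders.\<close>

lemma measure_minus_event:
  assumes "finite_measure \<mu>" "sets \<mu> = sets (configs UNIV)" "finite D"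
  shows "{X \<in> space (configs UNIV). Q (minus_set X \<inter> D)} \<in> sets (configs UNIV)"
    and "measure \<mu> {X \<in> space (configs UNIV). Q (minus_set X \<inter> D)} = (\<Sum>E\<in>{E. E \<subseteq> D \<and> Q E}. measure \<mu> (cyl D E))"
proof -
  interpret finite_measure \<mu> by fact
  have eq: "{X \<in> space (configs UNIV). Q (minus_set X \<inter> D)} = (\<Union>E\<in>{E. E \<subseteq> D \<and> Q E}. cyl D E)"
    by (auto simp: cyl_def)
  have fin: "finite {E. E \<subseteq> D \<and> Q E}" by (rule finite_subset[of _ "Pow D"]) (use assms(3) in auto)
  show "{X \<in> space (configs UNIV). Q (minus_set X \<inter> D)} \<in> sets (configs UNIV)"
    unfolding eq using fin assms by (intro sets.finite_UN) auto
  show "measure \<mu> {X \<in> space (configs UNIV). Q (minus_set X \<inter> D)} = (\<Sum>E\<in>{E. E \<subseteq> D \<and> Q E}. measure \<mu> (cyl D E))"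
    unfolding eq
  proof (rule finite_measure_finite_Union[OF fin])
    show "(\<lambda>E. cyl D E) ` {E. E \<subseteq> D \<and> Q E} \<subseteq> sets \<mu>" using assms by auto
    show "disjoint_family_on (\<lambda>E. cyl D E) {E. E \<subseteq> D \<and> Q E}"
      by (auto simp: disjoint_family_on_def cyl_def)
  qed
qed

lemma configs_measure_eqI:
  fixes \<mu> \<nu> :: "('s \<Rightarrow> real) measure"
  assumes M: "finite_measure \<mu>" "sets \<mu> = sets (configs UNIV)"
    and N: "finite_measure \<nu>" "sets \<nu> = sets (configs UNIV)"
    and eq: "\<And>D E. finite D \<Longrightarrow> E \<subseteq> D \<Longrightarrow> measure \<mu> (cyl D E) = measure \<nu> (cyl D E)"
  shows "\<mu> = \<nu>"
proof (rule measure_eqI_PiM_infinite)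
  show "sets \<mu> = sets (PiM UNIV (\<lambda>_. count_space spins))" "sets \<nu> = sets (PiM UNIV (\<lambda>_. count_space spins))"
    using M N by (simp_all add: configs_def)
  show "finite_measure \<mu>" by fact
  fix A and J :: "'s set" assume J: "finite J" "\<And>i. i \<in> J \<Longrightarrow> A i \<in> sets (count_space spins)"
  define Q where "Q E \<longleftrightarrow> (\<forall>x\<in>J. (if x \<in> E then - 1 else 1 :: real) \<in> A x)" for E
  have "prod_emb UNIV (\<lambda>_. count_space spins) J (Pi\<^sub>E J A) = {X \<in> space (configs UNIV). \<forall>x\<in>J. X x \<in> A x}"
    by (auto simp: prod_emb_def configs_def space_PiM PiE_iff)
  also have "\<dots> = {X \<in> space (configs UNIV). Q (minus_set X \<inter> J)}"
  proof -
    have "X x = (if x \<in> minus_set X \<inter> J then - 1 else 1)" if "X \<in> space (configs UNIV)" "x \<in> J" for X x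
      using that by (auto simp: in_configs_UNIV)
    then show ?thesis unfolding Q_def by (metis (no_types, lifting))
  qed
  finally have emb: "prod_emb UNIV (\<lambda>_. count_space spins) J (Pi\<^sub>E J A) = {X \<in> space (configs UNIV). Q (minus_set X \<inter> J)}" .
  have "measure \<mu> {X \<in> space (configs UNIV). Q (minus_set X \<inter> J)} = measure \<nu> {X \<in> space (configs UNIV). Q (minus_set X \<inter> J)}"
    unfolding measure_minus_event(2)[OF M J(1)] measure_minus_event(2)[OF N J(1)]
    using eq J(1) by (intro sum.cong) auto
  then show "emeasure \<mu> (prod_emb UNIV (\<lambda>_. count_space spins) J (Pi\<^sub>E J A)) = emeasure \<nu> (prod_emb UNIV (\<lambda>_. count_space spins) J (Pi\<^sub>E J A))"
    unfolding emb using M N by (simp add: finite_measure.emeasure_eq_measure)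
qed


section \<open>The finite-volume measures\<close>

lemma ising_weight_spin_on:
  assumes "finite \<Lambda>" "M \<subseteq> \<Lambda>"
  shows "ising_weight \<Lambda> \<beta> (spin_on \<Lambda> M) = bw \<beta> M"
proof -
  have g: "glue \<Lambda> (spin_on \<Lambda> M) (\<lambda>_. 1) z = (if z \<in> M then - 1 else 1)" for z
    using assms by (auto simp: glue_def spin_on_def)
  have "(\<Prod>z\<in>e. glue \<Lambda> (spin_on \<Lambda> M) (\<lambda>_. 1) z) - 1 = (if e \<in> cut M then - 2 else 0)" if "e \<in> bonds \<Lambda>" for e
  proof -
    obtain x y where e: "e = {x, y}" "neighbours x y" using \<open>e \<in> bonds \<Lambda>\<close> by (auto simp: bonds_def)
    then have "x \<noteq> y" using neighbours_irrefl by blast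
    then show ?thesis using e by (auto simp: g pair_in_cut[OF e(2)])
  qed
  then have "(\<Sum>e\<in>bonds \<Lambda>. (\<Prod>z\<in>e. glue \<Lambda> (spin_on \<Lambda> M) (\<lambda>_. 1) z) - 1) = (\<Sum>e\<in>bonds \<Lambda>. if e \<in> cut M then - 2 else 0)"
    by (intro sum.cong) auto
  also have "\<dots> = - 2 * real (card (cut M))"
    using finite_bonds[OF assms(1)] cut_subset_bonds[OF assms(2)] by (simp add: sum.If_cases Int_absorb1)
  finally show ?thesis unfolding ising_weight_def bw_def by (simp add: algebra_simps)
qed

lemma Pow_eq_interval: "Pow S = {{}..S}"
  by auto

lemma prob_ising:
  assumes "finite \<Lambda>"
  shows "\<P>(X in ising_plus_finite \<Lambda> \<beta>. Q X) = avg \<beta> {{}..\<Lambda>} (\<lambda>M. of_bool (Q (spin_on \<Lambda> M)))"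
proof -
  note fin = finite_space_configs[OF assms]
  have sum: "(\<Sum>\<tau>\<in>space (configs \<Lambda>). f \<tau>) = (\<Sum>M\<in>{{}..\<Lambda>}. f (spin_on \<Lambda> M))" for f :: "_ \<Rightarrow> real"
    using sum.reindex_bij_betw[OF bij_spin_on[of \<Lambda>], of f] by (simp add: Pow_eq_interval)
  define Z where "Z = (\<Sum>\<tau>\<in>space (configs \<Lambda>). ising_weight \<Lambda> \<beta> \<tau>)"
  have Z: "Z = part \<beta> {{}..\<Lambda>}" unfolding Z_def sum part_def
    using ising_weight_spin_on[OF assms] by (intro sum.cong) auto
  have w: "ising_weight \<Lambda> \<beta> \<tau> \<ge> 0" for \<tau> by (simp add: ising_weight_def)
  have "emeasure (ising_plus_finite \<Lambda> \<beta>) {X \<in> space (configs \<Lambda>). Q X}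
      = (\<Sum>X\<in>{X \<in> space (configs \<Lambda>). Q X}. ennreal (ising_weight \<Lambda> \<beta> X / Z))"
    unfolding ising_plus_finite_def Z_def using fin by (intro emeasure_point_measure_finite) auto
  also have "\<dots> = ennreal (\<Sum>X\<in>{X \<in> space (configs \<Lambda>). Q X}. ising_weight \<Lambda> \<beta> X / Z)"
    using w Z by (intro sum_ennreal) simp
  finally have "measure (ising_plus_finite \<Lambda> \<beta>) {X \<in> space (configs \<Lambda>). Q X}
     = (\<Sum>X\<in>{X \<in> space (configs \<Lambda>). Q X}. ising_weight \<Lambda> \<beta> X / Z)"
    using w Z by (simp add: measure_def sum_nonneg)
  also have "\<dots> = (\<Sum>X\<in>space (configs \<Lambda>). (ising_weight \<Lambda> \<beta> X / Z) * of_bool (Q X))"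
    using fin by (intro sum.mono_neutral_cong_left) auto
  also have "\<dots> = avg \<beta> {{}..\<Lambda>} (\<lambda>M. of_bool (Q (spin_on \<Lambda> M)))"
    unfolding sum avg_def Z sum_divide_distrib
    by (intro sum.cong) (auto simp: ising_weight_spin_on[OF assms])
  finally show ?thesis by (simp add: ising_plus_finite_def space_point_measure)
qed

text \<open>Conditioning on the spins in \<open>W\<close> restricts the configurations to an interval.\<close>

lemma avg_condition:
  assumes "finite \<Lambda>" "B \<subseteq> W" "W \<subseteq> \<Lambda>" "A \<inter> W = {}" "E \<subseteq> A"
  shows "avg \<beta> {{}..\<Lambda>} (pattern (W \<union> A) (B \<union> E))
      = avg \<beta> {{}..\<Lambda>} (pattern W B) * avg \<beta> {B..(\<Lambda> - W) \<union> B} (pattern A E)"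
proof -
  define I where "I = {B..(\<Lambda> - W) \<union> B}"
  have fin: "finite {{}..\<Lambda>}" using assms by simp
  have I: "I = {M\<in>{{}..\<Lambda>}. M \<inter> W = B}" unfolding I_def using assms(2,3)
    by (intro set_eqI iffI) (simp, blast, simp, blast)
  have 1: "(\<Sum>M\<in>{{}..\<Lambda>}. bw \<beta> M * pattern (W \<union> A) (B \<union> E) M) = (\<Sum>M\<in>I. bw \<beta> M * pattern A E M)"
  proof (rule sum.mono_neutral_cong_right[OF fin])
    have *: "M \<inter> (W \<union> A) = B \<union> E \<longleftrightarrow> M \<inter> W = B \<and> M \<inter> A = E" for M using assms by blast
    show "\<forall>M\<in>{{}..\<Lambda>} - I. bw \<beta> M * pattern (W \<union> A) (B \<union> E) M = 0"
      unfolding I pattern_def * by auto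
    show "bw \<beta> M * pattern (W \<union> A) (B \<union> E) M = bw \<beta> M * pattern A E M" if "M \<in> I" for M
      using that unfolding I pattern_def * by auto
  qed (auto simp: I)
  have 2: "(\<Sum>M\<in>{{}..\<Lambda>}. bw \<beta> M * pattern W B M) = part \<beta> I" unfolding part_def
    by (rule sum.mono_neutral_cong_right[OF fin]) (auto simp: I pattern_def)
  have "part \<beta> I > 0" "part \<beta> {{}..\<Lambda>} > 0"
    unfolding I_def using assms finite_subset[of B \<Lambda>] by (auto intro!: part_pos)
  then show ?thesis unfolding avg_def I_def[symmetric] 1 2 by simp
qed

lemma avg_pattern_pos:
  assumes "finite \<Lambda>" "E \<subseteq> A" "A \<subseteq> \<Lambda>"
  shows "avg \<beta> {{}..\<Lambda>} (pattern A E) > 0"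
proof -
  have "(\<Sum>M\<in>{{}..\<Lambda>}. bw \<beta> M * pattern A E M) > 0"
    using assms by (intro sum_pos2[of _ E]) (auto simp: pattern_def)
  moreover have "part \<beta> {{}..\<Lambda>} > 0" using assms by (intro part_pos) auto
  ultimately show ?thesis by (simp add: avg_def)
qed


section \<open>Existence and uniqueness of the plus phase\<close>

abbreviation "vol \<equiv> finite_subsets_at_top (UNIV :: (int \<times> int) set)"

lemma is_plus_phase_iff:
  "is_plus_phase \<beta> P \<longleftrightarrow> prob_space P \<and> sets P = sets (configs UNIV) \<and>
     (\<forall>A E. finite A \<longrightarrow> E \<subseteq> A \<longrightarrow> ((\<lambda>\<Lambda>. avg \<beta> {{}..\<Lambda>} (pattern A E)) \<longlongrightarrow> measure P (cyl A E)) vol)"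
proof -
  have *: "((\<lambda>\<Lambda>. \<P>(X in ising_plus_finite \<Lambda> \<beta>. \<forall>x\<in>A. X x = a x)) \<longlongrightarrow> \<P>(X in P. \<forall>x\<in>A. X x = a x)) vol
     \<longleftrightarrow> ((\<lambda>\<Lambda>. avg \<beta> {{}..\<Lambda>} (pattern A E)) \<longlongrightarrow> measure P (cyl A E)) vol"
    if A: "finite A" "E \<subseteq> A" and a: "a = spin_on A E" and P: "sets P = sets (configs UNIV)" for A E a
  proof -
    have "space P = space (configs UNIV)" using P by (rule sets_eq_imp_space_eq)
    then have 1: "{X \<in> space P. \<forall>x\<in>A. X x = a x} = cyl A E"
    proof -
      have "(\<forall>x\<in>A. X x = a x) \<longleftrightarrow> (\<forall>x\<in>A. X x = (if x \<in> E then - 1 else 1))" for X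
        unfolding a by (simp add: spin_on_def)
      then show ?thesis unfolding cyl_def \<open>space P = space (configs UNIV)\<close>
        using minus_set_Int_eq_iff[OF _ A(2)] by blast
    qed
    have 2: "eventually (\<lambda>\<Lambda>. \<P>(X in ising_plus_finite \<Lambda> \<beta>. \<forall>x\<in>A. X x = a x) = avg \<beta> {{}..\<Lambda>} (pattern A E)) vol"
      unfolding eventually_finite_subsets_at_top
    proof (intro exI conjI allI impI)
      fix \<Lambda> assume \<Lambda>: "finite \<Lambda> \<and> A \<subseteq> \<Lambda> \<and> \<Lambda> \<subseteq> UNIV"
      have "(\<forall>x\<in>A. spin_on \<Lambda> M x = a x) \<longleftrightarrow> M \<inter> A = E" for M
        unfolding a using A \<Lambda> by (intro spin_on_eq_iff) auto
      then show "\<P>(X in ising_plus_finite \<Lambda> \<beta>. \<forall>x\<in>A. X x = a x) = avg \<beta> {{}..\<Lambda>} (pattern A E)"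
        using \<Lambda> by (simp add: prob_ising pattern_def[abs_def])
    qed (use A in auto)
    show ?thesis unfolding 1 by (rule filterlim_cong[OF refl refl 2])
  qed
  have spin: "a = spin_on A (minus_set a \<inter> A)" if "a \<in> space (configs A)" for a :: "int \<times> int \<Rightarrow> real" and A
    using spin_on_minus_set[OF that] by simp
  show ?thesis unfolding is_plus_phase_def
  proof (intro conj_cong refl iffI allI impI)
    fix A E :: "(int \<times> int) set"
    assume P: "sets P = sets (configs UNIV)" and A: "finite A" "E \<subseteq> A"
      and h: "\<forall>A a. finite A \<longrightarrow> a \<in> space (configs A) \<longrightarrow>
        ((\<lambda>\<Lambda>. \<P>(X in ising_plus_finite \<Lambda> \<beta>. \<forall>x\<in>A. X x = a x)) \<longlongrightarrow> \<P>(X in P. \<forall>x\<in>A. X x = a x)) vol"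
    show "((\<lambda>\<Lambda>. avg \<beta> {{}..\<Lambda>} (pattern A E)) \<longlongrightarrow> measure P (cyl A E)) vol"
      using h[rule_format, OF A(1) spin_on_in_configs[of A E]] *[OF A refl P] by simp
  next
    fix A :: "(int \<times> int) set" and a :: "int \<times> int \<Rightarrow> real"
    assume P: "sets P = sets (configs UNIV)" and A: "finite A" and a: "a \<in> space (configs A)"
      and h: "\<forall>A E. finite A \<longrightarrow> E \<subseteq> A \<longrightarrow> ((\<lambda>\<Lambda>. avg \<beta> {{}..\<Lambda>} (pattern A E)) \<longlongrightarrow> measure P (cyl A E)) vol"
    show "((\<lambda>\<Lambda>. \<P>(X in ising_plus_finite \<Lambda> \<beta>. \<forall>x\<in>A. X x = a x)) \<longlongrightarrow> \<P>(X in P. \<forall>x\<in>A. X x = a x)) vol"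
      using h[rule_format, OF A, of "minus_set a \<inter> A"] *[OF A _ spin[OF a] P] by simp
  qed
qed

lemma plus_phase_unique:
  assumes "is_plus_phase \<beta> P" "is_plus_phase \<beta> P'"
  shows "P = P'"
proof (rule configs_measure_eqI)
  show "finite_measure P" "finite_measure P'" "sets P = sets (configs UNIV)" "sets P' = sets (configs UNIV)"
    using assms by (simp_all add: is_plus_phase_iff prob_space.axioms(1) prob_space_def)
  show "measure P (cyl D E) = measure P' (cyl D E)" if "finite D" "E \<subseteq> D" for D E
  proof (rule tendsto_unique[of vol])
    show "((\<lambda>\<Lambda>. avg \<beta> {{}..\<Lambda>} (pattern D E)) \<longlongrightarrow> measure P (cyl D E)) vol"
      using assms(1) that unfolding is_plus_phase_iff by blast
    show "((\<lambda>\<Lambda>. avg \<beta> {{}..\<Lambda>} (pattern D E)) \<longlongrightarrow> measure P' (cyl D E)) vol"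
      using assms(2) that unfolding is_plus_phase_iff by blast
  qed simp
qed

text \<open>Increasing functions of the volume converge along the net of all finite volumes.\<close>

lemma vol_mono_convergent:
  fixes f :: "(int \<times> int) set \<Rightarrow> real"
  assumes mono: "\<And>\<Lambda> \<Lambda>'. finite \<Lambda>' \<Longrightarrow> \<Lambda> \<subseteq> \<Lambda>' \<Longrightarrow> f \<Lambda> \<le> f \<Lambda>'" and bd: "\<And>\<Lambda>. f \<Lambda> \<le> b"
  shows "(f \<longlongrightarrow> (SUP \<Lambda>\<in>{\<Lambda>. finite \<Lambda>}. f \<Lambda>)) vol"
proof (rule order_tendstoI)
  have bdd: "bdd_above (f ` {\<Lambda>. finite \<Lambda>})" using bd by (intro bdd_aboveI2)
  fix a
  {
    assume "a < (SUP \<Lambda>\<in>{\<Lambda>. finite \<Lambda>}. f \<Lambda>)"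
    then obtain \<Lambda>0 where "finite \<Lambda>0" "a < f \<Lambda>0"
      using less_cSUP_iff[OF _ bdd] by (metis (mono_tags) empty_iff finite.emptyI mem_Collect_eq)
    then show "eventually (\<lambda>\<Lambda>. a < f \<Lambda>) vol"
      unfolding eventually_finite_subsets_at_top using mono by (meson order_less_le_trans subset_UNIV)
  next
    assume a: "(SUP \<Lambda>\<in>{\<Lambda>. finite \<Lambda>}. f \<Lambda>) < a"
    have "f \<Lambda> < a" if "finite \<Lambda>" for \<Lambda>
      using cSUP_upper[OF _ bdd, of \<Lambda>] that a by simp
    then show "eventually (\<lambda>\<Lambda>. f \<Lambda> < a) vol" by (intro eventually_finite_subsets_at_top_weakI)
  }
qed

definition plus_prob :: "real \<Rightarrow> (int \<times> int) set \<Rightarrow> (int \<times> int) set \<Rightarrow> real" where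
  "plus_prob \<beta> A E = Lim vol (\<lambda>\<Lambda>. avg \<beta> {{}..\<Lambda>} (pattern A E))"

lemma plus_prob:
  assumes "\<beta> \<ge> 0" "finite A" "E \<subseteq> A"
  shows "((\<lambda>\<Lambda>. avg \<beta> {{}..\<Lambda>} (pattern A E)) \<longlongrightarrow> plus_prob \<beta> A E) vol"
proof -
  have one: "eventually (\<lambda>\<Lambda>. avg \<beta> {{}..\<Lambda>} (\<lambda>_. 1) = 1) vol"
    by (intro eventually_finite_subsets_at_top_weakI avg_one part_pos) auto
  have "\<exists>l. ((\<lambda>\<Lambda>. avg \<beta> {{}..\<Lambda>} (pattern A E)) \<longlongrightarrow> l) vol"
  proof (rule pattern_induct[where Q="\<lambda>f. \<exists>l. ((\<lambda>\<Lambda>. avg \<beta> {{}..\<Lambda>} f) \<longlongrightarrow> l) vol"])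
    show "finite E" "E \<subseteq> A" using assms finite_subset by auto
    show "\<exists>l. ((\<lambda>\<Lambda>. avg \<beta> {{}..\<Lambda>} (\<lambda>_. 1)) \<longlongrightarrow> l) vol"
      using tendsto_eventually[OF one] by blast
    show "\<exists>l. ((\<lambda>\<Lambda>. avg \<beta> {{}..\<Lambda>} (\<lambda>M. f M - g M)) \<longlongrightarrow> l) vol"
      if "\<exists>l. ((\<lambda>\<Lambda>. avg \<beta> {{}..\<Lambda>} f) \<longlongrightarrow> l) vol" "\<exists>l. ((\<lambda>\<Lambda>. avg \<beta> {{}..\<Lambda>} g) \<longlongrightarrow> l) vol" for f g
      unfolding avg_diff using that tendsto_diff by blast
    show "\<exists>l. ((\<lambda>\<Lambda>. avg \<beta> {{}..\<Lambda>} (hit A')) \<longlongrightarrow> l) vol" for A'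
      by (rule exI, rule vol_mono_convergent[OF _ avg_hit_le_1])
         (use assms in \<open>intro avg_mono_interval mono_hit hit_nonneg; auto\<close>)
  qed
  then show ?thesis unfolding plus_prob_def
    by (metis finite_subsets_at_top_neq_bot tendsto_Lim)
qed

lemma plus_prob_nonneg:
  assumes "\<beta> \<ge> 0" "finite A" "E \<subseteq> A" shows "plus_prob \<beta> A E \<ge> 0"
  by (rule tendsto_lowerbound[OF plus_prob[OF assms]])
     (auto intro!: eventually_finite_subsets_at_top_weakI avg_nonneg simp: pattern_def)

lemma avg_sum: "avg \<beta> I (\<lambda>M. \<Sum>k\<in>K. f k M) = (\<Sum>k\<in>K. avg \<beta> I (f k))"
  unfolding avg_def by (simp add: sum_distrib_left sum_divide_distrib[symmetric] sum.swap[of _ K])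

lemma plus_prob_consistent:
  assumes "\<beta> \<ge> 0" "finite H" "J \<subseteq> H" "E \<subseteq> J"
  shows "(\<Sum>E'\<in>{E'. E' \<subseteq> H \<and> E' \<inter> J = E}. plus_prob \<beta> H E') = plus_prob \<beta> J E"
proof (rule tendsto_unique[of vol])
  have fin: "finite {E'. E' \<subseteq> H \<and> E' \<inter> J = E}" by (rule finite_subset[of _ "Pow H"]) (use assms in auto)
  have "(\<Sum>E'\<in>{E'. E' \<subseteq> H \<and> E' \<inter> J = E}. pattern H E' M) = pattern J E M" for M
  proof -
    have "(\<Sum>E'\<in>{E'. E' \<subseteq> H \<and> E' \<inter> J = E}. pattern H E' M) = (\<Sum>E'\<in>{E'. E' \<subseteq> H \<and> E' \<inter> J = E}. if E' = M \<inter> H then 1 else 0)"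
      by (intro sum.cong) (auto simp: pattern_def)
    also have "\<dots> = (if M \<inter> H \<inter> J = E then 1 else 0)" using fin by (simp add: sum.delta')
    also have "M \<inter> H \<inter> J = M \<inter> J" using assms by auto
    finally show ?thesis by (simp add: pattern_def)
  qed
  then have "(\<Sum>E'\<in>{E'. E' \<subseteq> H \<and> E' \<inter> J = E}. avg \<beta> {{}..\<Lambda>} (pattern H E')) = avg \<beta> {{}..\<Lambda>} (pattern J E)" for \<Lambda>
    unfolding avg_sum[symmetric] by simp
  moreover have "((\<lambda>\<Lambda>. \<Sum>E'\<in>{E'. E' \<subseteq> H \<and> E' \<inter> J = E}. avg \<beta> {{}..\<Lambda>} (pattern H E'))
      \<longlongrightarrow> (\<Sum>E'\<in>{E'. E' \<subseteq> H \<and> E' \<inter> J = E}. plus_prob \<beta> H E')) vol"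
    using assms by (intro tendsto_sum plus_prob) auto
  ultimately show "((\<lambda>\<Lambda>. avg \<beta> {{}..\<Lambda>} (pattern J E)) \<longlongrightarrow> (\<Sum>E'\<in>{E'. E' \<subseteq> H \<and> E' \<inter> J = E}. plus_prob \<beta> H E')) vol"
    by simp
  show "((\<lambda>\<Lambda>. avg \<beta> {{}..\<Lambda>} (pattern J E)) \<longlongrightarrow> plus_prob \<beta> J E) vol"
    using assms finite_subset by (intro plus_prob) auto
qed simp

lemma plus_prob_sum:
  assumes "\<beta> \<ge> 0" "finite H"
  shows "(\<Sum>E\<in>Pow H. plus_prob \<beta> H E) = 1"
proof -
  have "(\<Sum>E\<in>Pow H. plus_prob \<beta> H E) = (\<Sum>E'\<in>{E'. E' \<subseteq> H \<and> E' \<inter> {} = {}}. plus_prob \<beta> H E')"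
    by (intro sum.cong) auto
  also have "\<dots> = plus_prob \<beta> {} {}" by (rule plus_prob_consistent) (use assms in auto)
  also have "\<dots> = 1"
  proof (rule tendsto_unique[of vol])
    show "((\<lambda>\<Lambda>. avg \<beta> {{}..\<Lambda>} (pattern {} {})) \<longlongrightarrow> plus_prob \<beta> {} {}) vol"
      using assms by (intro plus_prob) auto
    have "eventually (\<lambda>\<Lambda>. avg \<beta> {{}..\<Lambda>} (pattern {} {}) = 1) vol"
      unfolding pattern_def by (intro eventually_finite_subsets_at_top_weakI) (simp add: avg_one part_pos)
    then show "((\<lambda>\<Lambda>. avg \<beta> {{}..\<Lambda>} (pattern {} {})) \<longlongrightarrow> 1) vol" by (rule tendsto_eventually)
  qed simp
  finally show ?thesis .
qed

text \<open>Kolmogorov extension of the limits of the cylinder probabilities. The extension theorem is about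
  real-valued coordinates with their Borel sets, so the limits are first transported to real
  configurations; at the end each coordinate is mapped back to a spin.\<close>

definition pattern_measure :: "real \<Rightarrow> (int \<times> int) set \<Rightarrow> (int \<times> int) set measure" where
  "pattern_measure \<beta> J = point_measure (Pow J) (\<lambda>E. ennreal (plus_prob \<beta> J E))"

definition marginal_law :: "real \<Rightarrow> (int \<times> int) set \<Rightarrow> (int \<times> int \<Rightarrow> real) measure" where
  "marginal_law \<beta> J = distr (pattern_measure \<beta> J) (PiM J (\<lambda>_. borel)) (spin_on J)"

lemma pattern_measure_singleton:
  assumes "finite J" "E \<subseteq> J"
  shows "emeasure (pattern_measure \<beta> J) {E} = ennreal (plus_prob \<beta> J E)"
  unfolding pattern_measure_def using assms by (subst emeasure_point_measure_finite) auto

lemma prob_space_pattern_measure: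
  assumes "\<beta> \<ge> 0" "finite J" shows "prob_space (pattern_measure \<beta> J)"
proof
  have "emeasure (pattern_measure \<beta> J) (Pow J) = (\<Sum>E\<in>Pow J. ennreal (plus_prob \<beta> J E))"
    unfolding pattern_measure_def using assms by (intro emeasure_point_measure_finite) auto
  also have "\<dots> = ennreal (\<Sum>E\<in>Pow J. plus_prob \<beta> J E)"
    using assms plus_prob_nonneg by (intro sum_ennreal) auto
  finally show "emeasure (pattern_measure \<beta> J) (space (pattern_measure \<beta> J)) = 1"
    using plus_prob_sum[OF assms] by (simp add: pattern_measure_def space_point_measure)
qed

lemma pattern_measure_consistent:
  assumes "\<beta> \<ge> 0" "finite H" "J \<subseteq> H"
  shows "distr (pattern_measure \<beta> H) (pattern_measure \<beta> J) (\<lambda>E. E \<inter> J) = pattern_measure \<beta> J"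
proof (rule measure_eqI_finite[where A="Pow J"])
  have J: "finite J" using assms finite_subset by auto
  then show "finite (Pow J)" by simp
  show "sets (distr (pattern_measure \<beta> H) (pattern_measure \<beta> J) (\<lambda>E. E \<inter> J)) = Pow (Pow J)"
    "sets (pattern_measure \<beta> J) = Pow (Pow J)"
    by (simp_all add: pattern_measure_def sets_point_measure)
  fix E assume "E \<in> Pow J"
  then have E: "E \<subseteq> J" by simp
  have "(\<lambda>E. E \<inter> J) \<in> measurable (pattern_measure \<beta> H) (pattern_measure \<beta> J)"
    by (simp add: pattern_measure_def space_point_measure)
  then have "emeasure (distr (pattern_measure \<beta> H) (pattern_measure \<beta> J) (\<lambda>E. E \<inter> J)) {E}
      = emeasure (pattern_measure \<beta> H) {E'. E' \<subseteq> H \<and> E' \<inter> J = E}"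
    using E by (subst emeasure_distr)
      (auto simp: pattern_measure_def sets_point_measure space_point_measure intro!: arg_cong2[where f=emeasure])
  also have "\<dots> = (\<Sum>E'\<in>{E'. E' \<subseteq> H \<and> E' \<inter> J = E}. ennreal (plus_prob \<beta> H E'))"
    unfolding pattern_measure_def using assms by (intro emeasure_point_measure_finite) auto
  also have "\<dots> = ennreal (\<Sum>E'\<in>{E'. E' \<subseteq> H \<and> E' \<inter> J = E}. plus_prob \<beta> H E')"
    using assms plus_prob_nonneg by (intro sum_ennreal) auto
  finally show "emeasure (distr (pattern_measure \<beta> H) (pattern_measure \<beta> J) (\<lambda>E. E \<inter> J)) {E} = emeasure (pattern_measure \<beta> J) {E}"
    using plus_prob_consistent[OF assms E] pattern_measure_singleton[OF J E] by simp
qed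

lemma measurable_spin_on: "spin_on J \<in> measurable (pattern_measure \<beta> J) (PiM J (\<lambda>_. borel))"
  by (auto simp: pattern_measure_def space_PiM spin_on_def)

lemma projective_marginal_law:
  assumes "\<beta> \<ge> 0"
  shows "polish_projective UNIV (marginal_law \<beta>)"
proof (intro polish_projective.intro projective_family.intro)
  fix J :: "(int \<times> int) set" assume "finite J"
  then show "prob_space (marginal_law \<beta> J)" unfolding marginal_law_def
    using prob_space_pattern_measure[OF assms] by (intro prob_space.prob_space_distr measurable_spin_on) auto
next
  fix J H :: "(int \<times> int) set" assume JH: "J \<subseteq> H" "finite H"
  have meas: "(\<lambda>E. E \<inter> J) \<in> measurable (pattern_measure \<beta> H) (pattern_measure \<beta> J)"
    by (simp add: pattern_measure_def space_point_measure)
  have "distr (marginal_law \<beta> H) (PiM J (\<lambda>_. borel)) (\<lambda>f. restrict f J)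
      = distr (pattern_measure \<beta> H) (PiM J (\<lambda>_. borel)) (\<lambda>E. restrict (spin_on H E) J)"
    unfolding marginal_law_def using JH
    by (subst distr_distr) (auto simp: comp_def intro: measurable_restrict_subset measurable_spin_on)
  also have "\<dots> = distr (pattern_measure \<beta> H) (PiM J (\<lambda>_. borel)) (\<lambda>E. spin_on J (E \<inter> J))"
    using JH by (intro distr_cong) (auto simp: spin_on_def restrict_def fun_eq_iff)
  also have "\<dots> = distr (distr (pattern_measure \<beta> H) (pattern_measure \<beta> J) (\<lambda>E. E \<inter> J)) (PiM J (\<lambda>_. borel)) (spin_on J)"
    by (subst distr_distr[OF measurable_spin_on meas]) (simp add: comp_def)
  also have "\<dots> = marginal_law \<beta> J"
    unfolding pattern_measure_consistent[OF assms JH(2,1)] marginal_law_def ..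
  finally show "marginal_law \<beta> J = distr (marginal_law \<beta> H) (PiM J (\<lambda>_. borel)) (\<lambda>f. restrict f J)" by simp
qed

lemma plus_phase_exists:
  assumes "\<beta> \<ge> 0"
  shows "\<exists>P. is_plus_phase \<beta> P"
proof -
  interpret polish_projective UNIV "marginal_law \<beta>" by (rule projective_marginal_law[OF assms])
  \<comment> \<open>Values other than 1 and -1 have probability 0; sending them to 1 makes \<open>\<phi>\<close> total.\<close>
  define \<phi> :: "(int \<times> int \<Rightarrow> real) \<Rightarrow> int \<times> int \<Rightarrow> real" where "\<phi> X = (\<lambda>x. if X x = - 1 then - 1 else 1)" for X
  have \<phi>: "\<phi> \<in> measurable lim (configs UNIV)"
    unfolding configs_def \<phi>_def
  proof (rule measurable_PiM_single')
    fix x :: "int \<times> int"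
    have "(\<lambda>X. X x) \<in> borel_measurable lim" by (simp cong: measurable_cong_sets)
    then have "(\<lambda>X. X x) -` {- 1} \<inter> space lim \<in> sets lim" by (rule measurable_sets) simp
    then have "{X \<in> space lim. X x = - 1} \<in> sets lim" by (simp add: vimage_def Int_def conj_commute)
    then show "(\<lambda>X. if X x = - 1 then - 1 else 1) \<in> measurable lim (count_space spins)"
      by (intro measurable_If) (auto simp: spins_def)
  qed (auto simp: spins_def)
  define P where "P = distr lim (configs UNIV) \<phi>"
  have cylP: "measure P (cyl A E) = plus_prob \<beta> A E" if A: "finite A" "E \<subseteq> A" for A E
  proof -
    define S where "S = (\<Pi>\<^sub>E x\<in>A. if x \<in> E then {- 1} else - {- 1 :: real})"
    have S: "S \<in> sets (PiM A (\<lambda>_. borel))" unfolding S_def using A by (intro sets_PiM_I_finite) auto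
    have "measure P (cyl A E) = measure lim (\<phi> -` cyl A E \<inter> space lim)"
      unfolding P_def using \<phi> A by (intro measure_distr) auto
    also have "\<phi> -` cyl A E \<inter> space lim = prod_emb UNIV (\<lambda>_. borel) A S"
    proof -
      have "\<phi> X \<in> cyl A E \<longleftrightarrow> restrict X A \<in> S" for X
      proof -
        have sp: "\<phi> X \<in> space (configs UNIV)" by (simp add: \<phi>_def in_configs_UNIV)
        have "\<phi> X \<in> cyl A E \<longleftrightarrow> (\<forall>x\<in>A. \<phi> X x = (if x \<in> E then - 1 else 1))"
          using minus_set_Int_eq_iff[OF sp A(2)] sp by (simp add: cyl_def)
        also have "\<dots> \<longleftrightarrow> (\<forall>x\<in>A. X x \<in> (if x \<in> E then {- 1} else - {- 1}))"
          by (intro ball_cong refl) (simp add: \<phi>_def)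
        finally show ?thesis by (simp add: S_def PiE_iff)
      qed
      then show ?thesis by (simp add: prod_emb_def space_PiM set_eq_iff)
    qed
    also have "measure lim (prod_emb UNIV (\<lambda>_. borel) A S) = measure (marginal_law \<beta> A) S"
      using A S by (intro measure_lim_emb) auto
    also have "\<dots> = measure (pattern_measure \<beta> A) (spin_on A -` S \<inter> space (pattern_measure \<beta> A))"
      unfolding marginal_law_def using S by (intro measure_distr measurable_spin_on)
    also have "spin_on A -` S \<inter> space (pattern_measure \<beta> A) = {E}"
    proof -
      have "spin_on A E' \<in> S \<longleftrightarrow> E' = E" if "E' \<subseteq> A" for E'
      proof -
        have "spin_on A E' \<in> S \<longleftrightarrow> (\<forall>x\<in>A. (if x \<in> E' then - 1 else 1) \<in> (if x \<in> E then {- 1} else - {- 1 :: real}))"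
          by (simp add: S_def PiE_iff spin_on_def)
        also have "\<dots> \<longleftrightarrow> (\<forall>x\<in>A. x \<in> E' \<longleftrightarrow> x \<in> E)" by (intro ball_cong refl) simp
        also have "\<dots> \<longleftrightarrow> E' = E" using that A(2) by blast
        finally show ?thesis .
      qed
      then show ?thesis using A(2) by (auto simp: pattern_measure_def space_point_measure)
    qed
    also have "measure (pattern_measure \<beta> A) {E} = plus_prob \<beta> A E"
      unfolding measure_def using pattern_measure_singleton[OF A] plus_prob_nonneg[OF assms A] by simp
    finally show ?thesis .
  qed
  have "prob_space P" unfolding P_def by (rule P.prob_space_distr[OF \<phi>])
  then have "is_plus_phase \<beta> P" unfolding is_plus_phase_iff using cylP plus_prob[OF assms]
    by (auto simp: P_def)
  then show ?thesis ..
qed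

lemma plus_phase: "\<beta> \<ge> 0 \<Longrightarrow> is_plus_phase \<beta> (plus_phase \<beta>)"
  unfolding plus_phase_def using plus_phase_exists plus_phase_unique by (metis theI)

section \<open>The restriction of the plus phase to the line\<close>

lemma borel_measurable_spin: "(\<lambda>X. X x) \<in> borel_measurable (configs UNIV)"
proof -
  have "(\<lambda>X. X x) \<in> measurable (configs UNIV) (count_space spins)"
    unfolding configs_def by (rule measurable_component_singleton) simp
  then show ?thesis by (rule measurable_compose) (simp add: measurable_count_space_eq1)
qed

lemma measurable_reindex:
  "(\<lambda>X i. X (f i)) \<in> measurable (configs UNIV) (configs UNIV)"
proof -
  have "(\<lambda>X. X (f i)) \<in> measurable (configs UNIV) (count_space spins)" for i
    unfolding configs_def by (rule measurable_component_singleton) simp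
  then show ?thesis unfolding configs_def[where S="UNIV :: 'b set"]
    by (rule measurable_PiM_single') (auto simp: space_configs spins_def PiE_UNIV_domain Pi_iff)
qed

lemma reindex_in_configs: "X \<in> space (configs UNIV) \<Longrightarrow> (\<lambda>i. X (f i)) \<in> space (configs UNIV)"
  by (simp add: in_configs_UNIV)

lemma vimage_cyl_reindex:
  assumes "inj f" "E \<subseteq> D"
  shows "(\<lambda>X i. X (f i)) -` cyl D E \<inter> space (configs UNIV) = cyl (f ` D) (f ` E)"
proof -
  have "minus_set (\<lambda>i. X (f i)) \<inter> D = E \<longleftrightarrow> minus_set X \<inter> f ` D = f ` E" for X
  proof -
    have "minus_set X \<inter> f ` D = f ` (minus_set (\<lambda>i. X (f i)) \<inter> D)" by auto
    then show ?thesis using inj_image_eq_iff[OF assms(1)] by metis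
  qed
  then show ?thesis unfolding cyl_def using reindex_in_configs by auto
qed

lemma plus_phase_props:
  assumes "\<beta> \<ge> 0"
  shows "prob_space (plus_phase \<beta>)" "sets (plus_phase \<beta>) = sets (configs UNIV)"
    "finite A \<Longrightarrow> E \<subseteq> A \<Longrightarrow> measure (plus_phase \<beta>) (cyl A E) = plus_prob \<beta> A E"
proof -
  note P = plus_phase[OF assms, unfolded is_plus_phase_iff]
  show "prob_space (plus_phase \<beta>)" "sets (plus_phase \<beta>) = sets (configs UNIV)" using P by auto
  assume A: "finite A" "E \<subseteq> A"
  show "measure (plus_phase \<beta>) (cyl A E) = plus_prob \<beta> A E"
  proof (rule tendsto_unique[of vol])
    show "((\<lambda>\<Lambda>. avg \<beta> {{}..\<Lambda>} (pattern A E)) \<longlongrightarrow> measure (plus_phase \<beta>) (cyl A E)) vol" using P A by blast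
  qed (use plus_prob[OF assms A] in simp_all)
qed

lemma inj_row: "inj (\<lambda>i::int. (i, 0::int))"
  by (auto simp: inj_def)

lemma nu_plus_props:
  assumes "\<beta> \<ge> 0"
  shows "prob_space (nu_plus \<beta>)" "sets (nu_plus \<beta>) = sets (configs UNIV)"
    "finite D \<Longrightarrow> E \<subseteq> D \<Longrightarrow> measure (nu_plus \<beta>) (cyl D E) = plus_prob \<beta> (row D) (row E)"
proof -
  note P = plus_phase_props[OF assms]
  have meas: "(\<lambda>X i. X (i, 0)) \<in> measurable (plus_phase \<beta>) (configs UNIV)"
    using measurable_reindex[of "\<lambda>i. (i, 0)"] P(2) by (simp cong: measurable_cong_sets)
  show "prob_space (nu_plus \<beta>)" unfolding nu_plus_def by (rule prob_space.prob_space_distr[OF P(1) meas])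
  show "sets (nu_plus \<beta>) = sets (configs UNIV)" by (simp add: nu_plus_def)
  assume D: "finite D" "E \<subseteq> D"
  have "space (plus_phase \<beta>) = space (configs UNIV)" using P(2) by (rule sets_eq_imp_space_eq)
  then have "measure (nu_plus \<beta>) (cyl D E) = measure (plus_phase \<beta>) ((\<lambda>X i. X (i, 0)) -` cyl D E \<inter> space (configs UNIV))"
    unfolding nu_plus_def using D by (subst measure_distr[OF meas]) auto
  also have "\<dots> = measure (plus_phase \<beta>) (cyl (row D) (row E))"
    unfolding row_def using vimage_cyl_reindex[OF inj_row D(2)] by simp
  also have "\<dots> = plus_prob \<beta> (row D) (row E)"
    using D by (intro P(3)) (auto simp: row_def)
  finally show "measure (nu_plus \<beta>) (cyl D E) = plus_prob \<beta> (row D) (row E)" .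
qed

subsection \<open>Translation invariance\<close>

lemma cut_image:
  assumes "bij \<tau>" "\<And>x y. neighbours (\<tau> x) (\<tau> y) \<longleftrightarrow> neighbours x y"
  shows "cut (\<tau> ` M) = (\<lambda>e. \<tau> ` e) ` cut M"
proof (intro set_eqI iffI)
  fix e assume "e \<in> cut (\<tau> ` M)"
  then obtain x y where e: "e = {x, y}" "neighbours x y" "x \<in> \<tau> ` M" "y \<notin> \<tau> ` M" by (rule cutE)
  obtain y' where y': "y = \<tau> y'" using assms(1) by (metis bij_pointE)
  obtain x' where x': "x = \<tau> x'" "x' \<in> M" using e(3) by auto
  have "y' \<notin> M" using e(4) y' by auto
  then have "{x', y'} \<in> cut M" using e(2) x' y' assms(2) unfolding cut_def by blast
  moreover have "e = \<tau> ` {x', y'}" using e(1) x' y' by simp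
  ultimately show "e \<in> (\<lambda>e. \<tau> ` e) ` cut M" by blast
next
  fix e assume "e \<in> (\<lambda>e. \<tau> ` e) ` cut M"
  then obtain x y where e: "e = {\<tau> x, \<tau> y}" "neighbours x y" "x \<in> M" "y \<notin> M" by (auto elim!: cutE)
  moreover have "\<tau> y \<notin> \<tau> ` M" using e(4) assms(1) by (simp add: bij_is_inj inj_image_mem_iff)
  ultimately show "e \<in> cut (\<tau> ` M)" using assms(2) unfolding cut_def by blast
qed

lemma bw_image:
  assumes "bij \<tau>" "\<And>x y. neighbours (\<tau> x) (\<tau> y) \<longleftrightarrow> neighbours x y"
  shows "bw \<beta> (\<tau> ` M) = bw \<beta> M"
proof -
  have "inj_on (\<lambda>e. \<tau> ` e) (cut M)" using assms(1) by (intro inj_onI) (simp add: bij_is_inj inj_image_eq_iff)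
  then show ?thesis unfolding bw_def cut_image[OF assms] by (simp add: card_image)
qed

lemma avg_image:
  assumes \<tau>: "bij \<tau>" "\<And>x y. neighbours (\<tau> x) (\<tau> y) \<longleftrightarrow> neighbours x y"
  shows "avg \<beta> {{}..\<tau> ` \<Lambda>} (pattern (\<tau> ` A) (\<tau> ` E)) = avg \<beta> {{}..\<Lambda>} (pattern A E)"
proof -
  have im: "{{}..\<tau> ` \<Lambda>} = (\<lambda>M. \<tau> ` M) ` {{}..\<Lambda>}"
    unfolding Pow_eq_interval[symmetric] by (simp add: image_Pow_surj)
  have inj: "inj_on (\<lambda>M. \<tau> ` M) {{}..\<Lambda>}" using \<tau>(1) by (intro inj_onI) (simp add: bij_is_inj inj_image_eq_iff)
  have "pattern (\<tau> ` A) (\<tau> ` E) (\<tau> ` M) = pattern A E M" for M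
    unfolding pattern_def using \<tau>(1) by (simp add: image_Int[symmetric] bij_is_inj inj_image_eq_iff)
  then show ?thesis unfolding avg_def part_def im
    by (simp add: sum.reindex[OF inj] bw_image[OF \<tau>])
qed

lemma filterlim_image_vol: "filterlim (\<lambda>\<Lambda>. \<tau> ` \<Lambda>) vol vol" if "bij \<tau>"
  unfolding filterlim_iff
proof (intro allI impI)
  fix P assume "eventually P vol"
  then obtain X where X: "finite X" "\<And>Y. finite Y \<Longrightarrow> X \<subseteq> Y \<Longrightarrow> P Y"
    by (auto simp: eventually_finite_subsets_at_top)
  show "eventually (\<lambda>\<Lambda>. P (\<tau> ` \<Lambda>)) vol"
    unfolding eventually_finite_subsets_at_top
  proof (intro exI conjI allI impI)
    show "finite (inv \<tau> ` X)" using X by simp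
    fix Y assume Y: "finite Y \<and> inv \<tau> ` X \<subseteq> Y \<and> Y \<subseteq> UNIV"
    then have "\<tau> ` inv \<tau> ` X \<subseteq> \<tau> ` Y" by blast
    moreover have "\<tau> ` inv \<tau> ` X = X" using that by (simp add: bij_is_surj image_f_inv_f)
    ultimately show "P (\<tau> ` Y)" using X Y by auto
  qed simp
qed

lemma plus_prob_image:
  assumes \<beta>: "\<beta> \<ge> 0" and \<tau>: "bij \<tau>" "\<And>x y. neighbours (\<tau> x) (\<tau> y) \<longleftrightarrow> neighbours x y"
    and A: "finite A" "E \<subseteq> A"
  shows "plus_prob \<beta> (\<tau> ` A) (\<tau> ` E) = plus_prob \<beta> A E"
proof (rule tendsto_unique[of vol])
  show "((\<lambda>\<Lambda>. avg \<beta> {{}..\<Lambda>} (pattern A E)) \<longlongrightarrow> plus_prob \<beta> A E) vol" by (rule plus_prob[OF \<beta> A])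
  have "((\<lambda>\<Lambda>. avg \<beta> {{}..\<tau> ` \<Lambda>} (pattern (\<tau> ` A) (\<tau> ` E))) \<longlongrightarrow> plus_prob \<beta> (\<tau> ` A) (\<tau> ` E)) vol"
    using A by (intro filterlim_compose[OF plus_prob[OF \<beta>] filterlim_image_vol[OF \<tau>(1)]]) auto
  then show "((\<lambda>\<Lambda>. avg \<beta> {{}..\<Lambda>} (pattern A E)) \<longlongrightarrow> plus_prob \<beta> (\<tau> ` A) (\<tau> ` E)) vol"
    unfolding avg_image[OF \<tau>] .
qed simp

lemma nu_plus_shift:
  assumes \<beta>: "\<beta> \<ge> 0" and D: "finite D" "E \<subseteq> D"
  shows "measure (nu_plus \<beta>) (cyl ((+) k ` D) ((+) k ` E)) = measure (nu_plus \<beta>) (cyl D E)"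
proof -
  define \<tau> :: "int \<times> int \<Rightarrow> int \<times> int" where "\<tau> = (\<lambda>p. (k + fst p, snd p))"
  have "bij \<tau>" unfolding \<tau>_def
    by (rule bij_betw_byWitness[where f'="\<lambda>p. (fst p - k, snd p)"]) auto
  moreover have "neighbours (\<tau> x) (\<tau> y) \<longleftrightarrow> neighbours x y" for x y
    by (simp add: \<tau>_def neighbours_def)
  moreover have "row ((+) k ` I) = \<tau> ` row I" for I by (force simp: row_def \<tau>_def)
  ultimately show ?thesis
    using D nu_plus_props(3)[OF \<beta>] plus_prob_image[OF \<beta>, of \<tau> "row D" "row E"]
    by (simp add: image_mono) (simp add: row_def image_mono)
qed

lemma translation_invariant_cyl:
  assumes \<mu>: "sets \<mu> = sets (configs UNIV)" "translation_invariant \<mu>" and D: "finite D" "E \<subseteq> D"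
  shows "measure \<mu> (cyl ((+) k ` D) ((+) k ` E)) = measure \<mu> (cyl D E)"
proof -
  have sp: "space \<mu> = space (configs UNIV)" using \<mu>(1) by (rule sets_eq_imp_space_eq)
  have f: "(\<lambda>i. i + k) = (+) k" by (auto simp: add.commute)
  have meas: "(\<lambda>\<sigma> i. \<sigma> (i + k)) \<in> measurable \<mu> (configs UNIV)"
    using measurable_reindex[of "\<lambda>i. i + k"] \<mu>(1) by (simp cong: measurable_cong_sets)
  have "measure \<mu> (cyl D E) = measure (distr \<mu> (configs UNIV) (\<lambda>\<sigma> i. \<sigma> (i + k))) (cyl D E)"
    using \<mu>(2) by (simp add: translation_invariant_def)
  also have "\<dots> = measure \<mu> ((\<lambda>\<sigma> i. \<sigma> (i + k)) -` cyl D E \<inter> space (configs UNIV))"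
    using D by (subst measure_distr[OF meas]) (auto simp: sp)
  also have "\<dots> = measure \<mu> (cyl ((+) k ` D) ((+) k ` E))"
    using vimage_cyl_reindex[of "\<lambda>i. i + k", OF _ D(2)] unfolding f by (simp add: inj_def)
  finally show ?thesis by simp
qed

subsection \<open>Positivity and conditional probabilities\<close>

lemma bw_change:
  fixes \<beta> :: real
  assumes \<beta>: "\<beta> \<ge> 0" and "finite M" "finite A" "E \<subseteq> A"
  shows "bw \<beta> M \<le> exp (16 * \<beta> * card A) * bw \<beta> ((M - A) \<union> E)"
proof -
  have E: "finite E" "card E \<le> card A" using assms finite_subset card_mono by auto
  have "card (cut ((M - A) \<union> E)) \<le> card (cut (M - A)) + 4 * card E"
    using assms E by (intro card_cut_add) auto
  also have "card (cut (M - A)) \<le> card (cut ((M - A) \<union> (M \<inter> A))) + 4 * card (M \<inter> A)"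
    using assms by (intro card_cut_remove) auto
  also have "(M - A) \<union> (M \<inter> A) = M" by auto
  also have "card (M \<inter> A) \<le> card A" using assms by (intro card_mono) auto
  finally have "card (cut ((M - A) \<union> E)) \<le> card (cut M) + 8 * card A" using E by linarith
  then have "2 * \<beta> * real (card (cut ((M - A) \<union> E))) \<le> 2 * \<beta> * (real (card (cut M)) + 8 * real (card A))"
    using \<beta> by (intro mult_left_mono) linarith+
  then show ?thesis unfolding bw_def exp_add[symmetric] by (simp add: algebra_simps)
qed

text \<open>Finite energy: replacing the spins in \<open>A\<close> by \<open>E\<close> changes the weight by a bounded factor, uniformly
  in the volume, so all \<open>2\<^bsup>|A|\<^esup>\<close> patterns on \<open>A\<close> have comparable probabilities.\<close>

lemma avg_pattern_lower:
  fixes \<beta> :: real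
  assumes \<beta>: "\<beta> \<ge> 0" and L: "finite \<Lambda>" and A: "A \<subseteq> \<Lambda>" "E \<subseteq> A"
  shows "exp (- 16 * \<beta> * card A) / 2 ^ card A \<le> avg \<beta> {{}..\<Lambda>} (pattern A E)"
proof -
  have fA: "finite A" using A L finite_subset by auto
  define c where "c = exp (16 * \<beta> * card A)"
  have c: "c > 0" by (simp add: c_def)
  have fin: "finite {{}..\<Lambda>}" using L by simp
  have le: "avg \<beta> {{}..\<Lambda>} (pattern A E') \<le> c * avg \<beta> {{}..\<Lambda>} (pattern A E)" if "E' \<subseteq> A" for E'
  proof -
    have "(\<Sum>M\<in>{{}..\<Lambda>}. bw \<beta> M * pattern A E' M) = (\<Sum>M\<in>{M\<in>{{}..\<Lambda>}. M \<inter> A = E'}. bw \<beta> M)"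
      using fin by (intro sum.mono_neutral_cong_right) (auto simp: pattern_def)
    also have "\<dots> \<le> (\<Sum>M\<in>{M\<in>{{}..\<Lambda>}. M \<inter> A = E'}. c * bw \<beta> ((M - A) \<union> E))"
      unfolding c_def using \<beta> fA A L finite_subset by (intro sum_mono bw_change) auto
    also have "\<dots> = c * (\<Sum>M\<in>{M\<in>{{}..\<Lambda>}. M \<inter> A = E'}. bw \<beta> ((M - A) \<union> E))" by (simp add: sum_distrib_left)
    also have "(\<Sum>M\<in>{M\<in>{{}..\<Lambda>}. M \<inter> A = E'}. bw \<beta> ((M - A) \<union> E)) = (\<Sum>M\<in>{M\<in>{{}..\<Lambda>}. M \<inter> A = E}. bw \<beta> M)"
      by (rule sum.reindex_bij_witness[of _ "\<lambda>M. (M - A) \<union> E'" "\<lambda>M. (M - A) \<union> E"]) (use that A in auto)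
    also have "(\<Sum>M\<in>{M\<in>{{}..\<Lambda>}. M \<inter> A = E}. bw \<beta> M) = (\<Sum>M\<in>{{}..\<Lambda>}. bw \<beta> M * pattern A E M)"
      using fin by (intro sum.mono_neutral_cong_left) (auto simp: pattern_def)
    finally show ?thesis unfolding avg_def by (simp add: divide_right_mono)
  qed
  have "1 = avg \<beta> {{}..\<Lambda>} (\<lambda>M. \<Sum>E'\<in>Pow A. pattern A E' M)"
  proof -
    have "(\<Sum>E'\<in>Pow A. pattern A E' M) = 1" for M
    proof -
      have "(\<Sum>E'\<in>Pow A. pattern A E' M) = (\<Sum>E'\<in>Pow A. if E' = M \<inter> A then 1 else 0)"
        by (intro sum.cong) (auto simp: pattern_def)
      also have "\<dots> = 1" using fA by (simp add: sum.delta')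
      finally show ?thesis .
    qed
    then show ?thesis using L by (simp add: avg_one part_pos)
  qed
  also have "\<dots> = (\<Sum>E'\<in>Pow A. avg \<beta> {{}..\<Lambda>} (pattern A E'))" by (rule avg_sum)
  also have "\<dots> \<le> (\<Sum>E'\<in>Pow A. c * avg \<beta> {{}..\<Lambda>} (pattern A E))" using le by (intro sum_mono) auto
  also have "\<dots> = 2 ^ card A * (c * avg \<beta> {{}..\<Lambda>} (pattern A E))" using fA by (simp add: card_Pow)
  finally have "1 / (2 ^ card A * c) \<le> avg \<beta> {{}..\<Lambda>} (pattern A E)" using c by (simp add: field_simps)
  then show ?thesis unfolding c_def by (simp add: exp_minus field_simps)
qed

lemma plus_prob_pos:
  assumes \<beta>: "\<beta> \<ge> 0" and A: "finite A" "E \<subseteq> A"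
  shows "plus_prob \<beta> A E > 0"
proof -
  have "eventually (\<lambda>\<Lambda>. exp (- 16 * \<beta> * card A) / 2 ^ card A \<le> avg \<beta> {{}..\<Lambda>} (pattern A E)) vol"
    unfolding eventually_finite_subsets_at_top using avg_pattern_lower[OF \<beta> _ _ A(2)] A(1) by blast
  then have "exp (- 16 * \<beta> * card A) / 2 ^ card A \<le> plus_prob \<beta> A E"
    by (intro tendsto_lowerbound[OF plus_prob[OF assms]]) auto
  moreover have "exp (- 16 * \<beta> * card A) / 2 ^ card A > 0" by simp
  ultimately show ?thesis by linarith
qed

lemma filterlim_box: "filterlim box vol sequentially"
  unfolding filterlim_iff
proof (intro allI impI)
  fix P assume "eventually P vol"
  then obtain X where X: "finite X" "\<And>Y. finite Y \<Longrightarrow> X \<subseteq> Y \<Longrightarrow> P Y"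
    by (auto simp: eventually_finite_subsets_at_top)
  have "finite ((\<lambda>z. nat \<bar>fst z\<bar> + nat \<bar>snd z\<bar>) ` X)" using X by simp
  then obtain m where m: "\<forall>k\<in>(\<lambda>z. nat \<bar>fst z\<bar> + nat \<bar>snd z\<bar>) ` X. k \<le> m"
    using finite_nat_set_iff_bounded_le by blast
  have "X \<subseteq> box n" if "m \<le> n" for n
  proof
    fix z assume "z \<in> X"
    then have "nat \<bar>fst z\<bar> + nat \<bar>snd z\<bar> \<le> m" using m by blast
    then show "z \<in> box n" using that by (cases z) auto
  qed
  then show "eventually (\<lambda>n. P (box n)) sequentially"
    using X(2) by (auto simp: eventually_sequentially intro!: exI[of _ m])
qed

lemma row_Un: "row (A \<union> B) = row A \<union> row B"
  by (auto simp: row_def)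

text \<open>In the box this is the product rule for conditional probabilities.\<close>

lemma nu_plus_condition:
  assumes \<beta>: "\<beta> \<ge> 0" and V: "V \<subseteq> {- int a..int b}" and E: "E \<subseteq> {- int a..int b}"
  shows "measure (nu_plus \<beta>) (cyl {- int a..int b} E)
     = measure (nu_plus \<beta>) (cyl (window V a b) (E \<inter> window V a b))
       * limit_box \<beta> V E a b (pattern (row V) (row (E \<inter> V)))"
proof -
  define W where "W = window V a b"
  have fin: "finite V" "finite E" "finite W" using V E finite_subset by (auto simp: W_def)
  have D: "{- int a..int b} = W \<union> V" "E = (E \<inter> W) \<union> (E \<inter> V)" using V E by (auto simp: W_def window_def)
  have VW: "V \<inter> W = {}" by (auto simp: W_def window_def)
  define f where "f N = avg \<beta> {{}..box N} (pattern (row {- int a..int b}) (row E))" for N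
  define g where "g N = avg \<beta> {{}..box N} (pattern (row W) (row (E \<inter> W)))" for N
  define h where "h N = avg \<beta> (given V E a b N) (pattern (row V) (row (E \<inter> V)))" for N
  have "f \<longlonglongrightarrow> measure (nu_plus \<beta>) (cyl {- int a..int b} E)"
    unfolding f_def nu_plus_props(3)[OF \<beta> finite_atLeastAtMost_int E]
    using E fin by (intro filterlim_compose[OF plus_prob[OF \<beta>] filterlim_box]) (auto simp: row_def)
  moreover have "g \<longlonglongrightarrow> measure (nu_plus \<beta>) (cyl W (E \<inter> W))"
    unfolding g_def nu_plus_props(3)[OF \<beta> fin(3) Int_lower2]
    using fin by (intro filterlim_compose[OF plus_prob[OF \<beta>] filterlim_box]) (auto simp: row_def)
  moreover have "h \<longlonglongrightarrow> limit_box \<beta> V E a b (pattern (row V) (row (E \<inter> V)))"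
    unfolding h_def limit_box_def using fin \<beta>
    by (intro convergent_LIMSEQ_iff[THEN iffD1] convergent_pattern) (auto simp: row_def)
  moreover have "f N = g N * h N" if "max a b \<le> N" for N
  proof -
    have "avg \<beta> {{}..box N} (pattern (row W \<union> row V) (row (E \<inter> W) \<union> row (E \<inter> V)))
      = avg \<beta> {{}..box N} (pattern (row W) (row (E \<inter> W)))
        * avg \<beta> {row (E \<inter> W)..(box N - row W) \<union> row (E \<inter> W)} (pattern (row V) (row (E \<inter> V)))"
      by (rule avg_condition) (use that VW in \<open>auto simp: W_def window_def\<close>)
    then show ?thesis unfolding f_def g_def h_def given_def W_def[symmetric] D(1) row_Un[symmetric] D(2)[symmetric] .
  qed
  ultimately show ?thesis unfolding W_def[symmetric]
    by (intro LIMSEQ_unique[of f])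
       (auto intro!: Lim_transform_eventually[of "\<lambda>N. g N * h N"] tendsto_mult exI[of _ "max a b"] simp: eventually_sequentially)
qed

text \<open>As soon as the box contains \<open>V\<close>, conditioning on the spins off \<open>V\<close> leaves exactly the
  configurations of \<open>given\<close>.\<close>

lemma gamma_eq_limit_window:
  assumes \<beta>: "\<beta> \<ge> 0" and V: "finite V" and \<sigma>: "\<sigma> \<in> space (configs V)" and \<omega>: "\<omega> \<in> space (configs UNIV)"
  defines "u \<equiv> (\<lambda>n. \<P>(X in ising_plus_finite (box n) \<beta>.
        (\<forall>i\<in>V. X (i, 0) = \<sigma> i) \<bar> (\<forall>i\<in>{- int n..int n} - V. X (i, 0) = \<omega> i)))"
  shows "u \<longlonglongrightarrow> limit_window \<beta> V (minus_set \<omega>) (pattern (row V) (row (minus_set \<sigma> \<inter> V)))"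
    and "gamma \<beta> V \<sigma> \<omega> = limit_window \<beta> V (minus_set \<omega>) (pattern (row V) (row (minus_set \<sigma> \<inter> V)))"
proof -
  define E where "E = minus_set \<sigma> \<inter> V"
  define P where "P = minus_set \<omega>"
  define v where "v n = avg \<beta> (given V P n n n) (pattern (row V) (row E))" for n
  have v: "v \<longlonglongrightarrow> limit_window \<beta> V P (pattern (row V) (row E))"
    unfolding v_def limit_window_def using V \<beta>
    by (intro convergent_LIMSEQ_iff[THEN iffD1] convergent_pattern) (auto simp: E_def)
  obtain r where r: "V \<subseteq> {- int r..int r}" by (rule finite_int_subset_interval[OF V])
  have uv: "u n = v n" if n: "r \<le> n" for n
  proof -
    define W where "W = window V n n"
    have Vn: "V \<subseteq> {- int n..int n}" using r n by fastforce
    have pat: "(\<forall>i\<in>I. spin_on (box n) M (i, 0) = (if i \<in> F then - 1 else 1)) \<longleftrightarrow> M \<inter> row I = row F"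
      if "I \<subseteq> {- int n..int n}" "F \<subseteq> I" for I F M
    proof -
      have "spin_on (box n) M (i, 0) = (if i \<in> F then - 1 else 1) \<longleftrightarrow> ((i, 0) \<in> M \<longleftrightarrow> i \<in> F)" if "i \<in> I" for i
      proof -
        have "(i, 0) \<in> box n" using subsetD[OF \<open>I \<subseteq> _\<close> that] by (simp add: abs_le_iff)
        then show ?thesis by (simp add: spin_on_def)
      qed
      then have "(\<forall>i\<in>I. spin_on (box n) M (i, 0) = (if i \<in> F then - 1 else 1)) \<longleftrightarrow> (\<forall>i\<in>I. (i, 0) \<in> M \<longleftrightarrow> i \<in> F)" by blast
      also have "\<dots> \<longleftrightarrow> M \<inter> row I = row F" using \<open>F \<subseteq> I\<close> by (auto simp: row_def)
      finally show ?thesis .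
    qed
    have \<sigma>': "\<sigma> i = (if i \<in> E then - 1 else 1)" if "i \<in> V" for i
      using \<sigma> that unfolding E_def by (auto simp: space_configs PiE_iff)
    have \<omega>': "\<omega> i = (if i \<in> P \<inter> W then - 1 else 1)" if "i \<in> W" for i
      using \<omega> that unfolding P_def in_configs_UNIV by auto
    have 1: "(\<forall>i\<in>V. spin_on (box n) M (i, 0) = \<sigma> i) \<longleftrightarrow> M \<inter> row V = row E" for M
      using pat[OF Vn, of E M] \<sigma>' by (simp add: E_def)
    have 2: "(\<forall>i\<in>{- int n..int n} - V. spin_on (box n) M (i, 0) = \<omega> i) \<longleftrightarrow> M \<inter> row W = row (P \<inter> W)" for M
      using pat[of W "P \<inter> W" M] \<omega>' by (simp add: W_def window_def)
    have 3: "M \<inter> row V = row E \<and> M \<inter> row W = row (P \<inter> W) \<longleftrightarrow> M \<inter> (row W \<union> row V) = row (P \<inter> W) \<union> row E" for M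
    proof -
      have "row V \<inter> row W = {}" "row E \<subseteq> row V" "row (P \<inter> W) \<subseteq> row W" by (auto simp: W_def window_def E_def)
      then show ?thesis by blast
    qed
    have "u n = avg \<beta> {{}..box n} (pattern (row W \<union> row V) (row (P \<inter> W) \<union> row E)) / avg \<beta> {{}..box n} (pattern (row W) (row (P \<inter> W)))"
      unfolding u_def cond_prob_def prob_ising[OF finite_box] 1 2 3 pattern_def[abs_def] ..
    also have "avg \<beta> {{}..box n} (pattern (row W \<union> row V) (row (P \<inter> W) \<union> row E))
      = avg \<beta> {{}..box n} (pattern (row W) (row (P \<inter> W))) * avg \<beta> {row (P \<inter> W)..(box n - row W) \<union> row (P \<inter> W)} (pattern (row V) (row E))"
      by (rule avg_condition) (auto simp: W_def window_def E_def)
    moreover have "avg \<beta> {{}..box n} (pattern (row W) (row (P \<inter> W))) > 0"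
      by (rule avg_pattern_pos) (auto simp: row_def W_def window_def)
    ultimately show ?thesis unfolding v_def given_def W_def[symmetric] by simp
  qed
  then have "u \<longlonglongrightarrow> limit_window \<beta> V P (pattern (row V) (row E))"
    by (intro Lim_transform_eventually[OF v]) (auto simp: eventually_sequentially intro!: exI[of _ r])
  then show "u \<longlonglongrightarrow> limit_window \<beta> V (minus_set \<omega>) (pattern (row V) (row (minus_set \<sigma> \<inter> V)))"
    by (simp add: P_def E_def)
  then show "gamma \<beta> V \<sigma> \<omega> = limit_window \<beta> V (minus_set \<omega>) (pattern (row V) (row (minus_set \<sigma> \<inter> V)))"
    unfolding gamma_def u_def by (rule limI)
qed

section \<open>Relative entropy\<close>

lemma kl_pointwise:
  fixes p r :: real
  assumes "p \<ge> 0" "r \<ge> 0" "r = 0 \<Longrightarrow> p = 0"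
  shows "p - r + (sqrt p - sqrt r)\<^sup>2 \<le> p * ln (p / r)"
proof (cases "p = 0")
  case True then show ?thesis using assms by simp
next
  case False
  then have p: "p > 0" and r: "r > 0" using assms by (auto simp: order_le_less)
  have "ln (p / r) = - 2 * ln (sqrt r / sqrt p)"
    using p r by (simp add: ln_div ln_sqrt)
  moreover have "ln (sqrt r / sqrt p) \<le> sqrt r / sqrt p - 1" using p r by (intro ln_le_minus_one) simp
  ultimately have "ln (p / r) \<ge> 2 - 2 * (sqrt r / sqrt p)" by linarith
  then have "p * ln (p / r) \<ge> p * (2 - 2 * (sqrt r / sqrt p))" using p by (intro mult_left_mono) auto
  also have "p * (2 - 2 * (sqrt r / sqrt p)) = 2 * p - 2 * (sqrt p * sqrt r)"
  proof -
    have "p * (sqrt r / sqrt p) = (sqrt p * sqrt p) * (sqrt r / sqrt p)" using p by simp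
    also have "\<dots> = sqrt p * sqrt r" using p by (simp add: field_simps del: real_sqrt_mult_self)
    finally have "p * (sqrt r / sqrt p) = sqrt p * sqrt r" .
    moreover have "p * (2 - 2 * (sqrt r / sqrt p)) = 2 * p - 2 * (p * (sqrt r / sqrt p))"
      by (simp only: right_diff_distrib mult.left_commute mult.commute[of p 2])
    ultimately show ?thesis by simp
  qed
  also have "\<dots> = p - r + (sqrt p - sqrt r)\<^sup>2"
    using p r by (simp add: power2_diff)
  finally show ?thesis .
qed

text \<open>Closeness in relative entropy implies closeness in total variation, by way of the Hellinger
  distance and the Cauchy-Schwarz inequality.\<close>

lemma total_variation_le_entropy:
  fixes p r :: "'a \<Rightarrow> real"
  assumes "finite I" and p: "\<And>i. i \<in> I \<Longrightarrow> p i \<ge> 0" and r: "\<And>i. i \<in> I \<Longrightarrow> r i \<ge> 0"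
    and ac: "\<And>i. i \<in> I \<Longrightarrow> r i = 0 \<Longrightarrow> p i = 0" and sums: "sum p I = 1" "sum r I = 1"
  shows "(\<Sum>i\<in>I. \<bar>p i - r i\<bar>)\<^sup>2 \<le> 4 * (\<Sum>i\<in>I. p i * ln (p i / r i))"
proof -
  define u where "u i = sqrt (p i) - sqrt (r i)" for i
  define v where "v i = sqrt (p i) + sqrt (r i)" for i
  have uv: "\<bar>p i - r i\<bar> = \<bar>u i\<bar> * v i" if "i \<in> I" for i
  proof -
    have "p i - r i = u i * v i" using p[OF that] r[OF that] by (simp add: u_def v_def algebra_simps)
    moreover have "v i \<ge> 0" using p[OF that] r[OF that] by (simp add: v_def)
    ultimately show ?thesis by (simp add: abs_mult)
  qed
  have "(\<Sum>i\<in>I. \<bar>p i - r i\<bar>)\<^sup>2 = (\<Sum>i\<in>I. \<bar>u i\<bar> * v i)\<^sup>2" using uv by (intro arg_cong2[where f=power] sum.cong) auto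
  also have "\<dots> \<le> (\<Sum>i\<in>I. \<bar>u i\<bar>\<^sup>2) * (\<Sum>i\<in>I. (v i)\<^sup>2)" by (rule Cauchy_Schwarz_ineq_sum)
  also have "\<dots> \<le> (\<Sum>i\<in>I. \<bar>u i\<bar>\<^sup>2) * 4"
  proof (rule mult_left_mono)
    have "(\<Sum>i\<in>I. (v i)\<^sup>2) \<le> (\<Sum>i\<in>I. 2 * p i + 2 * r i)"
    proof (intro sum_mono)
      fix i assume i: "i \<in> I"
      have "(v i)\<^sup>2 + (u i)\<^sup>2 = 2 * p i + 2 * r i"
        unfolding u_def v_def using p[OF i] r[OF i] by (simp add: power2_sum power2_diff)
      then show "(v i)\<^sup>2 \<le> 2 * p i + 2 * r i" using zero_le_power2[of "u i"] by linarith
    qed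
    also have "\<dots> = 4" using sums by (simp add: sum.distrib sum_distrib_left[symmetric])
    finally show "(\<Sum>i\<in>I. (v i)\<^sup>2) \<le> 4" .
  qed (intro sum_nonneg, simp)
  also have "(\<Sum>i\<in>I. \<bar>u i\<bar>\<^sup>2) = (\<Sum>i\<in>I. p i - r i + (u i)\<^sup>2)" using sums by (simp add: sum.distrib sum_subtractf)
  also have "\<dots> \<le> (\<Sum>i\<in>I. p i * ln (p i / r i))"
    unfolding u_def using p r ac by (intro sum_mono kl_pointwise) auto
  finally show ?thesis by simp
qed

definition entropy :: "('s \<Rightarrow> real) measure \<Rightarrow> ('s \<Rightarrow> real) measure \<Rightarrow> 's set \<Rightarrow> real" where
  "entropy \<mu> \<nu> D = (\<Sum>E\<in>Pow D. measure \<mu> (cyl D E) * ln (measure \<mu> (cyl D E) / measure \<nu> (cyl D E)))"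

lemma cyl_consistent:
  assumes "finite_measure \<mu>" "sets \<mu> = sets (configs UNIV)" "finite D'" "D \<subseteq> D'"
  shows "(\<Sum>E'\<in>{E'. E' \<subseteq> D' \<and> E' \<inter> D = E}. measure \<mu> (cyl D' E')) = measure \<mu> (cyl D E)"
proof -
  have "cyl D E = {X \<in> space (configs UNIV). (minus_set X \<inter> D') \<inter> D = E}"
    unfolding cyl_def using assms(4) by (simp add: Int_assoc Int_absorb1)
  then show ?thesis using measure_minus_event(2)[OF assms(1-3), of "\<lambda>E'. E' \<inter> D = E"] by simp
qed

lemma sum_Pow_group:
  fixes f g :: "'a set \<Rightarrow> real"
  assumes "finite D'" "D \<subseteq> D'"
  shows "(\<Sum>E'\<in>Pow D'. f (E' \<inter> D) * g E') = (\<Sum>E\<in>Pow D. f E * (\<Sum>E'\<in>{E'. E' \<subseteq> D' \<and> E' \<inter> D = E}. g E'))"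
proof -
  have fD: "finite D" using assms finite_subset by auto
  have "(\<Sum>E\<in>Pow D. \<Sum>E'\<in>{E'\<in>Pow D'. E' \<inter> D = E}. f (E' \<inter> D) * g E') = (\<Sum>E'\<in>Pow D'. f (E' \<inter> D) * g E')"
    using assms fD by (intro sum.group) auto
  moreover have "(\<Sum>E'\<in>{E'\<in>Pow D'. E' \<inter> D = E}. f (E' \<inter> D) * g E') = f E * (\<Sum>E'\<in>{E'. E' \<subseteq> D' \<and> E' \<inter> D = E}. g E')" for E
    unfolding sum_distrib_left by (intro sum.cong) auto
  ultimately show ?thesis by simp
qed

locale entropy_pair = M: prob_space \<mu> + N: prob_space \<nu>
  for \<mu> \<nu> :: "('s \<Rightarrow> real) measure" +
  assumes sets_M: "sets \<mu> = sets (configs UNIV)" and sets_N: "sets \<nu> = sets (configs UNIV)"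
    and pos: "\<And>D E. finite D \<Longrightarrow> E \<subseteq> D \<Longrightarrow> measure \<nu> (cyl D E) > 0"
begin

text \<open>The entropy increment from \<open>D\<close> to \<open>D'\<close> is the relative entropy of \<open>\<mu>\<close> with respect to the
  measure that has the marginal of \<open>\<mu>\<close> on \<open>D\<close> and the conditional probabilities of \<open>\<nu>\<close>.\<close>

lemma entropy_increment:
  assumes D: "finite D'" "D \<subseteq> D'"
  shows "(\<Sum>E\<in>Pow D'. \<bar>measure \<mu> (cyl D' E) - measure \<mu> (cyl D (E \<inter> D)) * (measure \<nu> (cyl D' E) / measure \<nu> (cyl D (E \<inter> D)))\<bar>)\<^sup>2
    \<le> 4 * (entropy \<mu> \<nu> D' - entropy \<mu> \<nu> D)"
proof -
  have fD: "finite D" using D finite_subset by auto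
  note consM = cyl_consistent[OF M.finite_measure_axioms sets_M D]
  note consN = cyl_consistent[OF N.finite_measure_axioms sets_N D]
  define m where "m E = measure \<mu> (cyl D' E)" for E
  define r where "r E = measure \<mu> (cyl D (E \<inter> D)) * (measure \<nu> (cyl D' E) / measure \<nu> (cyl D (E \<inter> D)))" for E
  have total: "(\<Sum>E\<in>Pow A. measure \<mu> (cyl A E)) = 1" if "finite A" for A
  proof -
    have "(\<Sum>E\<in>Pow A. measure \<mu> (cyl A E)) = measure \<mu> (cyl {} {})"
      using cyl_consistent[OF M.finite_measure_axioms sets_M that, of "{}" "{}"] by (simp add: Pow_def)
    also have "\<dots> = 1" using M.prob_space sets_eq_imp_space_eq[OF sets_M] by (simp add: cyl_def)
    finally show ?thesis .
  qed
  have m_le: "m E \<le> measure \<mu> (cyl D (E \<inter> D))" if "E \<subseteq> D'" for E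
    unfolding m_def by (rule M.finite_measure_mono) (use D fD sets_M in \<open>auto simp: cyl_def[of D'] cyl_def[of D] intro: sets_cyl[unfolded cyl_def]\<close>)
  have ac: "m E = 0" if "E \<subseteq> D'" "r E = 0" for E
  proof -
    have "measure \<nu> (cyl D' E) / measure \<nu> (cyl D (E \<inter> D)) > 0" using pos[of D' E] pos[of D "E \<inter> D"] D fD that by simp
    then have "measure \<mu> (cyl D (E \<inter> D)) = 0" using that(2) unfolding r_def by auto
    then show ?thesis using m_le[OF that(1)] measure_nonneg[of \<mu> "cyl D' E"] unfolding m_def by linarith
  qed
  have sum_r: "sum r (Pow D') = 1"
  proof -
    have "sum r (Pow D') = (\<Sum>E'\<in>Pow D'. (\<lambda>E. measure \<mu> (cyl D E) / measure \<nu> (cyl D E)) (E' \<inter> D) * measure \<nu> (cyl D' E'))"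
      unfolding r_def by simp
    also have "\<dots> = (\<Sum>E\<in>Pow D. measure \<mu> (cyl D E) / measure \<nu> (cyl D E) * measure \<nu> (cyl D E))"
      using sum_Pow_group[OF D, of "\<lambda>E. measure \<mu> (cyl D E) / measure \<nu> (cyl D E)" "\<lambda>E'. measure \<nu> (cyl D' E')"]
      unfolding consN .
    also have "\<dots> = (\<Sum>E\<in>Pow D. measure \<mu> (cyl D E))"
      using pos[OF fD] by (intro sum.cong refl) (auto simp: less_imp_neq[symmetric])
    finally show ?thesis using total[OF fD] by simp
  qed
  have ent: "(\<Sum>E\<in>Pow D'. m E * ln (m E / r E)) = entropy \<mu> \<nu> D' - entropy \<mu> \<nu> D"
  proof -
    define k where "k E = ln (measure \<mu> (cyl D E) / measure \<nu> (cyl D E))" for E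
    have "m E * ln (m E / r E) = m E * ln (m E / measure \<nu> (cyl D' E)) - k (E \<inter> D) * m E" if "E \<in> Pow D'" for E
    proof (cases "m E = 0")
      case False
      then have "m E > 0" unfolding m_def by (simp add: zero_less_measure_iff)
      moreover have "measure \<mu> (cyl D (E \<inter> D)) > 0" using m_le[of E] that calculation by auto
      moreover have "measure \<nu> (cyl D' E) > 0" "measure \<nu> (cyl D (E \<inter> D)) > 0" using pos D fD that by auto
      ultimately show ?thesis unfolding r_def k_def by (simp add: ln_div ln_mult algebra_simps)
    qed simp
    then have "(\<Sum>E\<in>Pow D'. m E * ln (m E / r E)) = (\<Sum>E\<in>Pow D'. m E * ln (m E / measure \<nu> (cyl D' E))) - (\<Sum>E\<in>Pow D'. k (E \<inter> D) * m E)"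
      by (simp add: sum_subtractf)
    also have "(\<Sum>E\<in>Pow D'. k (E \<inter> D) * m E) = (\<Sum>E\<in>Pow D. k E * measure \<mu> (cyl D E))"
      using sum_Pow_group[OF D, of k "\<lambda>E'. measure \<mu> (cyl D' E')"] unfolding consM m_def .
    finally show ?thesis unfolding entropy_def m_def k_def by (simp add: mult.commute)
  qed
  have "(\<Sum>E\<in>Pow D'. \<bar>m E - r E\<bar>)\<^sup>2 \<le> 4 * (\<Sum>E\<in>Pow D'. m E * ln (m E / r E))"
  proof (rule total_variation_le_entropy)
    show "sum m (Pow D') = 1" unfolding m_def by (rule total[OF D(1)])
  qed (use D sum_r ac in \<open>auto simp: m_def r_def\<close>)
  then show ?thesis unfolding ent unfolding m_def r_def .
qed

lemma entropy_mono:
  assumes "finite D'" "D \<subseteq> D'"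
  shows "entropy \<mu> \<nu> D \<le> entropy \<mu> \<nu> D'"
proof -
  have "0 \<le> 4 * (entropy \<mu> \<nu> D' - entropy \<mu> \<nu> D)"
    by (rule order_trans[OF zero_le_power2 entropy_increment[OF assms]])
  then show ?thesis by simp
qed

lemma entropy_empty: "entropy \<mu> \<nu> {} = 0"
  using M.prob_space N.prob_space sets_eq_imp_space_eq[OF sets_M] sets_eq_imp_space_eq[OF sets_N]
  by (simp add: entropy_def cyl_def)

end

lemma entropy_image:
  assumes "inj f"
    and "\<And>E. E \<subseteq> D \<Longrightarrow> measure \<mu> (cyl (f ` D) (f ` E)) = measure \<mu> (cyl D E)"
    and "\<And>E. E \<subseteq> D \<Longrightarrow> measure \<nu> (cyl (f ` D) (f ` E)) = measure \<nu> (cyl D E)"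
  shows "entropy \<mu> \<nu> (f ` D) = entropy \<mu> \<nu> D"
proof -
  have P: "Pow (f ` D) = (\<lambda>E. f ` E) ` Pow D" by (simp add: image_Pow_surj)
  have "inj_on (\<lambda>E. f ` E) (Pow D)" using assms(1) by (intro inj_onI) (simp add: inj_image_eq_iff)
  then show ?thesis unfolding entropy_def P using assms(2,3) by (simp add: sum.reindex)
qed

text \<open>If the entropy per site vanishes, so does, along suitable windows, the entropy increment
  caused by a fixed set \<open>V\<close>: the intervals \<open>{1..k L}\<close> grow by blocks that contain a translate of
  \<open>V\<close> in their middle, and removing only this translate costs no more than removing the block.\<close>

lemma small_entropy_increment:
  fixes \<mu> \<nu> :: "(int \<Rightarrow> real) measure"
  assumes "entropy_pair \<mu> \<nu>"
    and inv\<mu>: "\<And>k D E. finite D \<Longrightarrow> E \<subseteq> D \<Longrightarrow> measure \<mu> (cyl ((+) k ` D) ((+) k ` E)) = measure \<mu> (cyl D E)"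
    and inv\<nu>: "\<And>k D E. finite D \<Longrightarrow> E \<subseteq> D \<Longrightarrow> measure \<nu> (cyl ((+) k ` D) ((+) k ` E)) = measure \<nu> (cyl D E)"
    and s: "(\<lambda>n. entropy \<mu> \<nu> {- int n..int n} / (2 * real n + 1)) \<longlonglongrightarrow> 0"
    and V: "V \<subseteq> {- int R..int R}" and \<delta>: "\<delta> > 0"
  shows "\<exists>a\<ge>R. entropy \<mu> \<nu> {- int a..int R} - entropy \<mu> \<nu> ({- int a..int R} - V) \<le> \<delta>"
proof (rule ccontr)
  assume neg: "\<not> ?thesis"
  interpret entropy_pair \<mu> \<nu> by fact
  define H where "H = entropy \<mu> \<nu>"
  define L where "L = 2 * R + 1"
  define h where "h k = H {1..int (k * L)}" for k
  have shift: "H ((+) k ` D) = H D" if "finite D" for k D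
    unfolding H_def using that inv\<mu> inv\<nu> by (intro entropy_image) auto
  have step: "h k + \<delta> < h (Suc k)" for k
  proof -
    \<comment> \<open>The translate of \<open>V\<close> by \<open>t\<close> lies in the middle of the new block; seen from there the interval
      \<open>{1..(k + 1) L}\<close> is \<open>{-a..R}\<close>.\<close>
    define t where "t = int (k * L) + int R + 1"
    define a where "a = k * L + R"
    define D where "D = {- int a..int R}"
    have tD: "(+) t ` D = {1..int (Suc k * L)}" unfolding D_def a_def t_def L_def
      by (simp add: algebra_simps)
    have "\<delta> < H D - H (D - V)"
      using neg unfolding H_def D_def a_def by (metis le_add2 not_le_imp_less)
    moreover have "H D = h (Suc k)" unfolding h_def tD[symmetric] by (rule shift[symmetric]) (simp add: D_def)
    moreover have "h k \<le> H (D - V)"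
    proof -
      have "H (D - V) = H ((+) t ` (D - V))" by (rule shift[symmetric]) (simp add: D_def)
      moreover have "{1..int (k * L)} \<subseteq> (+) t ` (D - V)"
      proof
        fix x assume x: "x \<in> {1..int (k * L)}"
        have "x \<in> (+) t ` D" unfolding tD using x by (auto simp: algebra_simps)
        moreover have "x - t \<notin> V" using x V by (auto simp: t_def)
        ultimately show "x \<in> (+) t ` (D - V)" by auto
      qed
      then have "h k \<le> H ((+) t ` (D - V))" unfolding h_def H_def by (intro entropy_mono) (auto simp: D_def)
      ultimately show ?thesis by simp
    qed
    ultimately show ?thesis by linarith
  qed
  have h_lower: "real k * \<delta> \<le> h k" for k
  proof (induction k)
    case 0 show ?case by (simp add: h_def H_def entropy_empty)
  next
    case (Suc k) then show ?case using step[of k] by (simp add: algebra_simps)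
  qed
  obtain n0 where n0: "\<And>n. n \<ge> n0 \<Longrightarrow> norm (H {- int n..int n} / (2 * real n + 1) - 0) < \<delta> / (3 * real L)"
    using LIMSEQ_D[OF s, of "\<delta> / (3 * real L)"] \<delta> unfolding H_def by (auto simp: L_def)
  define k where "k = Suc n0"
  define n where "n = k * L"
  have n: "n \<ge> n0" "n \<ge> 1" unfolding n_def k_def L_def by auto
  have "h k \<le> H {- int n..int n}" unfolding h_def H_def n_def by (intro entropy_mono) auto
  also have "\<dots> < (2 * real n + 1) * (\<delta> / (3 * real L))"
    using n0[OF n(1)] by (simp add: field_simps abs_less_iff)
  also have "\<dots> \<le> (3 * real n) * (\<delta> / (3 * real L))" using n(2) \<delta> by (intro mult_right_mono) auto
  also have "\<dots> = real k * \<delta>"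
  proof -
    have "real L > 0" by (simp add: L_def)
    then show ?thesis unfolding n_def by (simp add: field_simps)
  qed
  finally show False using h_lower[of k] by simp
qed

subsection \<open>Relation to the entropy of the marginals\<close>

lemma measurable_restrict_configs: "(\<lambda>\<sigma>. restrict \<sigma> V) \<in> measurable (configs UNIV) (configs V)"
  unfolding configs_def by (rule measurable_restrict_subset) simp

lemma sets_configs_singleton:
  assumes "finite V" "\<tau> \<in> space (configs V)" shows "{\<tau>} \<in> sets (configs V)"
proof -
  have "{\<tau>} = (\<Pi>\<^sub>E i\<in>V. {\<tau> i})"
    using assms(2) by (auto simp: space_configs PiE_iff extensional_def fun_eq_iff) metis
  moreover have "\<dots> \<in> sets (configs V)"
    unfolding configs_def using assms by (intro sets_PiM_I_finite) (auto simp: space_configs spins_def PiE_iff)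
  ultimately show ?thesis by simp
qed

lemma measure_marginal:
  assumes \<mu>: "sets \<mu> = sets (configs UNIV)" and V: "finite V" "E \<subseteq> V"
  shows "measure (marginal V \<mu>) {spin_on V E} = measure \<mu> (cyl V E)"
proof -
  have sp: "space \<mu> = space (configs UNIV)" using \<mu> by (rule sets_eq_imp_space_eq)
  have meas: "(\<lambda>\<sigma>. restrict \<sigma> V) \<in> measurable \<mu> (configs V)"
    using measurable_restrict_configs \<mu> by (simp cong: measurable_cong_sets)
  have "restrict \<sigma> V = spin_on V E \<longleftrightarrow> minus_set \<sigma> \<inter> V = E" if "\<sigma> \<in> space (configs UNIV)" for \<sigma>
  proof -
    have "restrict \<sigma> V = spin_on V E \<longleftrightarrow> (\<forall>x\<in>V. \<sigma> x = (if x \<in> E then - 1 else 1))"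
      by (auto simp: spin_on_def fun_eq_iff)
    then show ?thesis using minus_set_Int_eq_iff[OF that V(2)] by simp
  qed
  then have "(\<lambda>\<sigma>. restrict \<sigma> V) -` {spin_on V E} \<inter> space \<mu> = cyl V E" unfolding sp cyl_def by auto
  then show ?thesis unfolding marginal_def
    using measure_distr[OF meas sets_configs_singleton[OF V(1) spin_on_in_configs]] by simp
qed

lemma rel_entropy_eq:
  assumes "entropy_pair \<mu> \<nu>" and V: "finite V"
  shows "rel_entropy V \<mu> \<nu> = ereal (entropy \<mu> \<nu> V)"
proof -
  interpret entropy_pair \<mu> \<nu> by fact
  have meas: "(\<lambda>\<sigma>. restrict \<sigma> V) \<in> measurable \<nu> (configs V)"
    using measurable_restrict_configs sets_N by (simp cong: measurable_cong_sets)
  interpret MN: prob_space "marginal V \<nu>" unfolding marginal_def by (rule N.prob_space_distr[OF meas])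
  have "A = {}" if A: "A \<in> null_sets (marginal V \<nu>)" for A
  proof (rule ccontr)
    assume "A \<noteq> {}"
    then obtain \<tau> where \<tau>: "\<tau> \<in> A" by blast
    have As: "A \<in> sets (marginal V \<nu>)" using A by auto
    then have "\<tau> \<in> space (configs V)" using \<tau> sets.sets_into_space by (fastforce simp: marginal_def)
    then have \<tau>': "\<tau> = spin_on V (minus_set \<tau> \<inter> V)" using spin_on_minus_set by metis
    have "measure (marginal V \<nu>) {\<tau>} \<le> measure (marginal V \<nu>) A"
      using \<tau> As by (intro MN.finite_measure_mono) auto
    also have "\<dots> = 0" using A by (simp add: measure_def null_setsD1)
    finally have "measure (marginal V \<nu>) {\<tau>} \<le> 0" .
    moreover have "measure (marginal V \<nu>) {\<tau>} > 0"
      using measure_marginal[OF sets_N V, of "minus_set \<tau> \<inter> V"] pos[OF V, of "minus_set \<tau> \<inter> V"] \<tau>' by simp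
    ultimately show False by simp
  qed
  then have "absolutely_continuous (marginal V \<nu>) (marginal V \<mu>)"
    unfolding absolutely_continuous_def by auto
  moreover have "(\<Sum>\<sigma>\<in>space (configs V). measure (marginal V \<mu>) {\<sigma>} * ln (measure (marginal V \<mu>) {\<sigma>} / measure (marginal V \<nu>) {\<sigma>}))
     = entropy \<mu> \<nu> V"
  proof -
    have "(\<Sum>\<sigma>\<in>space (configs V). measure (marginal V \<mu>) {\<sigma>} * ln (measure (marginal V \<mu>) {\<sigma>} / measure (marginal V \<nu>) {\<sigma>}))
      = (\<Sum>E\<in>Pow V. measure (marginal V \<mu>) {spin_on V E} * ln (measure (marginal V \<mu>) {spin_on V E} / measure (marginal V \<nu>) {spin_on V E}))"
      by (rule sum.reindex_bij_betw[OF bij_spin_on, symmetric])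
    also have "\<dots> = entropy \<mu> \<nu> V" unfolding entropy_def
      using measure_marginal[OF sets_M V] measure_marginal[OF sets_N V] by (intro sum.cong) auto
    finally show ?thesis .
  qed
  ultimately show ?thesis unfolding rel_entropy_def by simp
qed

section \<open>Sparse minus spins\<close>

lemma less_Inf_enat_iff: "enat n < Inf (enat ` S) \<longleftrightarrow> (\<forall>m\<in>S. n < m)"
proof
  assume "enat n < Inf (enat ` S)"
  then show "\<forall>m\<in>S. n < m" by (metis Inf_lower enat_ord_simps(2) image_eqI order_less_le_trans)
next
  assume S: "\<forall>m\<in>S. n < m"
  show "enat n < Inf (enat ` S)"
  proof (cases "S = {}")
    case False
    then have "Inf (enat ` S) \<in> enat ` S" by (simp add: Inf_enat_def LeastI_ex ex_in_conv) (metis LeastI imageI ex_in_conv)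
    then show ?thesis using S by auto
  qed (simp add: top_enat_def)
qed

text \<open>The common form of the conditions to the right (\<open>s = 1\<close>) and to the left (\<open>s = - 1\<close>) of the origin.\<close>

definition average_ok :: "real \<Rightarrow> int \<Rightarrow> nat \<Rightarrow> (int \<Rightarrow> real) \<Rightarrow> bool" where
  "average_ok \<alpha> s n \<sigma> \<longleftrightarrow> n \<ge> 1 \<and> (\<forall>k\<ge>n. (1 / real k) * (\<Sum>j = 0..k - 1. \<sigma> (s * int j)) \<ge> 8 / 9 * \<alpha>)"

lemma l_plus_average: "l_plus \<alpha> 0 \<sigma> = Inf (enat ` {n. average_ok \<alpha> 1 n \<sigma>})"
  and l_minus_average: "l_minus \<alpha> 0 \<sigma> = Inf (enat ` {n. average_ok \<alpha> (- 1) n \<sigma>})"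
  by (simp_all add: l_plus_def l_minus_def average_ok_def)

text \<open>The tail bound forces the minimum to be finite almost surely.\<close>

lemma AE_average_ok:
  assumes "prob_space \<mu>" and \<mu>: "sets \<mu> = sets (configs UNIV)" and c: "c > 0"
    and tail: "\<And>n. n \<ge> 1 \<Longrightarrow> \<P>(\<sigma> in \<mu>. Inf (enat ` {n. average_ok \<alpha> s n \<sigma>}) > enat n) \<le> exp (- c * real n)"
  shows "AE \<sigma> in \<mu>. \<exists>n. average_ok \<alpha> s n \<sigma>"
proof -
  interpret prob_space \<mu> by fact
  have [measurable]: "(\<lambda>\<sigma>. \<sigma> x) \<in> borel_measurable \<mu>" for x
    using borel_measurable_spin \<mu> by (simp cong: measurable_cong_sets)
  define T where "T n = {\<sigma> \<in> space \<mu>. \<forall>m. average_ok \<alpha> s m \<sigma> \<longrightarrow> n < m}" for n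
  have T: "T n \<in> sets \<mu>" for n unfolding T_def average_ok_def by measurable
  have "T n = {\<sigma> \<in> space \<mu>. Inf (enat ` {n. average_ok \<alpha> s n \<sigma>}) > enat n}" for n
    unfolding T_def by (simp add: less_Inf_enat_iff)
  then have bound: "measure \<mu> (T n) \<le> exp (- c * real n)" if "n \<ge> 1" for n using tail[OF that] by simp
  define N where "N = (\<Inter>n. T n)"
  have N: "N \<in> sets \<mu>" unfolding N_def using T by auto
  have "measure \<mu> N \<le> exp (- c) ^ n" if "n \<ge> 1" for n
  proof -
    have "measure \<mu> N \<le> measure \<mu> (T n)" using T by (intro finite_measure_mono) (auto simp: N_def)
    also have "\<dots> \<le> exp (- c * real n)" by (rule bound[OF that])
    finally show ?thesis by (simp add: exp_of_nat_mult[symmetric] mult.commute)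
  qed
  moreover have "(\<lambda>n. exp (- c) ^ n) \<longlonglongrightarrow> 0" using c by (intro LIMSEQ_realpow_zero) auto
  ultimately have "measure \<mu> N \<le> 0" by (intro LIMSEQ_le_const) auto
  then have "emeasure \<mu> N = 0" using emeasure_eq_measure[of N] measure_nonneg[of \<mu> N] by simp
  then have "N \<in> null_sets \<mu>" using N by auto
  moreover have "{\<sigma> \<in> space \<mu>. \<not> (\<exists>n. average_ok \<alpha> s n \<sigma>)} \<subseteq> N" by (auto simp: N_def T_def)
  ultimately show ?thesis by (intro AE_I')
qed

text \<open>A sum of \<open>k\<close> spins is \<open>k\<close> minus twice the number of minus spins. For \<open>k < n\<close> there are at most
  \<open>n\<close> minus spins anyway.\<close>

lemma average_ok_sparse:
  assumes \<sigma>: "\<sigma> \<in> space (configs UNIV)" and \<alpha>: "\<alpha> \<ge> 1" and ok: "average_ok \<alpha> s n \<sigma>" and s: "s = 1 \<or> s = - 1"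
  shows "real (card (minus_set \<sigma> \<inter> (\<lambda>j. s * int j) ` {..<k})) \<le> real n + real k / 18"
proof -
  define J where "J = {j\<in>{..<k}. \<sigma> (s * int j) = - 1}"
  have inj: "inj (\<lambda>j. s * int j)" using s by (auto simp: inj_def)
  have "minus_set \<sigma> \<inter> (\<lambda>j. s * int j) ` {..<k} = (\<lambda>j. s * int j) ` J" by (auto simp: J_def)
  then have card: "card (minus_set \<sigma> \<inter> (\<lambda>j. s * int j) ` {..<k}) = card J"
    using inj by (simp add: card_image inj_on_subset)
  show ?thesis
  proof (cases "k \<ge> n \<and> k \<ge> 1")
    case True
    have val: "\<sigma> (s * int j) = 1 - 2 * of_bool (\<sigma> (s * int j) = - 1)" for j
    proof -
      have "\<sigma> (s * int j) = - 1 \<or> \<sigma> (s * int j) = 1" using \<sigma> unfolding in_configs_UNIV by blast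
      then show ?thesis by auto
    qed
    have "(\<Sum>j = 0..k - 1. \<sigma> (s * int j)) = (\<Sum>j\<in>{..<k}. \<sigma> (s * int j))"
      using True by (intro sum.cong) auto
    also have "\<dots> = (\<Sum>j\<in>{..<k}. 1 - 2 * of_bool (\<sigma> (s * int j) = - 1))" using val by (intro sum.cong) auto
    also have "\<dots> = real k - 2 * real (card J)"
      unfolding J_def by (simp add: sum_subtractf sum_distrib_left[symmetric] of_bool_def sum.If_cases Int_def)
    finally have sum: "(\<Sum>j = 0..k - 1. \<sigma> (s * int j)) = real k - 2 * real (card J)" .
    have "8 / 9 \<le> 8 / 9 * \<alpha>" using \<alpha> by simp
    also have "\<dots> \<le> (1 / real k) * (real k - 2 * real (card J))" using ok True unfolding average_ok_def sum[symmetric] by blast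
    finally have "8 / 9 * real k \<le> real k - 2 * real (card J)" using True by (simp add: field_simps)
    then show ?thesis unfolding card by linarith
  next
    case False
    have "card J \<le> card {..<k}" unfolding J_def by (intro card_mono) auto
    then have "card J \<le> n" using False by auto
    then show ?thesis unfolding card by (simp add: add_increasing2)
  qed
qed

lemma sparse_minus_set:
  assumes \<sigma>: "\<sigma> \<in> space (configs UNIV)" and \<alpha>: "\<alpha> \<ge> 1"
    and ok: "average_ok \<alpha> 1 n \<sigma>" "average_ok \<alpha> (- 1) m \<sigma>"
  shows "sparse (real n + real m) (minus_set \<sigma>)"
  unfolding sparse_def
proof (intro allI conjI)
  fix k :: nat
  have i1: "{0..<int k} = (\<lambda>j. 1 * int j) ` {..<k}"
  proof (intro set_eqI iffI)
    fix x assume "x \<in> {0..<int k}"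
    then show "x \<in> (\<lambda>j. 1 * int j) ` {..<k}" by (intro image_eqI[of _ _ "nat x"]) auto
  qed auto
  have i2: "{- int k<..0} = (\<lambda>j. - 1 * int j) ` {..<k}"
  proof (intro set_eqI iffI)
    fix x assume "x \<in> {- int k<..0}"
    then show "x \<in> (\<lambda>j. - 1 * int j) ` {..<k}" by (intro image_eqI[of _ _ "nat (- x)"]) auto
  qed auto
  show "real (card (minus_set \<sigma> \<inter> {0..<int k})) \<le> real n + real m + real k / 18"
    unfolding i1 using average_ok_sparse[OF \<sigma> \<alpha> ok(1), of k] by simp
  show "real (card (minus_set \<sigma> \<inter> {- int k<..0})) \<le> real n + real m + real k / 18"
    unfolding i2 using average_ok_sparse[OF \<sigma> \<alpha> ok(2), of k] by simp
qed

lemma AE_sparse: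
  assumes \<mu>: "\<mu> \<in> M_class \<alpha>" and \<alpha>: "\<alpha> > 1"
  shows "AE \<sigma> in \<mu>. \<exists>c. sparse c (minus_set \<sigma>)"
proof -
  obtain c where c: "c > 0"
    and tails: "\<And>n. n \<ge> 1 \<Longrightarrow> \<P>(\<sigma> in \<mu>. l_plus \<alpha> 0 \<sigma> > enat n) \<le> exp (- c * real n)"
      "\<And>n. n \<ge> 1 \<Longrightarrow> \<P>(\<sigma> in \<mu>. l_minus \<alpha> 0 \<sigma> > enat n) \<le> exp (- c * real n)"
    using \<mu> by (auto simp: M_class_def)
  have props: "prob_space \<mu>" "sets \<mu> = sets (configs UNIV)" using \<mu> by (auto simp: M_class_def)
  have "AE \<sigma> in \<mu>. \<exists>n. average_ok \<alpha> 1 n \<sigma>"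
    by (rule AE_average_ok[OF props c]) (use tails(1) in \<open>simp add: l_plus_average\<close>)
  moreover have "AE \<sigma> in \<mu>. \<exists>n. average_ok \<alpha> (- 1) n \<sigma>"
    by (rule AE_average_ok[OF props c]) (use tails(2) in \<open>simp add: l_minus_average\<close>)
  moreover have "AE \<sigma> in \<mu>. \<sigma> \<in> space \<mu>" by (rule AE_space)
  ultimately show ?thesis
  proof eventually_elim
    case (elim \<sigma>)
    then obtain n m where ok: "average_ok \<alpha> 1 n \<sigma>" "average_ok \<alpha> (- 1) m \<sigma>" by blast
    have "\<sigma> \<in> space (configs UNIV)" using elim(3) sets_eq_imp_space_eq[OF props(2)] by simp
    then show ?case using sparse_minus_set[OF _ less_imp_le[OF \<alpha>] ok] by blast
  qed
qed


section \<open>The specification as a conditional probability\<close>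

lemma integral_pattern_function:
  assumes "finite_measure \<mu>" "sets \<mu> = sets (configs UNIV)" "finite W"
  shows "(\<lambda>\<omega>. \<phi> (minus_set \<omega> \<inter> W)) \<in> borel_measurable \<mu>"
    and "(\<integral>\<omega>. \<phi> (minus_set \<omega> \<inter> W) \<partial>\<mu>) = (\<Sum>G\<in>Pow W. \<phi> G * measure \<mu> (cyl W G) :: real)"
proof -
  interpret finite_measure \<mu> by fact
  have sp: "space \<mu> = space (configs UNIV)" using assms(2) by (rule sets_eq_imp_space_eq)
  have cyl: "cyl W G \<in> sets \<mu>" for G using assms by simp
  have eq: "\<phi> (minus_set \<omega> \<inter> W) = (\<Sum>G\<in>Pow W. \<phi> G * indicator (cyl W G) \<omega>)" if "\<omega> \<in> space \<mu>" for \<omega>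
  proof -
    have "(\<Sum>G\<in>Pow W. \<phi> G * indicator (cyl W G) \<omega>) = (\<Sum>G\<in>Pow W. if G = minus_set \<omega> \<inter> W then \<phi> G else 0)"
      using that by (intro sum.cong) (auto simp: cyl_def sp indicator_def)
    also have "\<dots> = \<phi> (minus_set \<omega> \<inter> W)" using assms(3) by (simp add: sum.delta')
    finally show ?thesis by simp
  qed
  have "(\<lambda>\<omega>. \<Sum>G\<in>Pow W. \<phi> G * indicator (cyl W G) \<omega>) \<in> borel_measurable \<mu>" using cyl by measurable
  then show "(\<lambda>\<omega>. \<phi> (minus_set \<omega> \<inter> W)) \<in> borel_measurable \<mu>"
    using eq by (simp cong: measurable_cong)
  have "(\<integral>\<omega>. \<phi> (minus_set \<omega> \<inter> W) \<partial>\<mu>) = (\<integral>\<omega>. (\<Sum>G\<in>Pow W. \<phi> G * indicator (cyl W G) \<omega>) \<partial>\<mu>)"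
    using eq by (intro Bochner_Integration.integral_cong) auto
  also have "\<dots> = (\<Sum>G\<in>Pow W. \<integral>\<omega>. \<phi> G * indicator (cyl W G) \<omega> \<partial>\<mu>)"
    using cyl by (intro Bochner_Integration.integral_sum integrable_mult_right integrable_real_indicator) (auto simp: emeasure_eq_measure)
  also have "\<dots> = (\<Sum>G\<in>Pow W. \<phi> G * measure \<mu> (cyl W G))"
    using sets.sets_into_space[OF cyl] by (intro sum.cong) (auto simp: Int_absorb2)
  finally show "(\<integral>\<omega>. \<phi> (minus_set \<omega> \<inter> W) \<partial>\<mu>) = (\<Sum>G\<in>Pow W. \<phi> G * measure \<mu> (cyl W G))" .
qed

text \<open>The specification as a function of the minus set: the probability of the minus set \<open>F\<close> in \<open>V\<close>,
  given the minus set \<open>P\<close> off \<open>V\<close>.\<close>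

definition spec :: "real \<Rightarrow> int set \<Rightarrow> int set \<Rightarrow> int set \<Rightarrow> real" where
  "spec \<beta> V F P = limit_window \<beta> V P (pattern (row V) (row F))"

definition spec_box :: "real \<Rightarrow> int set \<Rightarrow> int set \<Rightarrow> int set \<Rightarrow> nat \<Rightarrow> nat \<Rightarrow> real" where
  "spec_box \<beta> V F P a b = limit_box \<beta> V P a b (pattern (row V) (row F))"

lemma avg_pattern_bounds: "0 \<le> avg \<beta> I (pattern A E)" "avg \<beta> I (pattern A E) \<le> 1"
proof -
  show "0 \<le> avg \<beta> I (pattern A E)" by (intro avg_nonneg) (simp add: pattern_def)
  show "avg \<beta> I (pattern A E) \<le> 1"
  proof (cases "part \<beta> I > 0")
    case True
    have "avg \<beta> I (pattern A E) \<le> avg \<beta> I (\<lambda>_. 1)" by (intro avg_mono) (simp add: pattern_def)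
    then show ?thesis using avg_one[OF True] by simp
  next
    case False
    then have "part \<beta> I = 0" using part_nonneg[of \<beta> I] by linarith
    then show ?thesis by (simp add: avg_def)
  qed
qed

lemma given_cong: "P \<inter> window V a b = P' \<inter> window V a b \<Longrightarrow> given V P a b N = given V P' a b N"
  by (simp add: given_def)

context
  fixes \<beta> :: real and V F :: "int set"
  assumes \<beta>0: "\<beta> \<ge> 0" and V: "finite V" and F: "F \<subseteq> V"
begin

lemma finite_row_F: "finite (row F)" "row F \<subseteq> row V"
  using V F finite_subset by (auto simp: row_def)

lemma spec_LIMSEQ: "(\<lambda>n. avg \<beta> (given V P n n n) (pattern (row V) (row F))) \<longlonglongrightarrow> spec \<beta> V F P"
  unfolding spec_def limit_window_def
  using convergent_pattern(2)[OF \<beta>0 finite_row_F] by (simp add: convergent_LIMSEQ_iff)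

lemma spec_box_LIMSEQ: "(\<lambda>N. avg \<beta> (given V P a b N) (pattern (row V) (row F))) \<longlonglongrightarrow> spec_box \<beta> V F P a b"
  unfolding spec_box_def limit_box_def
  using convergent_pattern(1)[OF \<beta>0 finite_row_F] by (simp add: convergent_LIMSEQ_iff)

lemma spec_bounds: "0 \<le> spec \<beta> V F P" "spec \<beta> V F P \<le> 1"
  by (rule LIMSEQ_le_const[OF spec_LIMSEQ], simp add: avg_pattern_bounds)
     (rule LIMSEQ_le_const2[OF spec_LIMSEQ], simp add: avg_pattern_bounds)

lemma spec_box_bounds: "0 \<le> spec_box \<beta> V F P a b" "spec_box \<beta> V F P a b \<le> 1"
  by (rule LIMSEQ_le_const[OF spec_box_LIMSEQ], simp add: avg_pattern_bounds)
     (rule LIMSEQ_le_const2[OF spec_box_LIMSEQ], simp add: avg_pattern_bounds)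

lemma spec_box_cong: "P \<inter> window V a b = P' \<inter> window V a b \<Longrightarrow> spec_box \<beta> V F P a b = spec_box \<beta> V F P' a b"
  unfolding spec_box_def limit_box_def using given_cong by metis

lemma measurable_spec:
  assumes "finite_measure \<mu>" "sets \<mu> = sets (configs UNIV)"
  shows "(\<lambda>\<omega>. spec \<beta> V F (minus_set \<omega>)) \<in> borel_measurable \<mu>"
proof (rule borel_measurable_LIMSEQ_real)
  show "(\<lambda>n. avg \<beta> (given V (minus_set \<omega>) n n n) (pattern (row V) (row F))) \<longlonglongrightarrow> spec \<beta> V F (minus_set \<omega>)" for \<omega>
    by (rule spec_LIMSEQ)
  fix n
  have "avg \<beta> (given V (minus_set \<omega>) n n n) (pattern (row V) (row F))
      = avg \<beta> (given V (minus_set \<omega> \<inter> window V n n) n n n) (pattern (row V) (row F))" for \<omega>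
    by (simp add: given_def Int_assoc)
  then show "(\<lambda>\<omega>. avg \<beta> (given V (minus_set \<omega>) n n n) (pattern (row V) (row F))) \<in> borel_measurable \<mu>"
    using integral_pattern_function(1)[OF assms, of "window V n n" "\<lambda>G. avg \<beta> (given V G n n n) (pattern (row V) (row F))"] by simp
qed

end

text \<open>The integrated form of the statement that \<open>spec\<close> gives the conditional probabilities of \<open>\<mu>\<close>.
  Up to the square root of the entropy increment, \<open>\<mu>\<close> has on a finite window the conditional
  probabilities of \<open>\<nu>\<close>; along windows with vanishing increment these converge to the
  specification, almost surely since minus spins are sparse.\<close>

lemma spec_integral:
  assumes \<beta>: "\<beta> \<ge> 20" and V: "finite V" and D: "finite D" "V \<subseteq> D" "E \<subseteq> D"
    and pair: "entropy_pair \<mu> (nu_plus \<beta>)"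
    and inv: "\<And>k D E. finite D \<Longrightarrow> E \<subseteq> D \<Longrightarrow> measure \<mu> (cyl ((+) k ` D) ((+) k ` E)) = measure \<mu> (cyl D E)"
    and s: "(\<lambda>n. entropy \<mu> (nu_plus \<beta>) {- int n..int n} / (2 * real n + 1)) \<longlonglongrightarrow> 0"
    and sparse: "AE \<omega> in \<mu>. \<exists>c. sparse c (minus_set \<omega>)"
  shows "(\<integral>\<omega>. of_bool (minus_set \<omega> \<inter> (D - V) = E - V) * spec \<beta> V (E \<inter> V) (minus_set \<omega>) \<partial>\<mu>) = measure \<mu> (cyl D E)"
proof -
  interpret entropy_pair \<mu> "nu_plus \<beta>" by fact
  have \<beta>0: "\<beta> \<ge> 0" using \<beta> by simp
  have fV: "E \<inter> V \<subseteq> V" by simp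
  obtain r where r: "D \<subseteq> {- int r..int r}" by (rule finite_int_subset_interval[OF D(1)])
  define b where "b j = r + j" for j
  have "\<exists>a\<ge>b j. entropy \<mu> (nu_plus \<beta>) {- int a..int (b j)} - entropy \<mu> (nu_plus \<beta>) ({- int a..int (b j)} - V) \<le> 1 / (real j + 1)" for j
  proof (rule small_entropy_increment[OF pair inv nu_plus_shift[OF \<beta>0] s])
    show "V \<subseteq> {- int (b j)..int (b j)}" using r D by (fastforce simp: b_def)
  qed auto
  then obtain a where a: "\<And>j. a j \<ge> b j"
    "\<And>j. entropy \<mu> (nu_plus \<beta>) {- int (a j)..int (b j)} - entropy \<mu> (nu_plus \<beta>) ({- int (a j)..int (b j)} - V) \<le> 1 / (real j + 1)"
    by metis
  define \<Delta> where "\<Delta> j = {- int (a j)..int (b j)}" for j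
  define W where "W j = window V (a j) (b j)" for j
  define g where "g j P = spec_box \<beta> V (E \<inter> V) P (a j) (b j)" for j P
  define \<phi> where "\<phi> j P = of_bool (P \<inter> (D - V) = E - V) * g j P" for j P
  have D\<Delta>: "D \<subseteq> \<Delta> j" for j using r a(1)[of j] by (fastforce simp: \<Delta>_def b_def)
  have W\<Delta>: "W j = \<Delta> j - V" for j by (simp add: W_def \<Delta>_def window_def)
  have fin: "finite (\<Delta> j)" "finite (W j)" for j by (simp_all add: \<Delta>_def W_def)
  note M = M.finite_measure_axioms sets_M
  have \<phi>_W: "\<phi> j (minus_set \<omega>) = \<phi> j (minus_set \<omega> \<inter> W j)" for j \<omega>
  proof -
    have "minus_set \<omega> \<inter> W j \<inter> (D - V) = minus_set \<omega> \<inter> (D - V)" using D\<Delta>[of j] W\<Delta>[of j] by blast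
    moreover have "g j (minus_set \<omega>) = g j (minus_set \<omega> \<inter> W j)"
      unfolding g_def by (intro spec_box_cong[OF \<beta>0 V fV]) (simp add: W_def)
    ultimately show ?thesis by (simp add: \<phi>_def)
  qed
  \<comment> \<open>Pinsker-type comparison of \<open>\<mu>\<close> on \<open>\<Delta> j\<close> with \<open>\<rho>\<close>, the marginal of \<open>\<mu>\<close> off \<open>V\<close> continued by the conditional probabilities of \<open>nu_plus \<beta>\<close>.\<close>
  have close: "\<bar>measure \<mu> (cyl D E) - (\<integral>\<omega>. \<phi> j (minus_set \<omega>) \<partial>\<mu>)\<bar> \<le> 2 * sqrt (1 / (real j + 1))" for j
  proof -
    define \<rho> where "\<rho> G = measure \<mu> (cyl (W j) (G \<inter> W j)) * (measure (nu_plus \<beta>) (cyl (\<Delta> j) G) / measure (nu_plus \<beta>) (cyl (W j) (G \<inter> W j)))" for G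
    define S where "S = {G. G \<subseteq> \<Delta> j \<and> G \<inter> D = E}"
    have S: "S \<subseteq> Pow (\<Delta> j)" "finite S" using fin by (auto simp: S_def intro: finite_subset[of _ "Pow (\<Delta> j)"])
    have "(\<Sum>G\<in>Pow (\<Delta> j). \<bar>measure \<mu> (cyl (\<Delta> j) G) - \<rho> G\<bar>)\<^sup>2 \<le> 4 * (entropy \<mu> (nu_plus \<beta>) (\<Delta> j) - entropy \<mu> (nu_plus \<beta>) (W j))"
      unfolding \<rho>_def by (rule entropy_increment[OF fin(1)]) (auto simp: W\<Delta>)
    also have "\<dots> \<le> 4 * (1 / (real j + 1))" using a(2)[of j] unfolding W\<Delta> \<Delta>_def by simp
    finally have "(\<Sum>G\<in>Pow (\<Delta> j). \<bar>measure \<mu> (cyl (\<Delta> j) G) - \<rho> G\<bar>) \<le> sqrt (4 * (1 / (real j + 1)))"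
      by (rule real_le_rsqrt)
    then have tv: "(\<Sum>G\<in>Pow (\<Delta> j). \<bar>measure \<mu> (cyl (\<Delta> j) G) - \<rho> G\<bar>) \<le> 2 * sqrt (1 / (real j + 1))"
      by (simp only: real_sqrt_mult real_sqrt_four)
    have \<rho>: "\<rho> G = measure \<mu> (cyl (W j) (G \<inter> W j)) * g j (G \<inter> W j)" if "G \<in> S" for G
    proof -
      have G: "G \<subseteq> {- int (a j)..int (b j)}" and "G \<inter> D = E" using that by (auto simp: S_def \<Delta>_def)
      then have GV: "G \<inter> V = E \<inter> V" using D(2) by blast
      have "measure (nu_plus \<beta>) (cyl (\<Delta> j) G) = measure (nu_plus \<beta>) (cyl (W j) (G \<inter> W j)) * g j G"
        unfolding g_def spec_box_def GV[symmetric] \<Delta>_def W_def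
        using D\<Delta>[of j] D(2) by (intro nu_plus_condition[OF \<beta>0 _ G]) (auto simp: \<Delta>_def)
      moreover have "g j G = g j (G \<inter> W j)"
        unfolding g_def by (intro spec_box_cong[OF \<beta>0 V fV]) (simp add: W_def)
      moreover have "measure (nu_plus \<beta>) (cyl (W j) (G \<inter> W j)) > 0" using fin by (intro pos) auto
      ultimately show ?thesis unfolding \<rho>_def by simp
    qed
    have int: "(\<integral>\<omega>. \<phi> j (minus_set \<omega>) \<partial>\<mu>) = (\<Sum>G\<in>S. \<rho> G)"
    proof -
      have "(\<integral>\<omega>. \<phi> j (minus_set \<omega>) \<partial>\<mu>) = (\<Sum>G\<in>Pow (W j). \<phi> j G * measure \<mu> (cyl (W j) G))"
        unfolding \<phi>_W by (rule integral_pattern_function(2)[OF M fin(2)])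
      also have "\<dots> = (\<Sum>G\<in>{G. G \<subseteq> W j \<and> G \<inter> (D - V) = E - V}. measure \<mu> (cyl (W j) G) * g j G)"
        using fin by (intro sum.mono_neutral_cong_right) (auto simp: \<phi>_def)
      also have "\<dots> = (\<Sum>G\<in>S. measure \<mu> (cyl (W j) (G \<inter> W j)) * g j (G \<inter> W j))"
      proof (rule sum.reindex_bij_witness[of _ "\<lambda>G. G \<inter> W j" "\<lambda>G. G \<union> (E \<inter> V)"])
        fix G assume G: "G \<in> {G. G \<subseteq> W j \<and> G \<inter> (D - V) = E - V}"
        then show e: "(G \<union> (E \<inter> V)) \<inter> W j = G" using W\<Delta>[of j] by blast
        show "G \<union> (E \<inter> V) \<in> S" unfolding S_def using G W\<Delta>[of j] D\<Delta>[of j] D(2,3) by blast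
        show "measure \<mu> (cyl (W j) ((G \<union> (E \<inter> V)) \<inter> W j)) * g j ((G \<union> (E \<inter> V)) \<inter> W j) = measure \<mu> (cyl (W j) G) * g j G"
          unfolding e ..
      next
        fix G assume G: "G \<in> S"
        then show "(G \<inter> W j) \<union> (E \<inter> V) = G" unfolding S_def using W\<Delta>[of j] D(2) by blast
        show "G \<inter> W j \<in> {G. G \<subseteq> W j \<and> G \<inter> (D - V) = E - V}" using G unfolding S_def using W\<Delta>[of j] D\<Delta>[of j] by blast
      qed
      also have "\<dots> = (\<Sum>G\<in>S. \<rho> G)" using \<rho> by (intro sum.cong) auto
      finally show ?thesis .
    qed
    have "measure \<mu> (cyl D E) = (\<Sum>G\<in>S. measure \<mu> (cyl (\<Delta> j) G))"
      unfolding S_def by (rule cyl_consistent[OF M fin(1) D\<Delta>, symmetric])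
    then have "\<bar>measure \<mu> (cyl D E) - (\<integral>\<omega>. \<phi> j (minus_set \<omega>) \<partial>\<mu>)\<bar> = \<bar>\<Sum>G\<in>S. measure \<mu> (cyl (\<Delta> j) G) - \<rho> G\<bar>"
      unfolding int by (simp add: sum_subtractf)
    also have "\<dots> \<le> (\<Sum>G\<in>S. \<bar>measure \<mu> (cyl (\<Delta> j) G) - \<rho> G\<bar>)" by (rule sum_abs)
    also have "\<dots> \<le> (\<Sum>G\<in>Pow (\<Delta> j). \<bar>measure \<mu> (cyl (\<Delta> j) G) - \<rho> G\<bar>)" using S fin by (intro sum_mono2) auto
    finally show ?thesis using tv by linarith
  qed
  have lim1: "(\<lambda>j. \<integral>\<omega>. \<phi> j (minus_set \<omega>) \<partial>\<mu>) \<longlonglongrightarrow> measure \<mu> (cyl D E)"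
  proof -
    have "(\<lambda>j. sqrt (1 / (real j + 1))) \<longlonglongrightarrow> sqrt 0"
      using LIMSEQ_inverse_real_of_nat by (intro tendsto_real_sqrt) (simp add: inverse_eq_divide add.commute)
    then have "(\<lambda>j. 2 * sqrt (1 / (real j + 1))) \<longlonglongrightarrow> 2 * sqrt 0" by (rule tendsto_mult_left)
    then have "(\<lambda>j. 2 * sqrt (1 / (real j + 1))) \<longlonglongrightarrow> 0" by simp
    then have "(\<lambda>j. (\<integral>\<omega>. \<phi> j (minus_set \<omega>) \<partial>\<mu>) - measure \<mu> (cyl D E)) \<longlonglongrightarrow> 0"
      by (rule Lim_null_comparison[rotated]) (use close in \<open>auto simp: abs_minus_commute intro!: always_eventually\<close>)
    then show ?thesis by (simp add: LIM_zero_iff)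
  qed
  have lim2: "(\<lambda>j. \<integral>\<omega>. \<phi> j (minus_set \<omega>) \<partial>\<mu>) \<longlonglongrightarrow>
      (\<integral>\<omega>. of_bool (minus_set \<omega> \<inter> (D - V) = E - V) * spec \<beta> V (E \<inter> V) (minus_set \<omega>) \<partial>\<mu>)"
  proof (rule integral_dominated_convergence[where w="\<lambda>_. 1"])
    have "(\<lambda>\<omega>. of_bool (minus_set \<omega> \<inter> (D - V) = E - V) :: real) \<in> borel_measurable \<mu>"
      using integral_pattern_function(1)[OF M, of "D - V" "\<lambda>G. of_bool (G = E - V)"] D(1) by simp
    then show "(\<lambda>\<omega>. of_bool (minus_set \<omega> \<inter> (D - V) = E - V) * spec \<beta> V (E \<inter> V) (minus_set \<omega>)) \<in> borel_measurable \<mu>"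
      using measurable_spec[OF \<beta>0 V fV M] by (rule borel_measurable_times)
    show "(\<lambda>\<omega>. \<phi> j (minus_set \<omega>)) \<in> borel_measurable \<mu>" for j
      unfolding \<phi>_W by (rule integral_pattern_function(1)[OF M fin(2)])
    show "AE \<omega> in \<mu>. (\<lambda>j. \<phi> j (minus_set \<omega>)) \<longlonglongrightarrow> of_bool (minus_set \<omega> \<inter> (D - V) = E - V) * spec \<beta> V (E \<inter> V) (minus_set \<omega>)"
      using sparse
    proof eventually_elim
      case (elim \<omega>)
      then obtain c where c: "sparse c (minus_set \<omega>)" by blast
      have b_lim: "filterlim b at_top sequentially"
        unfolding filterlim_at_top b_def by (auto simp: eventually_sequentially intro: exI[of _ "_::nat"] trans_le_add2)
      have "filterlim a at_top sequentially" using b_lim by (rule filterlim_at_top_mono) (use a(1) in auto)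
      then have "(\<lambda>j. g j (minus_set \<omega>)) \<longlonglongrightarrow> spec \<beta> V (E \<inter> V) (minus_set \<omega>)"
        unfolding g_def spec_def spec_box_def using windows_converge[OF \<beta> V c fV _ b_lim] by blast
      then show ?case unfolding \<phi>_def by (rule tendsto_mult_left)
    qed
    show "AE \<omega> in \<mu>. norm (\<phi> j (minus_set \<omega>)) \<le> 1" for j
      using spec_box_bounds[OF \<beta>0 V fV] by (auto simp: \<phi>_def g_def of_bool_def)
  qed simp
  from lim1 lim2 show ?thesis using LIMSEQ_unique by blast
qed

text \<open>For each pattern \<open>F\<close> on \<open>V\<close> two measures agree on all cylinders, hence are equal: \<open>\<mu>\<close> weighted with
  the specification of \<open>F\<close> and mapped by setting the pattern \<open>F\<close> on \<open>V\<close>, and \<open>\<mu>\<close> restricted to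
  the configurations with pattern \<open>F\<close>. Integrating \<open>f\<close> and summing over \<open>F\<close> gives the Gibbs property.\<close>

lemma gibbs_from_spec:
  assumes \<beta>0: "\<beta> \<ge> 0" and "prob_space \<mu>" and \<mu>: "sets \<mu> = sets (configs UNIV)"
    and spec: "\<And>V D E. finite V \<Longrightarrow> finite D \<Longrightarrow> V \<subseteq> D \<Longrightarrow> E \<subseteq> D \<Longrightarrow>
      (\<integral>\<omega>. of_bool (minus_set \<omega> \<inter> (D - V) = E - V) * spec \<beta> V (E \<inter> V) (minus_set \<omega>) \<partial>\<mu>) = measure \<mu> (cyl D E)"
  shows "\<mu> \<in> gibbs \<beta>"
proof -
  interpret prob_space \<mu> by fact
  have sp: "space \<mu> = space (configs UNIV)" using \<mu> by (rule sets_eq_imp_space_eq)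
  have main: "(\<integral>\<omega>. (\<Sum>\<sigma>\<in>space (configs V). gamma \<beta> V \<sigma> \<omega> * f (glue V \<sigma> \<omega>)) \<partial>\<mu>) = (\<integral>\<omega>. f \<omega> \<partial>\<mu>)"
    if V: "finite V" and f: "f \<in> borel_measurable (configs UNIV)"
      and bd: "\<exists>C. \<forall>\<omega>\<in>space (configs UNIV). \<bar>f \<omega>\<bar> \<le> C" for V f
  proof -
    obtain C where C: "\<And>\<omega>. \<omega> \<in> space (configs UNIV) \<Longrightarrow> \<bar>f \<omega>\<bar> \<le> C" using bd by blast
    define T where "T F = glue V (spin_on V F)" for F
    define g where "g F \<omega> = spec \<beta> V F (minus_set \<omega>)" for F \<omega>
    have T_in: "T F \<omega> \<in> space (configs UNIV)" if "\<omega> \<in> space (configs UNIV)" for F \<omega>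
      using that by (auto simp: T_def glue_def spin_on_def in_configs_UNIV)
    have T_meas: "T F \<in> measurable \<mu> (configs UNIV)" for F
    proof -
      have "(\<lambda>\<omega> i. if i \<in> V then spin_on V F i else \<omega> i) \<in> measurable (configs UNIV) (configs UNIV)"
      proof (unfold configs_def, rule measurable_PiM_single')
        fix i :: int
        have "(\<lambda>\<omega>. \<omega> i) \<in> measurable (PiM UNIV (\<lambda>_. count_space spins)) (count_space spins)"
          by (rule measurable_component_singleton) simp
        then show "(\<lambda>\<omega>. if i \<in> V then spin_on V F i else \<omega> i) \<in> measurable (PiM UNIV (\<lambda>_. count_space spins)) (count_space spins)"
          by (cases "i \<in> V") (auto simp: spin_on_def spins_def)
      qed (auto simp: spin_on_def spins_def space_PiM PiE_UNIV_domain Pi_iff)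
      then show ?thesis unfolding T_def glue_def[abs_def] using \<mu> by (simp cong: measurable_cong_sets)
    qed
    have T_minus: "minus_set (T F \<omega>) \<inter> D = E \<longleftrightarrow> F = E \<inter> V \<and> minus_set \<omega> \<inter> (D - V) = E - V"
      if "F \<subseteq> V" "V \<subseteq> D" "E \<subseteq> D" for F D E \<omega>
    proof -
      have "minus_set (T F \<omega>) \<inter> D = F \<union> (minus_set \<omega> \<inter> (D - V))"
        using that by (auto simp: T_def glue_def spin_on_def split: if_splits)
      then show ?thesis using that by blast
    qed
    have g_meas: "g F \<in> borel_measurable \<mu>" if "F \<subseteq> V" for F
      unfolding g_def using measurable_spec[OF \<beta>0 V that finite_measure_axioms \<mu>] .
    have g_bd: "0 \<le> g F \<omega>" "g F \<omega> \<le> 1" if "F \<subseteq> V" for F \<omega>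
      unfolding g_def using spec_bounds[OF \<beta>0 V that] by auto
    have f_meas: "f \<in> borel_measurable \<mu>" using f \<mu> by (simp cong: measurable_cong_sets)
    have fT_meas: "(\<lambda>\<omega>. f (T F \<omega>)) \<in> borel_measurable \<mu>" for F by (rule measurable_compose[OF T_meas f])
    have cyl_meas: "cyl V F \<in> sets \<mu>" for F using V \<mu> by simp
    have one: "(\<integral>\<omega>. g F \<omega> * f (T F \<omega>) \<partial>\<mu>) = (\<integral>\<omega>. indicator (cyl V F) \<omega> * f \<omega> \<partial>\<mu>)" if F: "F \<subseteq> V" for F
    proof -
      define M1 where "M1 = distr (density \<mu> (\<lambda>\<omega>. ennreal (g F \<omega>))) (configs UNIV) (T F)"
      define M2 where "M2 = density \<mu> (\<lambda>\<omega>. ennreal (indicator (cyl V F) \<omega>))"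
      have T_dens: "T F \<in> measurable (density \<mu> (\<lambda>\<omega>. ennreal (g F \<omega>))) (configs UNIV)" using T_meas by simp
      have fin_dens: "finite_measure (density \<mu> h)" if h: "h \<in> borel_measurable \<mu>" "\<And>\<omega>. h \<omega> \<le> 1" for h
      proof
        have "emeasure (density \<mu> h) (space (density \<mu> h)) = (\<integral>\<^sup>+ \<omega>. h \<omega> \<partial>\<mu>)"
          using h by (simp add: emeasure_density cong: nn_integral_cong)
        also have "\<dots> \<le> (\<integral>\<^sup>+ \<omega>. 1 \<partial>\<mu>)" using h by (intro nn_integral_mono)
        also have "\<dots> = 1" by (simp add: emeasure_space_1)
        finally show "emeasure (density \<mu> h) (space (density \<mu> h)) \<noteq> \<infinity>" by (auto simp: top_unique)
      qed
      have int1: "(\<integral>\<omega>. h \<omega> \<partial>M1) = (\<integral>\<omega>. g F \<omega> * h (T F \<omega>) \<partial>\<mu>)" if h: "h \<in> borel_measurable (configs UNIV)" for h :: "_ \<Rightarrow> real"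
      proof -
        have "(\<integral>\<omega>. h \<omega> \<partial>M1) = (\<integral>\<omega>. h (T F \<omega>) \<partial>(density \<mu> (\<lambda>\<omega>. ennreal (g F \<omega>))))"
          unfolding M1_def by (rule integral_distr[OF T_dens h])
        also have "\<dots> = (\<integral>\<omega>. g F \<omega> *\<^sub>R h (T F \<omega>) \<partial>\<mu>)"
          using g_meas[OF F] g_bd[OF F] measurable_compose[OF T_meas h] by (intro integral_density) auto
        finally show ?thesis by simp
      qed
      have int2: "(\<integral>\<omega>. h \<omega> \<partial>M2) = (\<integral>\<omega>. indicator (cyl V F) \<omega> * h \<omega> \<partial>\<mu>)" if h: "h \<in> borel_measurable (configs UNIV)" for h :: "_ \<Rightarrow> real"
      proof -
        have "h \<in> borel_measurable \<mu>" using h \<mu> by (simp cong: measurable_cong_sets)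
        then have "(\<integral>\<omega>. h \<omega> \<partial>M2) = (\<integral>\<omega>. indicator (cyl V F) \<omega> *\<^sub>R h \<omega> \<partial>\<mu>)"
          unfolding M2_def using cyl_meas by (intro integral_density) auto
        then show ?thesis by simp
      qed
      have S1: "sets M1 = sets (configs UNIV)" "sets M2 = sets (configs UNIV)" by (simp_all add: M1_def M2_def \<mu>)
      have fin1: "finite_measure M1" unfolding M1_def
        using g_meas[OF F] g_bd(2)[OF F] T_dens by (intro finite_measure.finite_measure_distr fin_dens) auto
      have fin2: "finite_measure M2" unfolding M2_def
        using cyl_meas by (intro fin_dens) (auto simp: indicator_def)
      have ind: "measure N A = (\<integral>\<omega>. indicator A \<omega> \<partial>N)" if "sets N = sets (configs UNIV)" "A \<in> sets (configs UNIV)" for N :: "(int \<Rightarrow> real) measure" and A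
        using that sets.sets_into_space[of A N] by (simp add: Int_absorb2)
      have eqD: "measure M1 (cyl D E) = measure M2 (cyl D E)" if D: "finite D" "V \<subseteq> D" "E \<subseteq> D" for D E
      proof -
        have cD: "cyl D E \<in> sets (configs UNIV)" using D by simp
        have "measure M1 (cyl D E) = (\<integral>\<omega>. g F \<omega> * indicator (cyl D E) (T F \<omega>) \<partial>\<mu>)"
          using ind[OF S1(1) cD] int1[of "indicator (cyl D E)"] cD by simp
        also have "\<dots> = (\<integral>\<omega>. of_bool (F = E \<inter> V) * (of_bool (minus_set \<omega> \<inter> (D - V) = E - V) * spec \<beta> V (E \<inter> V) (minus_set \<omega>)) \<partial>\<mu>)"
          using T_in T_minus[OF F D(2,3)] sp by (intro Bochner_Integration.integral_cong) (auto simp: indicator_def cyl_def g_def)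
        also have "\<dots> = of_bool (F = E \<inter> V) * measure \<mu> (cyl D E)"
          using spec[OF V D(1,2,3)] by simp
        finally have 1: "measure M1 (cyl D E) = of_bool (F = E \<inter> V) * measure \<mu> (cyl D E)" .
        have cut: "cyl V F \<inter> cyl D E = (if F = E \<inter> V then cyl D E else {})"
        proof -
          have "minus_set \<omega> \<inter> D = E \<Longrightarrow> minus_set \<omega> \<inter> V = E \<inter> V" for \<omega> using D(2) by blast
          then show ?thesis unfolding cyl_def by auto
        qed
        have "measure M2 (cyl D E) = (\<integral>\<omega>. indicator (cyl V F) \<omega> * indicator (cyl D E) \<omega> \<partial>\<mu>)"
          using ind[OF S1(2) cD] int2[of "indicator (cyl D E)"] cD by simp
        also have "\<dots> = (\<integral>\<omega>. indicator (cyl V F \<inter> cyl D E) \<omega> \<partial>\<mu>)" by (simp add: indicator_inter_arith)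
        also have "\<dots> = measure \<mu> (cyl V F \<inter> cyl D E)"
          by (rule ind[OF \<mu>, symmetric]) (use V D in auto)
        finally show ?thesis using 1 by (simp add: cut)
      qed
      have "M1 = M2"
      proof (rule configs_measure_eqI[OF fin1 S1(1) fin2 S1(2)])
        fix D E :: "int set" assume D: "finite D" "E \<subseteq> D"
        have fDV: "finite (D \<union> V)" using D V by simp
        show "measure M1 (cyl D E) = measure M2 (cyl D E)"
          using cyl_consistent[OF fin1 S1(1) fDV, of D E] cyl_consistent[OF fin2 S1(2) fDV, of D E] eqD[OF fDV]
          by (metis (no_types, lifting) Un_upper1 Un_upper2 mem_Collect_eq sum.cong)
      qed
      then show ?thesis using int1[OF f] int2[OF f] by simp
    qed
    have gam: "(\<Sum>\<sigma>\<in>space (configs V). gamma \<beta> V \<sigma> \<omega> * f (glue V \<sigma> \<omega>)) = (\<Sum>F\<in>Pow V. g F \<omega> * f (T F \<omega>))"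
      if \<omega>: "\<omega> \<in> space \<mu>" for \<omega>
    proof -
      have "(\<Sum>\<sigma>\<in>space (configs V). gamma \<beta> V \<sigma> \<omega> * f (glue V \<sigma> \<omega>)) = (\<Sum>F\<in>Pow V. gamma \<beta> V (spin_on V F) \<omega> * f (glue V (spin_on V F) \<omega>))"
        by (rule sum.reindex_bij_betw[OF bij_spin_on, symmetric])
      also have "\<dots> = (\<Sum>F\<in>Pow V. g F \<omega> * f (T F \<omega>))"
      proof (intro sum.cong refl)
        fix F assume "F \<in> Pow V"
        then have "minus_set (spin_on V F) \<inter> V = F" using minus_set_spin_on[of V F] by auto
        then show "gamma \<beta> V (spin_on V F) \<omega> * f (glue V (spin_on V F) \<omega>) = g F \<omega> * f (T F \<omega>)"
          using gamma_eq_limit_window(2)[OF \<beta>0 V spin_on_in_configs, of \<omega> F] \<omega> sp by (simp add: g_def spec_def T_def)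
      qed
      finally show ?thesis .
    qed
    have "(\<integral>\<omega>. (\<Sum>\<sigma>\<in>space (configs V). gamma \<beta> V \<sigma> \<omega> * f (glue V \<sigma> \<omega>)) \<partial>\<mu>) = (\<integral>\<omega>. (\<Sum>F\<in>Pow V. g F \<omega> * f (T F \<omega>)) \<partial>\<mu>)"
      using gam by (intro Bochner_Integration.integral_cong) auto
    also have "\<dots> = (\<Sum>F\<in>Pow V. \<integral>\<omega>. g F \<omega> * f (T F \<omega>) \<partial>\<mu>)"
    proof (intro Bochner_Integration.integral_sum integrable_const_bound[of _ C])
      fix F assume F: "F \<in> Pow V"
      show "AE \<omega> in \<mu>. norm (g F \<omega> * f (T F \<omega>)) \<le> C"
      proof (rule AE_I2)
        fix \<omega> assume "\<omega> \<in> space \<mu>"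
        then have "\<bar>f (T F \<omega>)\<bar> \<le> C" using C T_in sp by simp
        then have "\<bar>g F \<omega>\<bar> * \<bar>f (T F \<omega>)\<bar> \<le> 1 * C" using g_bd[of F \<omega>] F by (intro mult_mono) auto
        then show "norm (g F \<omega> * f (T F \<omega>)) \<le> C" by (simp add: abs_mult)
      qed
      show "(\<lambda>\<omega>. g F \<omega> * f (T F \<omega>)) \<in> borel_measurable \<mu>" using g_meas[of F] fT_meas F by (intro borel_measurable_times) auto
    qed
    also have "\<dots> = (\<Sum>F\<in>Pow V. \<integral>\<omega>. indicator (cyl V F) \<omega> * f \<omega> \<partial>\<mu>)" using one by (intro sum.cong) auto
    also have "\<dots> = (\<integral>\<omega>. (\<Sum>F\<in>Pow V. indicator (cyl V F) \<omega> * f \<omega>) \<partial>\<mu>)"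
    proof (intro Bochner_Integration.integral_sum[symmetric] integrable_const_bound[of _ C])
      fix F assume F: "F \<in> Pow V"
      show "AE \<omega> in \<mu>. norm (indicator (cyl V F) \<omega> * f \<omega>) \<le> C"
      proof (rule AE_I2)
        fix \<omega> assume "\<omega> \<in> space \<mu>"
        then have "\<bar>f \<omega>\<bar> \<le> C" using C sp by simp
        then show "norm (indicator (cyl V F) \<omega> * f \<omega>) \<le> C" by (auto simp: indicator_def)
      qed
      show "(\<lambda>\<omega>. indicator (cyl V F) \<omega> * f \<omega>) \<in> borel_measurable \<mu>" using f_meas cyl_meas by measurable
    qed
    also have "\<dots> = (\<integral>\<omega>. f \<omega> \<partial>\<mu>)"
    proof (intro Bochner_Integration.integral_cong refl)
      fix \<omega> assume "\<omega> \<in> space \<mu>"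
      then have "(\<Sum>F\<in>Pow V. indicator (cyl V F) \<omega> * f \<omega>) = (\<Sum>F\<in>Pow V. if F = minus_set \<omega> \<inter> V then f \<omega> else 0)"
        by (intro sum.cong) (auto simp: cyl_def sp indicator_def)
      also have "\<dots> = f \<omega>" using V by (simp add: sum.delta')
      finally show "(\<Sum>F\<in>Pow V. indicator (cyl V F) \<omega> * f \<omega>) = f \<omega>" .
    qed
    finally show ?thesis .
  qed
  then show ?thesis unfolding gibbs_def using \<mu> prob_space_axioms by blast
qed

theorem theorem6p2:
  "\<exists>\<beta>\<^sub>0::real. \<forall>\<beta>\<ge>\<beta>\<^sub>0. \<forall>\<mu>\<in>M_all.
     (\<lambda>n. ereal (1 / (2 * real n + 1)) *
            rel_entropy {- int n..int n} \<mu> (nu_plus \<beta>)) \<longlonglongrightarrow> 0 \<longrightarrow>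
     (\<lambda>n. (\<integral>\<eta>. exp (2 * \<beta> * (\<Sum>i = - int n..int n. 1 - \<eta> i)) \<partial>\<mu>)
            * 2 ^ n * exp (- \<beta> * real n)) \<longlonglongrightarrow> 0 \<longrightarrow>
     \<mu> \<in> gibbs \<beta>"
proof (rule exI[of _ 20], intro allI ballI impI)
  fix \<beta> :: real and \<mu>
  assume \<beta>: "20 \<le> \<beta>" and "\<mu> \<in> M_all"
    and s: "(\<lambda>n. ereal (1 / (2 * real n + 1)) * rel_entropy {- int n..int n} \<mu> (nu_plus \<beta>)) \<longlonglongrightarrow> 0"
  have \<beta>0: "\<beta> \<ge> 0" using \<beta> by simp
  obtain \<alpha> where \<alpha>: "\<alpha> > 1" "\<mu> \<in> M_class \<alpha>" using \<open>\<mu> \<in> M_all\<close> by (auto simp: M_all_def)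
  then have \<mu>: "prob_space \<mu>" "sets \<mu> = sets (configs UNIV)" "translation_invariant \<mu>" by (auto simp: M_class_def)
  have pair: "entropy_pair \<mu> (nu_plus \<beta>)"
  proof (intro entropy_pair.intro entropy_pair_axioms.intro)
    fix D E :: "int set" assume D: "finite D" "E \<subseteq> D"
    show "measure (nu_plus \<beta>) (cyl D E) > 0"
      unfolding nu_plus_props(3)[OF \<beta>0 D] using D by (intro plus_prob_pos[OF \<beta>0]) (auto simp: row_def)
  qed (use \<mu> nu_plus_props[OF \<beta>0] in auto)
  have "(\<lambda>n. ereal (entropy \<mu> (nu_plus \<beta>) {- int n..int n} / (2 * real n + 1))) \<longlonglongrightarrow> ereal 0"
    using s by (simp add: rel_entropy_eq[OF pair] zero_ereal_def)
  then have ent: "(\<lambda>n. entropy \<mu> (nu_plus \<beta>) {- int n..int n} / (2 * real n + 1)) \<longlonglongrightarrow> 0"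
    by (simp add: lim_ereal)
  show "\<mu> \<in> gibbs \<beta>"
    by (rule gibbs_from_spec[OF \<beta>0 \<mu>(1,2)], rule spec_integral[OF \<beta> _ _ _ _ pair translation_invariant_cyl[OF \<mu>(2,3)] ent AE_sparse[OF \<alpha>(2,1)]])
qed

end
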